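(* Let $f:\mathbb{N}\to\mathbb{N}$ be a function. Then $f\in\mathcal{F}$ (i.e. $f$ is a tile counting function) if and only if there exist $r,d\in\mathbb{N}$ and integers $a_{ij},b_{ij},a'_i,b'_i,a''_i,b''_i\in\mathbb{Z}$ ($1\le i\le r$, $1\le j\le d$) such that for all $n\in\mathbb{N}$ $$f(n)=\sum_{(v_1,\ldots,v_d)\in\mathbb{Z}^d}\ \prod_{i=1}^{r}\binom{a_{i1}v_1+\cdots+a_{id}v_d+a'_i n+a''_i}{b_{i1}v_1+\cdots+b_{id}v_d+b'_i n+b''_i},$$ where in particular the sum on the right is required to be finite for every $n$.
   Context: $\mathbb{N}=\{0,1,2,\ldots\}$. Binomial coefficients: for $a,b\in\mathbb{Z}$, $\binom{a}{b}=\frac{a!}{(a-b)!\,b!}$ if $0\le b\le a$; $\binom{-1}{0}=1$; and $\binom{a}{b}=0$ in all other cases. Tile counting functions: A tile is an axis-parallel simply connected closed polygon in $\mathbb{R}^2$ (side lengths may be irrational); tiles are considered up to translation. A tile is tall if it has height exactly $1$. For real $a\ge 0$ let $R_a=[1\times a]$ be the rectangle of height $1$ and length $a$. A tiling of $R_a$ with a finite set of tiles $T$ is a collection of translates of tiles of $T$ (no rotations or reflections) with pairwise disjoint interiors whose union is $R_a$ (for $a=0$ the only tiling is the empty one). For a finite set $T$ of tall tiles and a fixed real $\varepsilon\ge 0$, let $f_{T,\varepsilon}(n)$ be the number of tilings of $R_{n+\varepsilon}$ with $T$, $n\in\mathbb{N}$. $\mathcal{F}$ denotes the set of all functions $f_{T,\varepsilon}:\mathbb{N}\to\mathbb{N}$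 obtained in this way. *)

theory Defs
  imports "HOL-Analysis.Analysis"
begin

text \<open>
  A polygonal region with axis-parallel sides: a finite union of nondegenerate closed
  axis-parallel rectangles whose interior is nonempty and connected (so no pieces that merely
  touch at a corner). Holes are excluded only in the definition of a tile, by simple connectedness;
  together the conditions describe exactly the closed regions bounded by a simple closed
  axis-parallel polygonal curve.
\<close>

definition axis_rectangle :: "(real \<times> real) set \<Rightarrow> bool" where
  "axis_rectangle Q \<longleftrightarrow> (\<exists>a b c d. a < b \<and> c < d \<and> Q = {a..b} \<times> {c..d})"

definition axis_parallel_polygon :: "(real \<times> real) set \<Rightarrow> bool" where
  "axis_parallel_polygon P \<longleftrightarrow>
     P \<noteq> {} \<and> connected (interior P) \<and>
     (\<exists>\<B>. finite \<B> \<and> (\<forall>Q\<in>\<B>. axis_rectangle Q) \<and> P = \<Union>\<B>)"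

definition tile :: "(real \<times> real) set \<Rightarrow> bool" where
  "tile P \<longleftrightarrow> axis_parallel_polygon P \<and> simply_connected P"

definition height :: "(real \<times> real) set \<Rightarrow> real" where
  "height P = Sup (snd ` P) - Inf (snd ` P)"

definition tall :: "(real \<times> real) set \<Rightarrow> bool" where
  "tall P \<longleftrightarrow> height P = 1"

definition strip_rectangle :: "real \<Rightarrow> (real \<times> real) set" where
  "strip_rectangle a = {0..a} \<times> {0..1}"

text \<open>
  A tiling is the set of the placed tiles, so a set \<open>T\<close> containing two translates of the same
  tile yields no additional tilings. The degenerate rectangle of length 0 is a segment; by
  convention its only tiling is the empty one.
\<close>

definition tilings :: "(real \<times> real) set set \<Rightarrow> real \<Rightarrow> (real \<times> real) set set set" where
  "tilings T a =
     (if a = 0 then {{}}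
      else {S. (\<forall>P\<in>S. \<exists>t\<in>T. \<exists>v. P = (+) v ` t) \<and>
               pairwise (\<lambda>P Q. interior P \<inter> interior Q = {}) S \<and>
               \<Union>S = strip_rectangle a})"

definition tile_count :: "(real \<times> real) set set \<Rightarrow> real \<Rightarrow> nat \<Rightarrow> nat" where
  "tile_count T \<epsilon> n = card (tilings T (real n + \<epsilon>))"

definition tile_counting_functions :: "(nat \<Rightarrow> nat) set" where
  "tile_counting_functions =
     {tile_count T \<epsilon> | T \<epsilon>. finite T \<and> (\<forall>t\<in>T. tile t \<and> tall t) \<and> \<epsilon> \<ge> 0}"

text \<open>
  The convention for negative arguments differs from \<open>gchoose\<close>: the only nonzero value with
  a negative upper argument is the one at \<open>(-1, 0)\<close>.
\<close>

definition int_binom :: "int \<Rightarrow> int \<Rightarrow> nat" where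
  "int_binom a b =
     (if 0 \<le> b \<and> b \<le> a then nat a choose nat b
      else if a = -1 \<and> b = 0 then 1
      else 0)"

text \<open>
  Vectors in \<open>\<int>\<^sup>d\<close>, for a dimension \<open>d\<close> that is bound inside the statement, are functions on
  \<open>{1..d}\<close>, extensional outside so that each vector is represented once.
\<close>

definition int_vectors :: "nat \<Rightarrow> (nat \<Rightarrow> int) set" where
  "int_vectors d = {1..d} \<rightarrow>\<^sub>E UNIV"

text \<open>
  For natural-number valued \<open>g\<close>: the sum of \<open>g\<close> over the possibly infinite set \<open>A\<close> is finite
  (i.e. only finitely many terms are nonzero) and has value \<open>s\<close>.
\<close>

definition has_finite_sum :: "('a \<Rightarrow> nat) \<Rightarrow> 'a set \<Rightarrow> nat \<Rightarrow> bool" where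
  "has_finite_sum g A s \<longleftrightarrow>
     finite {x \<in> A. g x \<noteq> 0} \<and> s = (\<Sum>x\<in>{x \<in> A. g x \<noteq> 0}. g x)"

end

theory Submission
  imports Defs
begin

text \<open>
  Tilings to multisums. In a tiling of a strip by tall tiles, every tile runs from the bottom to the
  top, so by the Fashoda theorem the tiles are ordered from left to right, and the region to the left
  of a tile depends on the tile alone. Hence tilings are closed walks in a finite graph whose vertices
  are these regions up to translation and whose edges are the tiles. The number of walks with given
  edge multiplicities is, as in the BEST theorem, a sum over in-trees of products of multinomial
  coefficients, and the condition on the total length is a system of integer linear equations. A sum of
  several multisums is again one, since \<open>int_binom (x + u - 1) x\<close> forces \<open>x = 0\<close> for \<open>u = 0\<close> and only
  \<open>x \<ge> 0\<close> for \<open>u = 1\<close>.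

  Multisums to tilings. A binomial coefficient counts words in two letters, and an integer variable is
  a word in one of two letters, so the multisum counts closed walks with a prescribed total weight in a
  lattice of rank \<open>2 r\<close>. The support of the multisum grows at most linearly with \<open>n\<close>, so that padding
  gives all these walks the same number of edges, which makes room for positive lengths. Rationally
  independent reals turn the weights into lengths, and bumps of different heights on the vertical
  sides of the tiles enforce the incidences of the graph.
\<close>

section \<open>Crossings in the strip\<close>

text \<open>A tiling is constrained through pairs of tiles and their union, a walk only from one
  edge to the next. The bridge is a left region defined from a single tile, as the closure of the
  union of all connected crossings that could come before it: every tiling that contains the tile
  fills exactly this region on its left. Hence equality of consecutive regions already yields order,
  disjointness and covering.

  Conversely, one real number, the total length, has to control everything. An edge gets the length
  \<open>(N + h + weight) / D\<close>, where \<open>h\<close> is an irrational \<open>\<eta>\<close>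
  on edges that leave the base vertex and 0 elsewhere. By rational independence the total length
  then determines the number of edges, the number of rounds and the weight in the lattice. The
  integer \<open>N\<close> is large because weights may be negative while lengths must be positive.
  The price is that all walks counted at \<open>n\<close> need the same number of edges, affine in
  \<open>n\<close>; this is why the linear bound on the support and the padding loops are needed.
  \<open>D\<close> is chosen such that raising \<open>n\<close> by 1 adds length 1, and
  \<open>\<epsilon>\<close> is the target length at \<open>n = 0\<close>.\<close>

definition open_strip :: "(real \<times> real) set" where
  "open_strip = UNIV \<times> {0<..<1}"

text \<open>Germs of vertical segments inside the set rather than boundary points: two tiles may
  share a point of the bottom line, but disjoint sets have disjoint feet. In an open connected set,
  a foot and a head can be joined by a path.\<close>

definition feet :: "(real \<times> real) set \<Rightarrow> real set" where
  "feet A = {x. \<exists>\<delta>>0. \<forall>y. 0 < y \<and> y < \<delta> \<longrightarrow> (x, y) \<in> A}"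

definition heads :: "(real \<times> real) set \<Rightarrow> real set" where
  "heads A = {x. \<exists>\<delta>>0. \<forall>y. 1 - \<delta> < y \<and> y < 1 \<longrightarrow> (x, y) \<in> A}"

lemma feet_mono: "A \<subseteq> B \<Longrightarrow> feet A \<subseteq> feet B"
  unfolding feet_def by blast

lemma heads_mono: "A \<subseteq> B \<Longrightarrow> heads A \<subseteq> heads B"
  unfolding heads_def by blast

lemma feet_disjoint:
  assumes "A \<inter> B = {}" "x \<in> feet A" "y \<in> feet B"
  shows "x \<noteq> y"
proof
  assume "x = y"
  obtain d where d: "d > 0" "\<And>y. 0 < y \<Longrightarrow> y < d \<Longrightarrow> (x, y) \<in> A"
    using assms(2) unfolding feet_def by blast
  obtain e where e: "e > 0" "\<And>y. 0 < y \<Longrightarrow> y < e \<Longrightarrow> (x, y) \<in> B"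
    using assms(3) \<open>x = y\<close> unfolding feet_def by blast
  have "(x, min d e / 2) \<in> A \<inter> B" using d e by auto
  then show False using assms(1) by blast
qed

lemma heads_disjoint:
  assumes "A \<inter> B = {}" "x \<in> heads A" "y \<in> heads B"
  shows "x \<noteq> y"
proof
  assume "x = y"
  obtain d where d: "d > 0" "\<And>y. 1 - d < y \<Longrightarrow> y < 1 \<Longrightarrow> (x, y) \<in> A"
    using assms(2) unfolding heads_def by blast
  obtain e where e: "e > 0" "\<And>y. 1 - e < y \<Longrightarrow> y < 1 \<Longrightarrow> (x, y) \<in> B"
    using assms(3) \<open>x = y\<close> unfolding heads_def by blast
  have "(x, 1 - min d e / 2) \<in> A \<inter> B" using d e by auto
  then show False using assms(1) by blast
qed

lemma segment_vertical:
  "closed_segment (x, a) (x, b) = {x} \<times> closed_segment a (b::real)" for x :: real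
proof -
  have "(1 - u) * x + u * x = x" for u :: real by (simp add: algebra_simps)
  then show ?thesis by (auto simp: closed_segment_def)
qed

lemma segment_horizontal:
  "closed_segment (a, y) (b, y) = closed_segment a (b::real) \<times> {y}" for y :: real
proof -
  have "(1 - u) * y + u * y = y" for u :: real by (simp add: algebra_simps)
  then show ?thesis by (auto simp: closed_segment_def)
qed

lemma spanning_path:
  assumes A: "open A" "connected A" and x: "x \<in> feet A" and x': "x' \<in> heads A"
  obtains p where "path p" "pathstart p = (x, 0)" "pathfinish p = (x', 1)"
    "path_image p \<subseteq> A \<union> {(x, 0), (x', 1)}"
proof -
  obtain d where d: "d > 0" "\<And>y. 0 < y \<Longrightarrow> y < d \<Longrightarrow> (x, y) \<in> A"
    using x unfolding feet_def by blast
  obtain e where e: "e > 0" "\<And>y. 1 - e < y \<Longrightarrow> y < 1 \<Longrightarrow> (x', y) \<in> A"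
    using x' unfolding heads_def by blast
  have "path_connected A" using A connected_open_path_connected by blast
  moreover have "(x, d/2) \<in> A" "(x', 1 - e/2) \<in> A" using d e by auto
  ultimately obtain q where q: "path q" "path_image q \<subseteq> A" "pathstart q = (x, d/2)"
      "pathfinish q = (x', 1 - e/2)"
    unfolding path_connected_def by blast
  have 1: "closed_segment (x, 0) (x, d/2) \<subseteq> A \<union> {(x, 0), (x', 1)}"
  proof
    fix z assume "z \<in> closed_segment (x, 0) (x, d/2)"
    then obtain y where "z = (x, y)" "0 \<le> y" "y \<le> d/2"
      using d(1) by (auto simp: segment_vertical closed_segment_eq_real_ivl)
    then show "z \<in> A \<union> {(x, 0), (x', 1)}" using d(1) d(2)[of y] by (cases "y = 0") auto
  qed
  have 2: "closed_segment (x', 1 - e/2) (x', 1) \<subseteq> A \<union> {(x, 0), (x', 1)}"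
  proof
    fix z assume "z \<in> closed_segment (x', 1 - e/2) (x', 1)"
    then obtain y where "z = (x', y)" "1 - e/2 \<le> y" "y \<le> 1"
      using e(1) by (auto simp: segment_vertical closed_segment_eq_real_ivl)
    then show "z \<in> A \<union> {(x, 0), (x', 1)}" using e(1) e(2)[of y] by (cases "y = 1") auto
  qed
  let ?p = "linepath (x, 0) (x, d/2) +++ q +++ linepath (x', 1 - e/2) (x', 1)"
  show thesis
  proof
    show "path ?p" using q by auto
    show "pathstart ?p = (x, 0)" "pathfinish ?p = (x', 1)" by auto
    show "path_image ?p \<subseteq> A \<union> {(x, 0), (x', 1)}"
      using 1 2 q by (auto simp: path_image_join)
  qed
qed

section \<open>Transfer of the Fashoda theorem to pairs of reals\<close>

definition to_vec :: "real \<times> real \<Rightarrow> real^2" where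
  "to_vec p = vector [fst p, snd p]"

lemma to_vec_nth [simp]: "to_vec p $ 1 = fst p" "to_vec p $ 2 = snd p"
  by (auto simp: to_vec_def)

lemma to_vec_inj: "to_vec p = to_vec q \<Longrightarrow> p = q"
  by (metis to_vec_nth prod.collapse)

lemma continuous_on_to_vec: "continuous_on S to_vec"
proof -
  have "to_vec p = (\<chi> i. if i = 1 then fst p else snd p)" for p
    by (auto simp: vec_eq_iff forall_2)
  moreover have "continuous_on S (\<lambda>p. if i = (1::2) then fst p else snd p :: real)" for i
    by (cases "i = 1") (auto intro: continuous_intros)
  ultimately show ?thesis
    by (subst continuous_on_cong[OF refl, of _ _ "\<lambda>p. \<chi> i. if i = 1 then fst p else snd p"])
      (auto intro: continuous_on_vec_lambda)
qed

lemma fashoda_prod: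
  fixes M :: real and f g :: "real \<Rightarrow> real \<times> real"
  assumes "path f" "path g" "path_image f \<subseteq> {-M..M} \<times> {0..1}" "path_image g \<subseteq> {-M..M} \<times> {0..1}"
    and "fst (pathstart f) = -M" "fst (pathfinish f) = M" "snd (pathstart g) = 0" "snd (pathfinish g) = 1"
  shows "path_image f \<inter> path_image g \<noteq> {}"
proof -
  have c: "to_vec ` S \<subseteq> cbox (to_vec (-M, 0)) (to_vec (M, 1))" if "S \<subseteq> {-M..M} \<times> {0..1}" for S
    using that by (auto simp: mem_box_cart forall_2)
  have "path (to_vec \<circ> f)" "path (to_vec \<circ> g)"
    using assms by (auto intro!: path_continuous_image continuous_on_to_vec)
  then obtain z where "z \<in> path_image (to_vec \<circ> f)" "z \<in> path_image (to_vec \<circ> g)"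
    using assms by (rule_tac fashoda[of "to_vec \<circ> f" "to_vec \<circ> g" "to_vec (-M, 0)" "to_vec (M, 1)"])
      (auto simp: path_image_compose c pathstart_compose pathfinish_compose)
  then obtain p q where "p \<in> path_image f" "q \<in> path_image g" "to_vec p = to_vec q"
    by (auto simp: path_image_compose)
  then show ?thesis using to_vec_inj by blast
qed

text \<open>By the Fashoda theorem: if the heads were in the opposite order, then a path in \<open>A\<close>,
  prolonged to the left along the bottom and to the right along the top, would meet a path in \<open>B\<close>.\<close>

lemma heads_ordered_as_feet:
  assumes A: "open A" "connected A" "A \<subseteq> open_strip" and B: "open B" "connected B" "B \<subseteq> open_strip"
    and dis: "A \<inter> B = {}"
    and x: "x \<in> feet A" "x' \<in> heads A" and y: "y \<in> feet B" "y' \<in> heads B" and "x < y"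
  shows "x' < y'"
proof (rule ccontr)
  assume "\<not> x' < y'"
  moreover have "x' \<noteq> y'" using heads_disjoint dis x y by blast
  ultimately have lt: "y' < x'" by simp
  obtain p where p: "path p" "pathstart p = (x, 0)" "pathfinish p = (x', 1)"
    "path_image p \<subseteq> A \<union> {(x, 0), (x', 1)}" using spanning_path[OF A(1,2) x] by blast
  obtain q where q: "path q" "pathstart q = (y, 0)" "pathfinish q = (y', 1)"
    "path_image q \<subseteq> B \<union> {(y, 0), (y', 1)}" using spanning_path[OF B(1,2) y] by blast
  have "bounded (path_image p \<union> path_image q)"
    using p q by (auto intro: bounded_path_image)
  then obtain M where M: "M > 0" "\<And>z. z \<in> path_image p \<union> path_image q \<Longrightarrow> norm z \<le> M"
    by (auto simp: bounded_pos)
  have M': "fst z \<in> {-M..M}" if "z \<in> path_image p \<union> path_image q" for z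
    using M(2)[OF that] norm_fst_le[of "fst z" "snd z"] by (auto simp: abs_le_iff)
  have xM: "x \<in> {-M..M}" "x' \<in> {-M..M}"
    using M'[of "(x, 0)"] M'[of "(x', 1)"] p(2,3) pathstart_in_path_image[of p] pathfinish_in_path_image[of p]
    by auto
  define f where "f = linepath (-M, 0) (x, 0) +++ p +++ linepath (x', 1) (M, 1)"
  have imf: "path_image f \<subseteq> {-M..x} \<times> {0} \<union> path_image p \<union> {x'..M} \<times> {1}"
    using xM p unfolding f_def
    by (auto simp: path_image_join segment_horizontal closed_segment_eq_real_ivl)
  have strip: "snd z \<in> {0..1}" if "z \<in> path_image p \<union> path_image q" for z
    
  proof -
    have "z \<in> A \<union> B \<union> {(x, 0), (x', 1), (y, 0), (y', 1)}" using that p(4) q(4) by blast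
    moreover have "snd z \<in> {0<..<1}" if "z \<in> A \<union> B"
      using that A(3) B(3) by (auto simp: open_strip_def mem_Times_iff)
    ultimately show ?thesis by (cases "z \<in> A \<union> B") auto
  qed
  have "path_image f \<inter> path_image q \<noteq> {}"
  proof (rule fashoda_prod)
    show "path f" using p unfolding f_def by auto
    show "path_image f \<subseteq> {-M..M} \<times> {0..1}"
    proof
      fix z assume "z \<in> path_image f"
      then consider "z \<in> {-M..x} \<times> {0}" | "z \<in> path_image p" | "z \<in> {x'..M} \<times> {1}"
        using imf by blast
      then show "z \<in> {-M..M} \<times> {0..1}"
        using M'[of z] strip[of z] xM by cases (auto simp: mem_Times_iff)
    qed
    show "path_image q \<subseteq> {-M..M} \<times> {0..1}"
    proof
      fix z assume "z \<in> path_image q"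
      then show "z \<in> {-M..M} \<times> {0..1}" using M'[of z] strip[of z] by (simp add: mem_Times_iff)
    qed
  qed (use q in \<open>auto simp: f_def\<close>)
  then obtain z where z: "z \<in> path_image f" "z \<in> path_image q" by blast
  have *: "(u, 0) \<notin> A \<union> B" "(u, 1) \<notin> A \<union> B" for u :: real
    using A B by (auto simp: open_strip_def)
  \<comment> \<open>The path \<open>q\<close> meets the bottom line only at \<open>y > x\<close> and
    the top line only at \<open>y' < x'\<close>, so it misses both prolongations; elsewhere it stays
    in \<open>B\<close>, away from \<open>A\<close>.\<close>
  have "z \<in> {-M..x} \<times> {0} \<union> A \<union> {(x, 0), (x', 1)} \<union> {x'..M} \<times> {1}"
    using z imf p by blast
  moreover have "z \<in> B \<union> {(y, 0), (y', 1)}" using z q by blast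
  ultimately show False using dis * lt \<open>x < y\<close> by auto
qed

section \<open>The region to the left of a piece\<close>

text \<open>Regular closed sets with connected interior that reach both sides of the strip. They may
  be unbounded, so that the half strips beyond the two ends of a rectangle are pieces as
  well.\<close>

definition piece :: "(real \<times> real) set \<Rightarrow> bool" where
  "piece A \<longleftrightarrow> closed A \<and> A \<subseteq> UNIV \<times> {0..1} \<and> A \<subseteq> closure (interior A) \<and>
     connected (interior A) \<and> feet (interior A) \<noteq> {} \<and> heads (interior A) \<noteq> {}"

lemma piece_interior_strip: "piece A \<Longrightarrow> interior A \<subseteq> open_strip"
  using interior_mono[of A "UNIV \<times> {0..1}"]
  by (auto simp: piece_def open_strip_def interior_Times)

lemma piece_interior_nonempty: "piece A \<Longrightarrow> interior A \<noteq> {}"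
proof -
  assume "piece A"
  then obtain x where "x \<in> feet (interior A)" unfolding piece_def by blast
  then obtain d where "d > 0" "\<forall>y. 0 < y \<and> y < d \<longrightarrow> (x, y) \<in> interior A" unfolding feet_def by blast
  then have "(x, d/2) \<in> interior A" by auto
  then show ?thesis by blast
qed

definition precedes :: "(real \<times> real) set \<Rightarrow> (real \<times> real) set \<Rightarrow> bool" where
  "precedes P Q \<longleftrightarrow> (\<exists>x\<in>feet (interior P). \<exists>y\<in>feet (interior Q). x < y)"

lemma precedes_heads:
  assumes "piece P" "piece Q" "interior P \<inter> interior Q = {}" "precedes P Q"
    "x \<in> heads (interior P)" "y \<in> heads (interior Q)"
  shows "x < y"
  using assms heads_ordered_as_feet[of "interior P" "interior Q"] piece_interior_strip
  unfolding precedes_def piece_def by (meson open_interior)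

lemma precedes_asym:
  assumes "piece P" "piece Q" "interior P \<inter> interior Q = {}" "precedes P Q"
  shows "\<not> precedes Q P"
proof
  assume "precedes Q P"
  moreover obtain x y where "x \<in> heads (interior P)" "y \<in> heads (interior Q)"
    using assms unfolding piece_def by blast
  ultimately have "x < y" "y < x"
    using precedes_heads[OF assms] precedes_heads[of Q P] assms by (auto simp: Int_commute)
  then show False by simp
qed

lemma precedes_total:
  assumes "piece P" "piece Q" "interior P \<inter> interior Q = {}"
  shows "precedes P Q \<or> precedes Q P"
proof -
  obtain x y where "x \<in> feet (interior P)" "y \<in> feet (interior Q)"
    using assms unfolding piece_def by blast
  moreover from this have "x \<noteq> y" using feet_disjoint assms(3) by blast
  ultimately show ?thesis unfolding precedes_def by (meson linorder_neqE)
qed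

lemma precedes_feet:
  assumes "piece P" "piece Q" "interior P \<inter> interior Q = {}" "precedes P Q"
    "x \<in> feet (interior P)" "y \<in> feet (interior Q)"
  shows "x < y"
  using precedes_asym[OF assms(1-4)] feet_disjoint[OF assms(3,5,6)] assms(5,6)
  unfolding precedes_def by (meson linorder_neqE)

text \<open>Candidates for the interior of a piece before \<open>P\<close>, described without any
  tiling. They have a foot and a head so that the order of crossings applies to them.\<close>

definition left_cover :: "(real \<times> real) set \<Rightarrow> (real \<times> real) set \<Rightarrow> bool" where
  "left_cover P A \<longleftrightarrow> open A \<and> connected A \<and> A \<subseteq> open_strip \<and> A \<inter> interior P = {} \<and>
     heads A \<noteq> {} \<and> (\<exists>x\<in>feet A. \<exists>y\<in>feet (interior P). x < y)"

text \<open>The union collects all conceivable predecessors of \<open>P\<close>; the closure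
  restores the boundaries of the closed pieces.\<close>

definition left_region :: "(real \<times> real) set \<Rightarrow> (real \<times> real) set" where
  "left_region P = closure (\<Union>{A. left_cover P A})"

text \<open>Otherwise \<open>A \<union> B\<close> would be connected and disjoint from the interior
  of \<open>P\<close>, with a foot to the left of a foot of \<open>P\<close> and a head to the right
  of a head of \<open>P\<close>, against \<open>heads_ordered_as_feet\<close>.\<close>

lemma left_cover_avoids:
  assumes "piece P" "left_cover P A" and B: "open B" "connected B" "B \<subseteq> open_strip"
    "B \<inter> interior P = {}" and x: "x \<in> heads B" "y \<in> heads (interior P)" "y < x"
  shows "A \<inter> B = {}"
proof (rule ccontr)
  assume "A \<inter> B \<noteq> {}"
  then have "connected (A \<union> B)" using assms connected_Un unfolding left_cover_def by blast
  moreover have "x \<in> heads (A \<union> B)" using x heads_mono by blast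
  moreover obtain u v where "u \<in> feet A" "v \<in> feet (interior P)" "u < v"
    using assms(2) unfolding left_cover_def by blast
  moreover have "feet A \<subseteq> feet (A \<union> B)" by (simp add: feet_mono)
  ultimately have "x < y"
    using heads_ordered_as_feet[of "A \<union> B" "interior P" u x v y] assms piece_interior_strip[OF assms(1)]
    unfolding left_cover_def piece_def by blast
  then show False using x by simp
qed

lemma left_cover_avoids_later:
  assumes "piece P" "piece Q" "interior P \<inter> interior Q = {}" "precedes P Q" "left_cover P A"
  shows "A \<inter> interior Q = {}"
proof -
  obtain x y where xy: "x \<in> heads (interior P)" "y \<in> heads (interior Q)"
    using assms unfolding piece_def by blast
  show ?thesis
  proof (rule left_cover_avoids[OF assms(1,5) _ _ _ _ xy(2,1)])
    show "connected (interior Q)" using assms(2) unfolding piece_def by blast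
    show "interior Q \<subseteq> open_strip" using piece_interior_strip[OF assms(2)] .
    show "interior Q \<inter> interior P = {}" using assms(3) by blast
    show "x < y" using precedes_heads[OF assms(1-4)] xy by blast
  qed simp
qed

lemma left_cover_precedes:
  assumes "piece P" "piece Q" "interior P \<inter> interior Q = {}" "precedes Q P"
  shows "left_cover P (interior Q)"
  using assms piece_interior_strip[OF assms(2)]
  unfolding left_cover_def piece_def precedes_def by blast

lemma left_region_disjoint: "interior P \<inter> left_region P = {}"
proof -
  have "interior P \<inter> \<Union>{A. left_cover P A} = {}" unfolding left_cover_def by blast
  then show ?thesis
    unfolding left_region_def by (simp only: open_Int_closure_eq_empty[OF open_interior])
qed

text \<open>The local test that replaces the pairwise conditions of a tiling. If \<open>Q\<close>
  came after \<open>P\<close>, every left cover of \<open>P\<close> would avoid the nonempty open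
  interior of \<open>Q\<close>, and so would the closure of their union.\<close>

lemma subset_left_region_precedes:
  assumes "piece P" "piece Q" "Q \<subseteq> left_region P"
  shows "interior P \<inter> interior Q = {}" "precedes Q P"
proof -
  show dis: "interior P \<inter> interior Q = {}"
    using left_region_disjoint[of P] assms(3) interior_subset[of Q] by blast
  show "precedes Q P"
  proof (rule ccontr)
    assume "\<not> precedes Q P"
    then have "precedes P Q" using precedes_total[OF assms(1,2) dis] by blast
    then have "interior Q \<inter> \<Union>{A. left_cover P A} = {}"
      using left_cover_avoids_later[OF assms(1,2) dis] by blast
    then have "interior Q \<inter> left_region P = {}"
      using open_Int_closure_eq_empty[OF open_interior] unfolding left_region_def by blast
    then show False using assms(3) interior_subset[of Q] piece_interior_nonempty[OF assms(2)] by blast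
  qed
qed

text \<open>Tilings of the infinite strip: those of a rectangle are completed by two half strips, so
  that the ends are treated like boundaries between tiles.\<close>

definition strip_tiling :: "(real \<times> real) set set \<Rightarrow> bool" where
  "strip_tiling S \<longleftrightarrow> finite S \<and> (\<forall>P\<in>S. piece P) \<and>
     pairwise (\<lambda>P Q. interior P \<inter> interior Q = {}) S \<and> \<Union>S = UNIV \<times> {0..1}"

text \<open>The interiors of the predecessors are left covers, which gives one inclusion. For the
  other, a left cover avoids the interiors of all remaining pieces; these are dense in the remaining
  pieces, so the open set that is left after removing the closed union of the predecessors has to be
  empty.\<close>

lemma left_region_eq:
  assumes S: "strip_tiling S" "P \<in> S"
  shows "left_region P = \<Union>{Q \<in> S. Q \<noteq> P \<and> precedes Q P}"
proof -
  have p: "piece Q" if "Q \<in> S" for Q using S that unfolding strip_tiling_def by blast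
  have dis: "interior P \<inter> interior Q = {}" if "Q \<in> S" "Q \<noteq> P" for Q
    using S that unfolding strip_tiling_def pairwise_def by blast
  have irr: "\<not> precedes P Q" if "precedes Q P" "Q \<in> S" "Q \<noteq> P" for Q
    using precedes_asym dis that p S by blast
  let ?U = "\<Union>{Q \<in> S. Q \<noteq> P \<and> precedes Q P}"
  have clo: "closed ?U" using S p unfolding strip_tiling_def piece_def by (intro closed_Union) auto
  have "A \<subseteq> ?U" if A: "left_cover P A" for A
  proof -
    let ?W = "\<Union>{interior Q |Q. Q \<in> S \<and> \<not> (Q \<noteq> P \<and> precedes Q P)}"
    have "A \<inter> interior Q = {}" if "Q \<in> S" "\<not> (Q \<noteq> P \<and> precedes Q P)" for Q
    proof (cases "Q = P")
      case True
      then show ?thesis using A unfolding left_cover_def by blast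
    next
      case False
      then show ?thesis
        using left_cover_avoids_later[OF _ _ _ _ A] precedes_total p dis that S by blast
    qed
    then have "A \<inter> ?W = {}" by blast
    moreover have "open (A - ?U)" using A clo unfolding left_cover_def by blast
    ultimately have "(A - ?U) \<inter> closure ?W = {}"
      using open_Int_closure_eq_empty[of "A - ?U" ?W] by blast
    moreover have "A - ?U \<subseteq> closure ?W"
    proof
      fix z assume z: "z \<in> A - ?U"
      then have "z \<in> \<Union>S" using A S unfolding left_cover_def open_strip_def strip_tiling_def by force
      then obtain Q where Q: "Q \<in> S" "z \<in> Q" by blast
      then have "\<not> (Q \<noteq> P \<and> precedes Q P)" using z by blast
      then have "interior Q \<subseteq> ?W" using Q by blast
      moreover have "z \<in> closure (interior Q)" using p Q unfolding piece_def by blast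
      ultimately show "z \<in> closure ?W" using closure_mono by blast
    qed
    ultimately show ?thesis by blast
  qed
  then have "left_region P \<subseteq> ?U"
    unfolding left_region_def by (intro closure_minimal clo) blast
  moreover have "?U \<subseteq> left_region P"
  proof
    fix z assume "z \<in> ?U"
    then obtain Q where Q: "Q \<in> S" "Q \<noteq> P" "precedes Q P" "z \<in> Q" by blast
    then have "interior Q \<subseteq> \<Union>{A. left_cover P A}"
      using left_cover_precedes p dis S by blast
    then have "closure (interior Q) \<subseteq> left_region P"
      unfolding left_region_def by (rule closure_mono)
    then show "z \<in> left_region P" using Q p unfolding piece_def by blast
  qed
  ultimately show ?thesis by blast
qed

section \<open>Half strips and bounds for left regions\<close>

definition left_strip :: "real \<Rightarrow> (real \<times> real) set" where
  "left_strip a = {..a} \<times> {0..1}"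

definition right_strip :: "real \<Rightarrow> (real \<times> real) set" where
  "right_strip a = {a..} \<times> {0..1}"

lemma interior_left_strip: "interior (left_strip a) = {..<a} \<times> {0<..<1}"
  by (simp add: left_strip_def interior_Times)

lemma interior_right_strip: "interior (right_strip a) = {a<..} \<times> {0<..<1}"
  by (simp add: right_strip_def interior_Times)

lemma feet_Times: "feet (I \<times> {0<..<1}) = I" "heads (I \<times> {0<..<1}) = I"
proof -
  have "x \<in> feet (I \<times> {0<..<1}) \<longleftrightarrow> x \<in> I" for x
  proof
    assume "x \<in> feet (I \<times> {0<..<1})"
    then obtain d where "d > 0" "\<And>y. 0 < y \<Longrightarrow> y < d \<Longrightarrow> (x, y) \<in> I \<times> {0<..<1::real}"
      unfolding feet_def mem_Collect_eq by metis
    from this(2)[of "d/2"] this(1) show "x \<in> I" by simp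
  next
    assume "x \<in> I" then show "x \<in> feet (I \<times> {0<..<1})" by (auto simp: feet_def intro!: exI[of _ 1])
  qed
  then show "feet (I \<times> {0<..<1}) = I" by blast
  have "x \<in> heads (I \<times> {0<..<1}) \<longleftrightarrow> x \<in> I" for x
  proof
    assume "x \<in> heads (I \<times> {0<..<1})"
    then obtain d where "d > 0" "\<And>y. 1 - d < y \<Longrightarrow> y < 1 \<Longrightarrow> (x, y) \<in> I \<times> {0<..<1::real}"
      unfolding heads_def mem_Collect_eq by metis
    from this(2)[of "1 - d/2"] this(1) show "x \<in> I" by simp
  next
    assume "x \<in> I" then show "x \<in> heads (I \<times> {0<..<1})" by (auto simp: heads_def intro!: exI[of _ 1])
  qed
  then show "heads (I \<times> {0<..<1}) = I" by blast
qed

lemma piece_left_strip [simp]: "piece (left_strip a)"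
proof -
  have "closure ({..<a} \<times> {0<..<1::real}) = {..a} \<times> {0..1}"
    by (simp add: closure_Times)
  moreover have "connected ({..<a} \<times> {0<..<1::real})" by (intro connected_Times) auto
  ultimately show ?thesis
    unfolding piece_def interior_left_strip feet_Times
    by (auto simp: left_strip_def closed_Times)
qed

lemma piece_right_strip [simp]: "piece (right_strip a)"
proof -
  have "closure ({a<..} \<times> {0<..<1::real}) = {a..} \<times> {0..1}"
    by (simp add: closure_Times)
  moreover have "connected ({a<..} \<times> {0<..<1::real})" by (intro connected_Times) auto
  ultimately show ?thesis
    unfolding piece_def interior_right_strip feet_Times
    by (auto simp: right_strip_def closed_Times)
qed

lemma feet_in_piece:
  assumes "x \<in> feet (interior P)" shows "\<exists>y. (x, y) \<in> P \<and> y < 1/2"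
proof -
  obtain d where "d > 0" "\<forall>y. 0 < y \<and> y < d \<longrightarrow> (x, y) \<in> interior P" using assms unfolding feet_def by blast
  then have "(x, min d (1/2) / 2) \<in> interior P" by auto
  then show ?thesis using interior_subset by (intro exI[of _ "min d (1/2) / 2"]) auto
qed

lemma heads_in_piece:
  assumes "x \<in> heads (interior P)" shows "\<exists>y. (x, y) \<in> P"
proof -
  obtain d where "d > 0" "\<forall>y. 1 - d < y \<and> y < 1 \<longrightarrow> (x, y) \<in> interior P" using assms unfolding heads_def by blast
  then have "(x, 1 - d/2) \<in> interior P" by auto
  then show ?thesis using interior_subset by blast
qed

text \<open>The open half strip to the right of \<open>c\<close> is connected and has heads to the
  right of those of \<open>P\<close>, so no left cover of \<open>P\<close> can meet it.\<close>

lemma left_region_upper: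
  assumes P: "piece P" and c: "\<And>z. z \<in> P \<Longrightarrow> fst z \<le> c"
  shows "left_region P \<subseteq> left_strip c"
proof -
  let ?B = "{c<..} \<times> {0<..<1::real}"
  have A: "A \<subseteq> left_strip c" if A: "left_cover P A" for A
  proof -
    obtain y where y: "y \<in> heads (interior P)" using P unfolding piece_def by blast
    then have "y \<le> c" using heads_in_piece c by fastforce
    then have "c + 1 \<in> heads ?B" "y < c + 1" by (auto simp: feet_Times)
    moreover have "?B \<inter> interior P = {}" using interior_subset[of P] c by fastforce
    moreover have "connected ?B" by (intro connected_Times) auto
    moreover have "open ?B" by (intro open_Times) auto
    ultimately have "A \<inter> ?B = {}"
      using left_cover_avoids[OF P A, of ?B "c + 1" y] y by (auto simp: open_strip_def)
    then show ?thesis using A unfolding left_cover_def open_strip_def left_strip_def by force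
  qed
  have "closed (left_strip c)" using piece_left_strip piece_def by blast
  then show ?thesis unfolding left_region_def using A by (intro closure_minimal) auto
qed

lemma left_region_lower:
  assumes P: "piece P" and c: "\<And>z. z \<in> P \<Longrightarrow> c \<le> fst z"
  shows "left_strip c \<subseteq> left_region P"
proof -
  have "interior (left_strip c) \<inter> interior P = {}"
    using interior_subset[of P] c unfolding interior_left_strip by fastforce
  moreover have "precedes (left_strip c) P"
  proof -
    obtain y where y: "y \<in> feet (interior P)" using P unfolding piece_def by blast
    then have "c \<le> y" using feet_in_piece c by fastforce
    then show ?thesis unfolding precedes_def interior_left_strip feet_Times
      using y by (intro bexI[of _ "c - 1"] bexI[of _ y]) auto
  qed
  ultimately have "left_cover P (interior (left_strip c))"
    using left_cover_precedes[OF P piece_left_strip] by blast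
  then have "closure (interior (left_strip c)) \<subseteq> left_region P"
    unfolding left_region_def by (intro closure_mono) blast
  then show ?thesis using piece_left_strip unfolding piece_def by blast
qed

section \<open>Horizontal translations\<close>

definition shift :: "real \<Rightarrow> (real \<times> real) set \<Rightarrow> (real \<times> real) set" where
  "shift s A = (+) (s, 0) ` A"

lemma mem_shift: "(x, y) \<in> shift s A \<longleftrightarrow> (x - s, y) \<in> A"
  unfolding shift_def by (force simp: image_iff)

lemma shift_0 [simp]: "shift 0 A = A"
  by (auto simp: mem_shift)

lemma shift_shift [simp]: "shift s (shift t A) = shift (s + t) A"
  by (auto simp: mem_shift diff_diff_eq)

lemma shift_Un: "shift s (A \<union> B) = shift s A \<union> shift s B"
  unfolding shift_def by blast

lemma interior_shift: "interior (shift s A) = shift s (interior A)"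
  unfolding shift_def by (rule interior_translation)

lemma closure_shift: "closure (shift s A) = shift s (closure A)"
  unfolding shift_def by (rule closure_translation)

lemma connected_shift: "connected A \<Longrightarrow> connected (shift s A)"
  unfolding shift_def by (intro connected_continuous_image continuous_intros)

lemma feet_shift: "feet (shift s A) = (+) s ` feet A"
proof -
  have "x \<in> feet (shift s A) \<longleftrightarrow> x - s \<in> feet A" for x unfolding feet_def by (simp add: mem_shift)
  then show ?thesis by (force simp: image_iff)
qed

lemma heads_shift: "heads (shift s A) = (+) s ` heads A"
proof -
  have "x \<in> heads (shift s A) \<longleftrightarrow> x - s \<in> heads A" for x unfolding heads_def by (simp add: mem_shift)
  then show ?thesis by (force simp: image_iff)
qed

lemma left_cover_shift:
  assumes "left_cover P A" shows "left_cover (shift s P) (shift s A)"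
proof -
  have "open (shift s A)" "connected (shift s A)"
    using assms open_translation connected_shift unfolding left_cover_def
    by (auto simp: shift_def)
  moreover have "shift s A \<subseteq> open_strip" using assms unfolding left_cover_def open_strip_def
    by (auto simp: mem_shift)
  moreover have "shift s A \<inter> shift s (interior P) = {}"
    using assms unfolding left_cover_def by (auto simp: mem_shift)
  ultimately show ?thesis using assms
    unfolding left_cover_def interior_shift feet_shift heads_shift by fastforce
qed

lemma left_region_shift: "left_region (shift s P) = shift s (left_region P)"
proof -
  have "{A. left_cover (shift s P) A} = shift s ` {A. left_cover P A}"
  proof -
    have "\<exists>B. left_cover P B \<and> A = shift s B" if "left_cover (shift s P) A" for A
      using left_cover_shift[OF that, of "- s"] by (intro exI[of _ "shift (-s) A"]) simp
    then show ?thesis using left_cover_shift by blast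
  qed
  moreover have "\<Union> (shift s ` F) = shift s (\<Union>F)" for F unfolding shift_def by blast
  ultimately show ?thesis unfolding left_region_def closure_shift[symmetric] by simp
qed

lemma piece_shift: "piece P \<Longrightarrow> piece (shift s P)"
proof -
  assume P: "piece P"
  have "closed (shift s P)" "connected (shift s (interior P))"
    using P closed_translation connected_shift unfolding piece_def
    by (auto simp: shift_def)
  moreover have "shift s P \<subseteq> UNIV \<times> {0..1}" "shift s P \<subseteq> shift s (closure (interior P))"
    using P unfolding piece_def by (auto simp: mem_shift)
  ultimately show ?thesis using P
    unfolding piece_def interior_shift feet_shift heads_shift closure_shift by blast
qed

text \<open>\<open>U\<close> is the region covered before the list is placed and \<open>V\<close>
  the region covered afterwards. Each piece is tested only against what is covered at its
  turn.\<close>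

fun region_chain :: "(real \<times> real) set \<Rightarrow> (real \<times> real) set list \<Rightarrow> (real \<times> real) set \<Rightarrow> bool" where
  "region_chain U [] V \<longleftrightarrow> U = V"
| "region_chain U (P # Ps) V \<longleftrightarrow> left_region P = U \<and> region_chain (U \<union> P) Ps V"

lemma region_chain_iff:
  "region_chain U Ps V \<longleftrightarrow> V = U \<union> \<Union>(set Ps) \<and>
     (\<forall>i<length Ps. left_region (Ps ! i) = U \<union> \<Union>(set (take i Ps)))"
proof (induction Ps arbitrary: U)
  case (Cons P Ps)
  have "(\<forall>i<length (P # Ps). left_region ((P # Ps) ! i) = U \<union> \<Union>(set (take i (P # Ps)))) \<longleftrightarrow>
      left_region P = U \<and> (\<forall>i<length Ps. left_region (Ps ! i) = U \<union> P \<union> \<Union>(set (take i Ps)))"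
    by (simp add: All_less_Suc2 Un_assoc)
  then show ?case using Cons by (auto simp: Un_assoc)
qed auto

section \<open>Tilings of the strip as chains of regions\<close>

text \<open>An arbitrary choice suffices: by \<open>precedes_feet\<close> every foot of an earlier
  piece is to the left of every foot of a later one.\<close>

definition foot :: "(real \<times> real) set \<Rightarrow> real" where
  "foot P = (SOME x. x \<in> feet (interior P))"

lemma foot_in_feet: "piece P \<Longrightarrow> foot P \<in> feet (interior P)"
  unfolding foot_def piece_def by (simp add: some_in_eq)

lemma precedes_iff_foot:
  assumes "piece P" "piece Q" "interior P \<inter> interior Q = {}"
  shows "precedes P Q \<longleftrightarrow> foot P < foot Q"
  using precedes_feet[OF assms] foot_in_feet assms(1,2) unfolding precedes_def by blast

lemma precedes_left_strip:
  assumes "piece P" "interior (left_strip c) \<inter> interior P = {}"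
  shows "precedes (left_strip c) P"
proof -
  have "c \<le> foot P"
    using feet_disjoint[OF assms(2), of "foot P" "foot P"] foot_in_feet[OF assms(1)]
    unfolding interior_left_strip feet_Times by force
  then show ?thesis using foot_in_feet[OF assms(1)]
    unfolding precedes_def interior_left_strip feet_Times
    by (intro bexI[of _ "c - 1"] bexI[of _ "foot P"]) auto
qed

lemma precedes_right_strip:
  assumes "piece P" "interior P \<inter> interior (right_strip c) = {}"
  shows "precedes P (right_strip c)"
proof -
  have "foot P \<le> c"
    using feet_disjoint[OF assms(2), of "foot P" "foot P"] foot_in_feet[OF assms(1)]
    unfolding interior_right_strip feet_Times by force
  then show ?thesis using foot_in_feet[OF assms(1)]
    unfolding precedes_def interior_right_strip feet_Times
    by (intro bexI[of _ "c + 1"] bexI[of _ "foot P"]) auto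
qed

lemma left_strip_Un_right_strip: "left_strip a \<union> right_strip a = UNIV \<times> {0..1}"
  by (auto simp: left_strip_def right_strip_def)

lemma interior_left_right: "interior (left_strip a) \<inter> interior (right_strip a) = {}"
  by (auto simp: interior_left_strip interior_right_strip)

lemma left_strip_neq_right_strip: "left_strip a \<noteq> right_strip b"
proof -
  have "(min a b - 1, 0) \<in> left_strip a" "(min a b - 1, 0) \<notin> right_strip b"
    by (auto simp: left_strip_def right_strip_def)
  then show ?thesis by blast
qed

lemma left_region_right_strip: "left_region (right_strip a) = left_strip a"
proof -
  have "strip_tiling {left_strip a, right_strip a}"
    using interior_left_right[of a]
    by (auto simp: strip_tiling_def pairwise_def left_strip_Un_right_strip)
  then have "left_region (right_strip a) =
      \<Union>{Q \<in> {left_strip a, right_strip a}. Q \<noteq> right_strip a \<and> precedes Q (right_strip a)}"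
    by (rule left_region_eq) simp
  also have "{Q \<in> {left_strip a, right_strip a}. Q \<noteq> right_strip a \<and> precedes Q (right_strip a)} = {left_strip a}"
    using precedes_right_strip[OF piece_left_strip interior_left_right] left_strip_neq_right_strip by auto
  finally show ?thesis by simp
qed

text \<open>An earlier piece is contained in the left region of a later one, where
  \<open>subset_left_region_precedes\<close> applies.\<close>

lemma region_chain_disjoint:
  assumes chain: "region_chain U Ps V" and p: "\<And>P. P \<in> set Ps \<Longrightarrow> piece P" and ij: "i < j" "j < length Ps"
  shows "interior (Ps ! i) \<inter> interior (Ps ! j) = {}" "foot (Ps ! i) < foot (Ps ! j)"
proof -
  have "Ps ! i \<in> set (take j Ps)" using ij by (auto simp: in_set_conv_nth intro!: exI[of _ i])
  then have sub: "Ps ! i \<subseteq> left_region (Ps ! j)" using chain ij unfolding region_chain_iff by auto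
  have pp: "piece (Ps ! i)" "piece (Ps ! j)" using p ij by auto
  show dis: "interior (Ps ! i) \<inter> interior (Ps ! j) = {}"
    using subset_left_region_precedes(1)[OF pp(2,1) sub] by blast
  show "foot (Ps ! i) < foot (Ps ! j)"
    using subset_left_region_precedes(2)[OF pp(2,1) sub] precedes_iff_foot[OF pp dis] by blast
qed

lemma region_chain_foot_sorted:
  assumes "region_chain U Ps V" "\<And>P. P \<in> set Ps \<Longrightarrow> piece P"
  shows "sorted_wrt (<) (map foot Ps)"
  using region_chain_disjoint(2)[OF assms] by (auto simp: sorted_wrt_iff_nth_less)

text \<open>The feet increase strictly along a chain, so sorting by them recovers the list from the
  set.\<close>

lemma region_chain_unique:
  assumes "region_chain U Ps V" "region_chain U Qs V" "set Ps = set Qs" "\<And>P. P \<in> set Ps \<Longrightarrow> piece P"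
  shows "Ps = Qs"
proof -
  have s: "sorted_wrt (<) (map foot Ps)" "sorted_wrt (<) (map foot Qs)"
    using region_chain_foot_sorted assms by blast+
  then have eq: "map foot Ps = map foot Qs"
    using strict_sorted_equal[of "map foot Ps" "map foot Qs"] assms(3) by simp
  have "inj_on foot (set Ps)"
    using s(1) by (metis distinct_map strict_sorted_iff)
  then show ?thesis using eq assms(3) map_inj_on[of foot Ps Qs] by simp
qed

text \<open>Disjointness is a conclusion here: the left region of a piece contains the left half
  strip and all earlier pieces and misses the interior of the piece itself. The right half strip is
  disjoint from the rest because everything else lies in \<open>left_strip a\<close>.\<close>

lemma region_chain_imp_tiling:
  assumes chain: "region_chain (left_strip 0) Ps (left_strip a)" and p: "\<And>P. P \<in> set Ps \<Longrightarrow> piece P"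
  shows "strip_tiling ({left_strip 0, right_strip a} \<union> set Ps)"
proof -
  have U: "left_strip a = left_strip 0 \<union> \<Union>(set Ps)" using chain unfolding region_chain_iff by blast
  have r: "interior P \<inter> interior (right_strip a) = {}" if "P \<in> insert (left_strip 0) (set Ps)" for P
    using interior_mono[of P "left_strip a"] that U interior_left_right[of a] by blast
  have l: "interior (left_strip 0) \<inter> interior P = {}" if "P \<in> set Ps" for P
  proof -
    obtain i where "i < length Ps" "P = Ps ! i" using \<open>P \<in> set Ps\<close> by (metis in_set_conv_nth)
    then have "left_strip 0 \<subseteq> left_region P" using chain unfolding region_chain_iff by blast
    then show ?thesis using left_region_disjoint[of P] interior_subset[of "left_strip 0"] by blast
  qed
  have m: "interior P \<inter> interior Q = {}" if PQ: "P \<in> set Ps" "Q \<in> set Ps" "P \<noteq> Q" for P Q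
  proof -
    obtain i where i: "i < length Ps" "P = Ps ! i" using PQ(1) by (metis in_set_conv_nth)
    obtain j where j: "j < length Ps" "Q = Ps ! j" using PQ(2) by (metis in_set_conv_nth)
    note ij = i j
    then consider "i < j" | "j < i" using PQ(3) by (metis ij(2,4) linorder_neqE_nat)
    then show ?thesis
    proof cases
      case 1
      then show ?thesis using region_chain_disjoint(1)[OF chain p] ij by blast
    next
      case 2
      then show ?thesis using region_chain_disjoint(1)[OF chain p, of j i] ij by blast
    qed
  qed
  have "\<Union>({left_strip 0, right_strip a} \<union> set Ps) = left_strip a \<union> right_strip a" using U by blast
  moreover have "pairwise (\<lambda>P Q. interior P \<inter> interior Q = {}) ({left_strip 0, right_strip a} \<union> set Ps)"
    unfolding pairwise_def
  proof (intro ballI impI)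
    fix P Q assume "P \<in> {left_strip 0, right_strip a} \<union> set Ps" "Q \<in> {left_strip 0, right_strip a} \<union> set Ps" "P \<noteq> Q"
    then show "interior P \<inter> interior Q = {}"
      using l[of P] l[of Q] r[of P] r[of Q] m[of P Q] by (auto simp: Int_commute)
  qed
  ultimately show ?thesis using p unfolding strip_tiling_def left_strip_Un_right_strip by auto
qed

text \<open>When the pieces are listed by increasing feet, the predecessors of a piece form an
  initial segment, and \<open>left_region_eq\<close> gives the chain equations. The final region is
  the left region of the right half strip.\<close>

lemma tiling_imp_region_chain:
  assumes S: "strip_tiling ({left_strip 0, right_strip a} \<union> S)"
    and new: "left_strip 0 \<notin> S" "right_strip a \<notin> S"
  shows "\<exists>Ps. set Ps = S \<and> region_chain (left_strip 0) Ps (left_strip a)"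
proof -
  let ?T = "{left_strip 0, right_strip a} \<union> S"
  have fin: "finite S" using S unfolding strip_tiling_def by simp
  have p: "piece P" if "P \<in> ?T" for P using S that unfolding strip_tiling_def by blast
  have dis: "interior P \<inter> interior Q = {}" if "P \<in> ?T" "Q \<in> ?T" "P \<noteq> Q" for P Q
    using S that unfolding strip_tiling_def pairwise_def by blast
  have lr: "left_strip 0 \<noteq> right_strip a" by (rule left_strip_neq_right_strip)
  have first: "precedes (left_strip 0) P" if "P \<in> insert (right_strip a) S" for P
  proof (rule precedes_left_strip)
    have "P \<noteq> left_strip 0" using that new lr by auto
    then show "piece P" "interior (left_strip 0) \<inter> interior P = {}"
      using p[of P] dis[of "left_strip 0" P] that by auto
  qed
  have last: "precedes P (right_strip a)" if "P \<in> insert (left_strip 0) S" for P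
  proof (rule precedes_right_strip)
    have "P \<noteq> right_strip a" using that new lr by auto
    then show "piece P" "interior P \<inter> interior (right_strip a) = {}"
      using p[of P] dis[of P "right_strip a"] that by auto
  qed
  have iff: "precedes P Q \<longleftrightarrow> foot P < foot Q" if "P \<in> S" "Q \<in> S" "P \<noteq> Q" for P Q
    using precedes_iff_foot[of P Q] p[of P] p[of Q] dis[of P Q] that by simp
  have tot: "foot P \<noteq> foot Q" if "P \<in> S" "Q \<in> S" "P \<noteq> Q" for P Q
  proof -
    have "precedes P Q \<or> precedes Q P"
      using precedes_total[of P Q] p[of P] p[of Q] dis[of P Q] that by simp
    then show ?thesis using iff[of P Q] iff[of Q P] that by auto
  qed
  then have inj: "inj_on foot S" unfolding inj_on_def by blast
  define Ps where "Ps = map (inv_into S foot) (sorted_list_of_set (foot ` S))"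
  have setPs: "set Ps = S" unfolding Ps_def using fin inj by (auto simp: image_image)
  have "map foot Ps = map (\<lambda>x. x) (sorted_list_of_set (foot ` S))"
    unfolding Ps_def map_map o_def using fin by (intro map_cong refl) (auto simp: f_inv_into_f)
  then have sorted: "sorted_wrt (<) (map foot Ps)" by simp
  have sorted': "foot (Ps ! i) < foot (Ps ! j)" if "i < j" "j < length Ps" for i j
    using sorted_wrt_nth_less[OF sorted] that by fastforce
  have U: "left_strip a = left_strip 0 \<union> \<Union>S"
  proof -
    have "left_region (right_strip a) = \<Union>{Q \<in> ?T. Q \<noteq> right_strip a \<and> precedes Q (right_strip a)}"
      using left_region_eq[OF S, of "right_strip a"] by blast
    also have "{Q \<in> ?T. Q \<noteq> right_strip a \<and> precedes Q (right_strip a)} = insert (left_strip 0) S"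
      using last new lr by blast
    finally show ?thesis unfolding left_region_right_strip by simp
  qed
  have "left_region (Ps ! i) = left_strip 0 \<union> \<Union>(set (take i Ps))" if i: "i < length Ps" for i
  proof -
    have PS: "Ps ! i \<in> S" using i setPs by auto
    have "left_region (Ps ! i) = \<Union>{Q \<in> ?T. Q \<noteq> Ps ! i \<and> precedes Q (Ps ! i)}"
      using left_region_eq[OF S, of "Ps ! i"] PS by blast
    also have "{Q \<in> ?T. Q \<noteq> Ps ! i \<and> precedes Q (Ps ! i)} = insert (left_strip 0) (set (take i Ps))"
    proof (intro set_eqI iffI)
      fix Q assume Q: "Q \<in> {Q \<in> ?T. Q \<noteq> Ps ! i \<and> precedes Q (Ps ! i)}"
      have "Ps ! i \<noteq> right_strip a" using PS new by auto
      then have "\<not> precedes (right_strip a) (Ps ! i)"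
        using last[of "Ps ! i"] precedes_asym[of "Ps ! i" "right_strip a"] PS p[of "Ps ! i"]
          dis[of "Ps ! i" "right_strip a"] by auto
      then have "Q = left_strip 0 \<or> Q \<in> S" using Q by blast
      moreover have "Q \<in> set (take i Ps)" if QS: "Q \<in> S"
      proof -
        obtain j where j: "j < length Ps" "Q = Ps ! j" using QS setPs by (metis in_set_conv_nth)
        have "foot Q < foot (Ps ! i)" using iff[of Q "Ps ! i"] Q QS PS by blast
        then have "j < i" using sorted'[of i j] j by (metis linorder_cases order.asym order_less_irrefl)
        then show ?thesis using j by (auto simp: in_set_conv_nth intro!: exI[of _ j])
      qed
      ultimately show "Q \<in> insert (left_strip 0) (set (take i Ps))" by blast
    next
      fix Q assume Q: "Q \<in> insert (left_strip 0) (set (take i Ps))"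
      show "Q \<in> {Q \<in> ?T. Q \<noteq> Ps ! i \<and> precedes Q (Ps ! i)}"
      proof (cases "Q = left_strip 0")
        case True
        then show ?thesis using first[of "Ps ! i"] PS new by auto
      next
        case False
        then have "Q \<in> set (take i Ps)" using Q by blast
        then obtain j where j: "j < i" "Q = Ps ! j" using i
          by (metis in_set_conv_nth length_take min_less_iff_conj nth_take)
        then have "foot Q < foot (Ps ! i)" using sorted' i by blast
        moreover have "Q \<in> S" using j i setPs by auto
        ultimately show ?thesis using iff[of Q "Ps ! i"] PS by auto
      qed
    qed
    finally show ?thesis by simp
  qed
  then have "region_chain (left_strip 0) Ps (left_strip a)"
    unfolding region_chain_iff setPs using U by blast
  then show ?thesis using setPs by blast
qed

section \<open>Tilings as closed walks\<close>

fun walk :: "('e \<Rightarrow> 'v) \<Rightarrow> ('e \<Rightarrow> 'v) \<Rightarrow> 'v \<Rightarrow> 'e list \<Rightarrow> 'v \<Rightarrow> bool" where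
  "walk src tgt u [] v \<longleftrightarrow> u = v"
| "walk src tgt u (e # es) v \<longleftrightarrow> src e = u \<and> walk src tgt (tgt e) es v"

section \<open>Regions up to translation\<close>

definition off :: "(real \<times> real) set \<Rightarrow> real" where
  "off U = Sup (fst ` U)"

text \<open>Since \<open>off\<close> moves along with translations, this is a canonical
  representative of a translation class of regions. These representatives are the vertices of the
  graph.\<close>

definition nf :: "(real \<times> real) set \<Rightarrow> (real \<times> real) set" where
  "nf U = shift (- off U) U"

definition right_bounded :: "(real \<times> real) set \<Rightarrow> bool" where
  "right_bounded U \<longleftrightarrow> U \<noteq> {} \<and> bdd_above (fst ` U)"

lemma off_shift: "right_bounded U \<Longrightarrow> off (shift s U) = s + off U"
proof -
  assume "right_bounded U"
  moreover have "fst ` shift s U = (\<lambda>z. s + fst z) ` U" unfolding shift_def image_image by simp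
  ultimately show ?thesis unfolding off_def right_bounded_def by (simp add: Sup_add_eq)
qed

lemma nf_shift: "right_bounded U \<Longrightarrow> nf (shift s U) = nf U"
  unfolding nf_def by (simp add: off_shift)

lemma shift_off_nf: "shift (off U) (nf U) = U"
  unfolding nf_def by simp

lemma right_bounded_shift: "right_bounded U \<Longrightarrow> right_bounded (shift s U)"
  unfolding right_bounded_def shift_def bdd_above_def by (force intro: add_left_mono)

lemma right_bounded_Un: "right_bounded U \<Longrightarrow> right_bounded V \<Longrightarrow> right_bounded (U \<union> V)"
  unfolding right_bounded_def by (simp add: image_Un)

definition bounded_piece :: "(real \<times> real) set \<Rightarrow> bool" where
  "bounded_piece P \<longleftrightarrow> piece P \<and> bounded P"

lemma bounded_piece_shift: "bounded_piece P \<Longrightarrow> bounded_piece (shift s P)"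
  unfolding bounded_piece_def using piece_shift bounded_translation
  by (auto simp: shift_def)

lemma bounded_piece_range:
  assumes "bounded_piece P" obtains c where "\<And>z. z \<in> P \<Longrightarrow> -c \<le> fst z \<and> fst z \<le> c"
proof -
  obtain c where "\<And>z. z \<in> P \<Longrightarrow> norm z \<le> c"
    using assms unfolding bounded_piece_def bounded_iff by blast
  then have "-c \<le> fst z \<and> fst z \<le> c" if "z \<in> P" for z
    using norm_fst_le[of "fst z" "snd z"] that by fastforce
  then show thesis using that by blast
qed

lemma right_bounded_piece: "bounded_piece P \<Longrightarrow> right_bounded P"
  using bounded_piece_range[of P] piece_interior_nonempty[of P] interior_subset[of P]
  unfolding right_bounded_def bounded_piece_def bdd_above_def by (metis image_iff subset_empty)

lemma right_bounded_left_strip [simp]: "right_bounded (left_strip a)"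
  unfolding right_bounded_def left_strip_def bdd_above_def by auto

lemma off_left_strip [simp]: "off (left_strip a) = a"
  unfolding off_def left_strip_def by simp

lemma shift_left_strip: "shift s (left_strip a) = left_strip (s + a)"
  by (auto simp: mem_shift left_strip_def)

lemma nf_left_strip [simp]: "nf (left_strip a) = left_strip 0"
  unfolding nf_def by (simp add: shift_left_strip)

lemma right_bounded_left_region:
  assumes "bounded_piece P" shows "right_bounded (left_region P)"
proof -
  obtain c where c: "\<And>z. z \<in> P \<Longrightarrow> -c \<le> fst z \<and> fst z \<le> c" using bounded_piece_range[OF assms] by blast
  then have "left_strip (-c) \<subseteq> left_region P" "left_region P \<subseteq> left_strip c"
    using left_region_lower[of P "-c"] left_region_upper[of P c] assms
    unfolding bounded_piece_def by blast+
  moreover have "(-c, 0) \<in> left_strip (-c)" by (simp add: left_strip_def)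
  ultimately show ?thesis
    unfolding right_bounded_def bdd_above_def by (fastforce simp: left_strip_def)
qed

definition right_region :: "(real \<times> real) set \<Rightarrow> (real \<times> real) set" where
  "right_region P = left_region P \<union> P"

lemma right_bounded_right_region: "bounded_piece P \<Longrightarrow> right_bounded (right_region P)"
  unfolding right_region_def
  using right_bounded_left_region right_bounded_piece right_bounded_Un by blast

definition tail_of :: "(real \<times> real) set \<Rightarrow> (real \<times> real) set" where
  "tail_of P = nf (left_region P)"

definition head_of :: "(real \<times> real) set \<Rightarrow> (real \<times> real) set" where
  "head_of P = nf (right_region P)"

text \<open>The edge length. It need not be the width of the tile, since tiles may interlock, but
  differences of offsets telescope along a walk and add up to the length of the rectangle.\<close>

definition advance :: "(real \<times> real) set \<Rightarrow> real" where
  "advance P = off (right_region P) - off (left_region P)"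

text \<open>Recovers positions from a word of prototiles: each one is moved so that its left region
  ends where the covered region ends. Along a walk the normal forms agree, and hence the regions
  themselves.\<close>

fun place :: "(real \<times> real) set \<Rightarrow> (real \<times> real) set list \<Rightarrow> (real \<times> real) set list" where
  "place U [] = []"
| "place U (t # ts) = shift (off U - off (left_region t)) t #
      place (U \<union> shift (off U - off (left_region t)) t) ts"

lemma length_place [simp]: "length (place U ts) = length ts"
  by (induction ts arbitrary: U) auto

lemma set_place: "P \<in> set (place U ts) \<Longrightarrow> \<exists>t\<in>set ts. \<exists>s. P = shift s t"
  by (induction ts arbitrary: U) auto

lemma region_chain_place:
  assumes "right_bounded U" "\<And>t. t \<in> set ts \<Longrightarrow> bounded_piece t"
    "walk tail_of head_of (nf U) ts (nf V)" "sum_list (map advance ts) = off V - off U"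
  shows "region_chain U (place U ts) V"
  using assms
proof (induction ts arbitrary: U)
  case Nil
  then show ?case using shift_off_nf[of U] shift_off_nf[of V] by simp
next
  case (Cons t ts)
  define s where "s = off U - off (left_region t)"
  have t: "bounded_piece t" using Cons by simp
  have "shift s (left_region t) = shift (off U) (nf (left_region t))"
    unfolding s_def nf_def by simp
  also have "\<dots> = U" using Cons.prems(3) shift_off_nf[of U] unfolding tail_of_def by simp
  finally have U: "left_region (shift s t) = U" by (simp add: left_region_shift)
  have R: "U \<union> shift s t = shift s (right_region t)"
    using U by (simp add: right_region_def shift_Un left_region_shift)
  have "region_chain (U \<union> shift s t) (place (U \<union> shift s t) ts) V"
  proof (rule Cons.IH)
    show "right_bounded (U \<union> shift s t)"
      unfolding R using right_bounded_shift right_bounded_right_region t by blast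
    show "bounded_piece t'" if "t' \<in> set ts" for t' using Cons.prems(2) that by simp
    show "walk tail_of head_of (nf (U \<union> shift s t)) ts (nf V)"
      unfolding R nf_shift[OF right_bounded_right_region[OF t]] using Cons.prems(3) unfolding head_of_def by simp
    show "sum_list (map advance ts) = off V - off (U \<union> shift s t)"
    proof -
      have "advance t + sum_list (map advance ts) = off V - off U" using Cons.prems(4) by simp
      moreover have "off (U \<union> shift s t) = s + off (right_region t)"
        unfolding R using off_shift right_bounded_right_region t by blast
      ultimately show ?thesis unfolding advance_def[of t] by (simp add: s_def)
    qed
  qed
  then show ?case using U by (simp add: s_def)
qed

lemma region_chain_imp_place:
  assumes "right_bounded U" "\<And>t. t \<in> T \<Longrightarrow> bounded_piece t" "region_chain U Ps V"
    "\<And>P. P \<in> set Ps \<Longrightarrow> \<exists>t\<in>T. \<exists>s. P = shift s t"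
  shows "\<exists>ts\<in>lists T. walk tail_of head_of (nf U) ts (nf V) \<and>
    sum_list (map advance ts) = off V - off U \<and> Ps = place U ts"
  using assms
proof (induction Ps arbitrary: U)
  case Nil
  then show ?case by (intro bexI[of _ "[]"]) auto
next
  case (Cons P Ps)
  obtain t s where t: "t \<in> T" "P = shift s t" using Cons.prems(4)[of P] by auto
  have bt: "bounded_piece t" using Cons.prems(2) t by blast
  have U: "U = shift s (left_region t)" using Cons.prems(3) t left_region_shift by simp
  then have offU: "off U = s + off (left_region t)"
    using off_shift right_bounded_left_region[OF bt] by simp
  have R: "U \<union> P = shift s (right_region t)"
    unfolding U t(2) right_region_def shift_Un ..
  have "\<exists>ts\<in>lists T. walk tail_of head_of (nf (U \<union> P)) ts (nf V) \<and>
    sum_list (map advance ts) = off V - off (U \<union> P) \<and> Ps = place (U \<union> P) ts"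
  proof (rule Cons.IH)
    show "right_bounded (U \<union> P)"
      unfolding R using right_bounded_shift right_bounded_right_region bt by blast
  qed (use Cons.prems in auto)
  then obtain ts where ts: "ts \<in> lists T" "walk tail_of head_of (nf (U \<union> P)) ts (nf V)"
    "sum_list (map advance ts) = off V - off (U \<union> P)" "Ps = place (U \<union> P) ts" by blast
  have "tail_of t = nf U" unfolding U tail_of_def using nf_shift right_bounded_left_region bt by simp
  moreover have "head_of t = nf (U \<union> P)"
    unfolding R head_of_def using nf_shift right_bounded_right_region bt by simp
  moreover have "advance t = off (U \<union> P) - off U"
    unfolding R advance_def offU using off_shift right_bounded_right_region bt by simp
  ultimately show ?case using ts t offU
    by (intro bexI[of _ "t # ts"]) auto
qed

text \<open>Two translates of one tile among the prototiles would give several words for the same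
  tiling.\<close>

definition shift_independent :: "(real \<times> real) set set \<Rightarrow> bool" where
  "shift_independent T \<longleftrightarrow> (\<forall>t\<in>T. \<forall>u\<in>T. \<forall>s. shift s t = u \<longrightarrow> t = u)"

lemma place_inj:
  assumes "shift_independent T" "ts \<in> lists T" "us \<in> lists T" "place U ts = place U us"
  shows "ts = us"
  using assms(2-)
proof (induction ts arbitrary: U us rule: list.induct)
  case Nil
  then show ?case by (cases us) auto
next
  case (Cons t ts)
  then obtain u us' where us: "us = u # us'" by (cases us) auto
  have eq: "shift (off U - off (left_region t)) t = shift (off U - off (left_region u)) u"
    using Cons.prems us by simp
  then have "shift (- (off U - off (left_region u))) (shift (off U - off (left_region t)) t) = u"
    by simp
  then have "shift (- (off U - off (left_region u)) + (off U - off (left_region t))) t = u"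
    by (simp only: shift_shift)
  then have "t = u" using assms(1) Cons.prems(1,2) us unfolding shift_independent_def by auto
  moreover have "ts = us'" using Cons.IH[of us'] Cons.prems us \<open>t = u\<close> by auto
  ultimately show ?case using us by simp
qed

definition shifts_of :: "(real \<times> real) set set \<Rightarrow> (real \<times> real) set set" where
  "shifts_of T = {P. \<exists>t\<in>T. \<exists>s. P = shift s t}"

definition closed_words :: "(real \<times> real) set set \<Rightarrow> real \<Rightarrow> (real \<times> real) set list set" where
  "closed_words T a = {ts \<in> lists T. walk tail_of head_of (left_strip 0) ts (left_strip 0) \<and>
     sum_list (map advance ts) = a}"

text \<open>A tiling determines its chain through the order of the feet, and the chain determines
  the word because the prototiles are no translates of each other.\<close>

theorem bij_betw_words_tilings:
  assumes T: "shift_independent T" "\<And>t. t \<in> T \<Longrightarrow> bounded_piece t"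
  shows "bij_betw (\<lambda>ts. set (place (left_strip 0) ts)) (closed_words T a)
    {S. S \<subseteq> shifts_of T \<and> strip_tiling ({left_strip 0, right_strip a} \<union> S)}"
  unfolding bij_betw_def
proof (intro conjI subset_antisym subsetI)
  have chain: "region_chain (left_strip 0) (place (left_strip 0) ts) (left_strip a)"
    if "ts \<in> closed_words T a" for ts
    using that T by (intro region_chain_place) (auto simp: closed_words_def)
  have pc: "piece P" if "P \<in> shifts_of T" for P
    using that T bounded_piece_shift unfolding shifts_of_def bounded_piece_def by blast
  have sub: "set (place (left_strip 0) ts) \<subseteq> shifts_of T" if "ts \<in> closed_words T a" for ts
    using set_place that unfolding closed_words_def shifts_of_def by blast
  show "inj_on (\<lambda>ts. set (place (left_strip 0) ts)) (closed_words T a)"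
  proof (rule inj_onI)
    fix ts us assume *: "ts \<in> closed_words T a" "us \<in> closed_words T a"
      "set (place (left_strip 0) ts) = set (place (left_strip 0) us)"
    then have "place (left_strip 0) ts = place (left_strip 0) us"
      using region_chain_unique[OF chain chain] sub pc by blast
    then show "ts = us" using place_inj[OF T(1)] * unfolding closed_words_def by blast
  qed
  show "S \<in> {S. S \<subseteq> shifts_of T \<and> strip_tiling ({left_strip 0, right_strip a} \<union> S)}"
    if "S \<in> (\<lambda>ts. set (place (left_strip 0) ts)) ` closed_words T a" for S
    using that sub region_chain_imp_tiling[OF chain] pc by blast
  show "S \<in> (\<lambda>ts. set (place (left_strip 0) ts)) ` closed_words T a"
    if S: "S \<in> {S. S \<subseteq> shifts_of T \<and> strip_tiling ({left_strip 0, right_strip a} \<union> S)}" for S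
  proof -
    have bd: "bounded P" if "P \<in> shifts_of T" for P
      using that T bounded_piece_shift unfolding shifts_of_def bounded_piece_def by blast
    \<comment> \<open>The tiles are bounded and the half strips are not, so neither half strip
      belongs to \<open>S\<close> itself.\<close>
    have "\<not> bounded (left_strip 0)" "\<not> bounded (right_strip a)"
    proof -
      have "\<exists>z\<in>left_strip 0. norm z > c" for c
        by (intro bexI[of _ "(- \<bar>c\<bar> - 1, 0)"]) (auto simp: left_strip_def norm_Pair)
      then show "\<not> bounded (left_strip 0)" unfolding bounded_iff by (meson not_less)
      have "\<exists>z\<in>right_strip a. norm z > c" for c
        by (intro bexI[of _ "(\<bar>a\<bar> + \<bar>c\<bar> + 1, 0)"]) (auto simp: right_strip_def norm_Pair)
      then show "\<not> bounded (right_strip a)" unfolding bounded_iff by (meson not_less)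
    qed
    then have "left_strip 0 \<notin> S" "right_strip a \<notin> S" using bd S by blast+
    then obtain Ps where Ps: "set Ps = S" "region_chain (left_strip 0) Ps (left_strip a)"
      using tiling_imp_region_chain S by blast
    have "\<exists>ts\<in>lists T. walk tail_of head_of (nf (left_strip 0)) ts (nf (left_strip a)) \<and>
      sum_list (map advance ts) = off (left_strip a) - off (left_strip 0) \<and> Ps = place (left_strip 0) ts"
      using Ps S T(2) by (intro region_chain_imp_place) (auto simp: shifts_of_def)
    then show ?thesis using Ps unfolding closed_words_def by auto
  qed
qed

section \<open>Tall tiles\<close>

lemma axis_rectangle_translation:
  assumes "axis_rectangle Q" shows "axis_rectangle ((+) v ` Q)"
proof -
  obtain a b c d where Q: "a < b" "c < d" "Q = {a..b} \<times> {c..d}"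
    using assms unfolding axis_rectangle_def by blast
  have "(+) v ` Q = ((+) (fst v) ` {a..b}) \<times> ((+) (snd v) ` {c..d})"
  proof -
    have "(+) v = (\<lambda>(p, q). (fst v + p, snd v + q))" by (cases v) auto
    then show ?thesis unfolding Q(3) by (simp only: image_paired_Times)
  qed
  then have eq: "(+) v ` Q = {a + fst v..b + fst v} \<times> {c + snd v..d + snd v}" by (simp add: add.commute)
  show ?thesis unfolding axis_rectangle_def eq using Q(1,2)
    by (intro exI[of _ "a + fst v"] exI[of _ "b + fst v"] exI[of _ "c + snd v"] exI[of _ "d + snd v"]
        conjI refl) auto
qed

lemma axis_parallel_polygon_translation:
  assumes "axis_parallel_polygon P" shows "axis_parallel_polygon ((+) v ` P)"
proof -
  obtain B where B: "finite B" "\<forall>Q\<in>B. axis_rectangle Q" "P = \<Union>B"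
    using assms unfolding axis_parallel_polygon_def by blast
  have "(+) v ` P = \<Union>((`) ((+) v) ` B)" unfolding B(3) by blast
  moreover have "\<forall>Q\<in>(`) ((+) v) ` B. axis_rectangle Q" using B axis_rectangle_translation by blast
  moreover have "connected ((+) v ` interior P)"
    using assms unfolding axis_parallel_polygon_def
    by (intro connected_continuous_image continuous_intros) simp
  moreover have "(+) v ` P \<noteq> {}" "finite ((`) ((+) v) ` B)"
    using assms B(1) unfolding axis_parallel_polygon_def by auto
  ultimately show ?thesis
    unfolding axis_parallel_polygon_def interior_translation by blast
qed

lemma compact_axis_parallel_polygon: "axis_parallel_polygon P \<Longrightarrow> compact P"
  unfolding axis_parallel_polygon_def axis_rectangle_def
  by (auto intro!: compact_Union compact_Times)

lemma interior_rectangle: "interior ({a..b} \<times> {c..d}) = {a<..<b} \<times> {c<..<d::real}" for a b :: real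
  by (simp add: interior_Times)

lemma axis_rectangle_closure_interior: "axis_rectangle Q \<Longrightarrow> Q \<subseteq> closure (interior Q)"
  unfolding axis_rectangle_def by (auto simp: interior_rectangle closure_Times)

text \<open>A rectangle of the polygon that contains a point of the bottom line must stand on it,
  since the polygon stays in the strip; the open base of this rectangle then consists of feet. The
  same holds at the top.\<close>

lemma polygon_bounded_piece:
  assumes P: "axis_parallel_polygon P" and range: "snd ` P \<subseteq> {0..1}" "0 \<in> snd ` P" "1 \<in> snd ` P"
  shows "bounded_piece P"
proof -
  obtain B where B: "finite B" "\<forall>Q\<in>B. axis_rectangle Q" "P = \<Union>B"
    using P unfolding axis_parallel_polygon_def by blast
  have comp: "compact P" using compact_axis_parallel_polygon[OF P] .
  have strip: "P \<subseteq> UNIV \<times> {0..1}" using range by force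
  have clo: "P \<subseteq> closure (interior P)"
  proof
    fix z assume "z \<in> P"
    then obtain Q where "Q \<in> B" "z \<in> Q" using B by blast
    then have "z \<in> closure (interior Q)" "Q \<subseteq> P" using B axis_rectangle_closure_interior by blast+
    then show "z \<in> closure (interior P)" using closure_mono[OF interior_mono] by blast
  qed
  have "feet (interior P) \<noteq> {}"
  proof -
    obtain x where "(x, 0) \<in> P" using range(2) by force
    then obtain Q where Q: "Q \<in> B" "(x, 0) \<in> Q" using B by blast
    have "axis_rectangle Q" using B(2) Q(1) by blast
    then obtain a b c d where q: "a < b" "c < d" "Q = {a..b} \<times> {c..d}"
      unfolding axis_rectangle_def by blast
    have "(a, c) \<in> Q" using q Q(2) by auto
    then have "(a, c) \<in> P" using Q(1) B(3) by blast
    then have "c = 0" using strip q Q(2) by auto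
    then have "{a<..<b} \<times> {0<..<d} \<subseteq> interior P"
      using interior_mono[of Q P] Q B unfolding q(3) interior_rectangle by blast
    then have "(a + b) / 2 \<in> feet (interior P)"
      unfolding feet_def mem_Collect_eq using q(1,2) \<open>c = 0\<close>
      by (intro exI[of _ d] conjI allI impI subsetD[OF \<open>_ \<subseteq> interior P\<close>]) auto
    then show ?thesis by blast
  qed
  moreover have "heads (interior P) \<noteq> {}"
  proof -
    obtain x where "(x, 1) \<in> P" using range(3) by force
    then obtain Q where Q: "Q \<in> B" "(x, 1) \<in> Q" using B by blast
    have "axis_rectangle Q" using B(2) Q(1) by blast
    then obtain a b c d where q: "a < b" "c < d" "Q = {a..b} \<times> {c..d}"
      unfolding axis_rectangle_def by blast
    have "(a, d) \<in> Q" using q Q(2) by auto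
    then have "(a, d) \<in> P" using Q(1) B(3) by blast
    then have "d = 1" using strip q Q(2) by auto
    then have "{a<..<b} \<times> {c<..<1} \<subseteq> interior P"
      using interior_mono[of Q P] Q B unfolding q(3) interior_rectangle by blast
    then have "(a + b) / 2 \<in> heads (interior P)"
      unfolding heads_def mem_Collect_eq using q(1,2) \<open>d = 1\<close>
      by (intro exI[of _ "1 - c"] conjI allI impI subsetD[OF \<open>_ \<subseteq> interior P\<close>]) auto
    then show ?thesis by blast
  qed
  ultimately show ?thesis
    using comp strip clo P compact_imp_bounded compact_imp_closed
    unfolding bounded_piece_def piece_def axis_parallel_polygon_def by blast
qed

definition base :: "(real \<times> real) set \<Rightarrow> (real \<times> real) set" where
  "base t = (+) (0, - Inf (snd ` t)) ` t"

lemma tall_range: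
  assumes "axis_parallel_polygon t" "tall t"
  obtains c where "Inf (snd ` t) = c" "snd ` t \<subseteq> {c..c + 1}" "c \<in> snd ` t" "c + 1 \<in> snd ` t"
proof -
  have c: "compact (snd ` t)" "snd ` t \<noteq> {}"
    using compact_continuous_image[OF continuous_on_snd[OF continuous_on_id]
      compact_axis_parallel_polygon[OF assms(1)]] assms(1)
    unfolding axis_parallel_polygon_def by auto
  then have bd: "bdd_below (snd ` t)" "bdd_above (snd ` t)"
    using bounded_imp_bdd_above[OF compact_imp_bounded[OF c(1)]]
      bounded_imp_bdd_below[OF compact_imp_bounded[OF c(1)]] by auto
  have "Inf (snd ` t) \<in> snd ` t" "Sup (snd ` t) \<in> snd ` t"
    using closed_contains_Inf[OF c(2) bd(1) compact_imp_closed[OF c(1)]]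
      closed_contains_Sup[OF c(2) bd(2) compact_imp_closed[OF c(1)]] by simp_all
  moreover have "Sup (snd ` t) = Inf (snd ` t) + 1" using assms(2) unfolding tall_def height_def by simp
  moreover have "snd ` t \<subseteq> {Inf (snd ` t)..Sup (snd ` t)}"
    using bd cInf_lower[of _ "snd ` t"] cSup_upper[of _ "snd ` t"] by (intro subsetI) simp
  ultimately show thesis using that[of "Inf (snd ` t)"] by simp
qed

lemma snd_image_translation: "snd ` ((+) v ` t) = (+) (snd v) ` (snd ` t)"
  unfolding image_image by simp

lemma bounded_piece_base:
  assumes "axis_parallel_polygon t" "tall t"
  shows "bounded_piece (base t)"
proof -
  obtain c where c: "Inf (snd ` t) = c" "snd ` t \<subseteq> {c..c + 1}" "c \<in> snd ` t" "c + 1 \<in> snd ` t"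
    using tall_range[OF assms] by blast
  have i: "snd ` base t = (\<lambda>x. x - c) ` (snd ` t)"
    unfolding base_def snd_image_translation c(1) by simp
  show ?thesis
  proof (rule polygon_bounded_piece)
    show "axis_parallel_polygon (base t)"
      unfolding base_def using assms axis_parallel_polygon_translation by blast
    show "snd ` base t \<subseteq> {0..1}" unfolding i using c(2) by fastforce
    show "0 \<in> snd ` base t" unfolding i using c(3) by (intro image_eqI[of _ _ c]) auto
    show "1 \<in> snd ` base t" unfolding i using c(4) by (intro image_eqI[of _ _ "c + 1"]) auto
  qed
qed

lemma translation_eq_shift_base:
  "(+) v ` t = (+) (0, snd v + Inf (snd ` t)) ` shift (fst v) (base t)"
  unfolding base_def shift_def image_image by (cases v) (simp add: add.assoc[symmetric])

text \<open>A tile of height 1 has no vertical freedom in a strip of height 1: its extreme heights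
  are attained, and they must fall on 0 and 1.\<close>

lemma translation_in_strip:
  assumes "axis_parallel_polygon t" "tall t" "(+) v ` t \<subseteq> UNIV \<times> {0..1}"
  shows "(+) v ` t = shift (fst v) (base t)"
proof -
  obtain c where c: "Inf (snd ` t) = c" "snd ` t \<subseteq> {c..c + 1}" "c \<in> snd ` t" "c + 1 \<in> snd ` t"
    using tall_range[OF assms(1,2)] by blast
  have "snd ` ((+) v ` t) \<subseteq> {0..1}" using assms(3) by fastforce
  then have "snd v + c \<in> {0..1}" "snd v + (c + 1) \<in> {0..1}"
    unfolding snd_image_translation using c(3,4) by blast+
  then have "snd v + Inf (snd ` t) = 0" using c(1) by simp
  moreover have "(+) (0 :: real \<times> real) ` A = A" for A by simp
  ultimately show ?thesis using translation_eq_shift_base[of v t] by (simp add: zero_prod_def[symmetric])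
qed

lemma translations_in_strip:
  assumes "\<And>t. t \<in> T \<Longrightarrow> axis_parallel_polygon t \<and> tall t"
  shows "{P. \<exists>t\<in>T. \<exists>v. P = (+) v ` t \<and> P \<subseteq> UNIV \<times> {0..1}} = shifts_of (base ` T)"
proof (intro set_eqI iffI)
  fix P assume "P \<in> {P. \<exists>t\<in>T. \<exists>v. P = (+) v ` t \<and> P \<subseteq> UNIV \<times> {0..1}}"
  then show "P \<in> shifts_of (base ` T)"
    using translation_in_strip assms unfolding shifts_of_def by blast
next
  fix P assume "P \<in> shifts_of (base ` T)"
  then obtain t s where t: "t \<in> T" "P = shift s (base t)" unfolding shifts_of_def by blast
  then have "P = (+) (s, - Inf (snd ` t)) ` t"
    unfolding base_def shift_def image_image by (simp add: add.assoc[symmetric])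
  moreover have "P \<subseteq> UNIV \<times> {0..1}"
    using bounded_piece_base bounded_piece_shift t assms unfolding bounded_piece_def piece_def by metis
  ultimately show "P \<in> {P. \<exists>t\<in>T. \<exists>v. P = (+) v ` t \<and> P \<subseteq> UNIV \<times> {0..1}}" using t by blast
qed

lemma shifts_of_nf: "shifts_of (nf ` T) = shifts_of T"
proof -
  have "\<exists>s'. shift s (nf t) = shift s' t" "\<exists>s'. shift s t = shift s' (nf t)" for s t
    unfolding nf_def by (auto intro: exI[of _ "s - off t"] exI[of _ "s + off t"])
  then show ?thesis unfolding shifts_of_def by blast
qed

lemma shift_independent_nf:
  assumes "\<And>t. t \<in> T \<Longrightarrow> right_bounded t" shows "shift_independent (nf ` T)"
proof -
  have "nf t = nf u" if "t \<in> T" "u \<in> T" "shift s (nf t) = nf u" for t u s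
  proof -
    have "right_bounded (nf t)" "right_bounded (nf u)"
      using assms right_bounded_shift that unfolding nf_def by blast+
    then have "nf (nf t) = nf (nf u)" using nf_shift[of "nf t" s] that by simp
    moreover have "nf (nf t) = nf t" "nf (nf u) = nf u" using nf_shift assms that by (metis nf_def)+
    ultimately show ?thesis by simp
  qed
  then show ?thesis unfolding shift_independent_def by blast
qed

section \<open>Areas and finiteness\<close>

lemma area_lower_bound:
  assumes "finite T" "\<And>t. t \<in> T \<Longrightarrow> bounded_piece t"
  obtains \<delta> where "\<delta> > 0" "\<And>P. P \<in> shifts_of T \<Longrightarrow> \<delta> \<le> measure lebesgue (interior P)"
proof -
  \<comment> \<open>The extra 1 keeps the minimum meaningful for empty \<open>T\<close>.\<close>
  let ?M = "insert 1 ((\<lambda>t. measure lebesgue (interior t)) ` T)"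
  have pos: "measure lebesgue (interior t) > 0" if "t \<in> T" for t
  proof -
    have "interior t \<noteq> {}" "bounded t" using assms that piece_interior_nonempty
      unfolding bounded_piece_def by blast+
    then have "\<not> negligible (interior t)" "interior t \<in> lmeasurable"
      using open_not_negligible lmeasurable_interior by auto
    then show ?thesis using negligible_iff_measure zero_less_measure_iff
      by (metis measure_nonneg order_le_less)
  qed
  have fin: "finite ?M" using assms by simp
  have "Min ?M > 0" using fin pos by (subst Min_gr_iff) auto
  moreover have "Min ?M \<le> measure lebesgue (interior P)" if P: "P \<in> shifts_of T" for P
  proof -
    obtain t s where "t \<in> T" "P = shift s t" using P unfolding shifts_of_def by blast
    then have "measure lebesgue (interior P) = measure lebesgue (interior t)"
      using interior_shift measure_translation unfolding shift_def by metis
    then show ?thesis using fin \<open>t \<in> T\<close> by (auto intro!: Min_le)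
  qed
  ultimately show thesis using that by blast
qed

lemma card_pieces_bound:
  fixes F :: "(real \<times> real) set set"
  assumes "finite F" "pairwise (\<lambda>P Q. interior P \<inter> interior Q = {}) F" "a \<ge> 0"
    and F: "\<And>P. P \<in> F \<Longrightarrow> P \<subseteq> {0..a} \<times> {0..1} \<and> \<delta> \<le> measure lebesgue (interior P)"
  shows "real (card F) * \<delta> \<le> a"
proof -
  have box: "{0..a} \<times> {0..1::real} = cbox (0, 0) (a, 1::real)" by (simp add: cbox_Pair_eq)
  have sub: "P \<subseteq> cbox (0, 0) (a, 1)" if "P \<in> F" for P
    using F[OF that] unfolding box by (rule conjunct1)
  then have bd: "bounded P" if "P \<in> F" for P
    using that bounded_subset[OF bounded_cbox] by metis
  have m: "interior P \<in> lmeasurable" if "P \<in> F" for P using bd[OF that] lmeasurable_interior by blast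
  have "real (card F) * \<delta> = (\<Sum>P\<in>F. \<delta>)" by simp
  also have "\<dots> \<le> (\<Sum>P\<in>F. measure lebesgue (interior P))" by (intro sum_mono conjunct2[OF F])
  also have "\<dots> = measure lebesgue (\<Union>P\<in>F. interior P)"
    using assms m by (intro measure_UNION'[symmetric]) (auto simp: disjnt_def pairwise_def)
  also have "\<dots> \<le> measure lebesgue (cbox (0, 0) (a, 1::real))"
  proof (rule measure_mono_fmeasurable)
    have "interior P \<subseteq> cbox (0, 0) (a, 1)" if "P \<in> F" for P
      using sub[OF that] interior_subset[of P] by (rule_tac order_trans)
    then show "(\<Union>P\<in>F. interior P) \<subseteq> cbox (0, 0) (a, 1)" by (rule UN_least)
    show "(\<Union>P\<in>F. interior P) \<in> sets lebesgue" using m assms(1) by (intro sets.finite_UN) auto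
  qed auto
  also have "\<dots> = a" using assms(3) by (simp add: content_Pair)
  finally show ?thesis .
qed

text \<open>\<open>tilings\<close> speaks of arbitrary sets of placed tiles. Infinitely many
  disjoint interiors of area at least \<open>\<delta>\<close> would not fit into the
  rectangle.\<close>

lemma finite_pieces:
  assumes "finite T" "\<And>t. t \<in> T \<Longrightarrow> bounded_piece t" "a \<ge> 0" "S \<subseteq> shifts_of T"
    "pairwise (\<lambda>P Q. interior P \<inter> interior Q = {}) S" "\<And>P. P \<in> S \<Longrightarrow> P \<subseteq> {0..a} \<times> {0..1}"
  shows "finite S"
proof (rule ccontr)
  assume inf: "infinite S"
  obtain \<delta> where d: "\<delta> > 0" "\<And>P. P \<in> shifts_of T \<Longrightarrow> \<delta> \<le> measure lebesgue (interior P)"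
    using area_lower_bound assms by metis
  obtain N where N: "real N * \<delta> > a" using d(1) ex_less_of_nat_mult by blast
  obtain F where F: "F \<subseteq> S" "finite F" "card F = N" using infinite_arbitrarily_large[OF inf] by blast
  have "real (card F) * \<delta> \<le> a"
  proof (rule card_pieces_bound[OF F(2) _ assms(3)])
    show "pairwise (\<lambda>P Q. interior P \<inter> interior Q = {}) F" using assms(5) F(1) by (rule pairwise_subset)
    show "P \<subseteq> {0..a} \<times> {0..1} \<and> \<delta> \<le> measure lebesgue (interior P)" if "P \<in> F" for P
      using assms(4,6) d(2) F(1) that by (meson subsetD)
  qed
  then show False using N F by simp
qed

lemma piece_subset_strip_rectangle:
  assumes "piece P" "interior (left_strip 0) \<inter> interior P = {}" "interior P \<inter> interior (right_strip a) = {}"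
  shows "P \<subseteq> {0..a} \<times> {0..1}"
proof -
  have "interior P \<subseteq> {0..a} \<times> {0..1}"
  proof
    fix z assume z: "z \<in> interior P"
    then have "z \<notin> interior (left_strip 0)" "z \<notin> interior (right_strip a)" "z \<in> open_strip"
      using assms piece_interior_strip by blast+
    then show "z \<in> {0..a} \<times> {0..1}"
      unfolding interior_left_strip interior_right_strip open_strip_def by (cases z) auto
  qed
  moreover have "closed ({0..a} \<times> {0..1::real})" by (intro closed_Times) auto
  ultimately have "closure (interior P) \<subseteq> {0..a} \<times> {0..1}" by (rule closure_minimal)
  then show ?thesis using assms(1) unfolding piece_def by blast
qed

text \<open>\<open>T'\<close> is the given tile set and \<open>T\<close> a normalized one with the
  same translates inside the strip. The two half strips turn a tiling of the rectangle into one of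
  the infinite strip.\<close>

theorem tilings_eq:
  assumes T: "finite T" "\<And>t. t \<in> T \<Longrightarrow> bounded_piece t"
    and TT: "{P. \<exists>t\<in>T'. \<exists>v. P = (+) v ` t \<and> P \<subseteq> UNIV \<times> {0..1}} = shifts_of T" and a: "a \<ge> 0"
  shows "tilings T' a = {S. S \<subseteq> shifts_of T \<and> strip_tiling ({left_strip 0, right_strip a} \<union> S)}"
    (is "_ = ?R")
proof -
  have pc: "piece P" if "P \<in> shifts_of T" for P
    using that T bounded_piece_shift unfolding shifts_of_def bounded_piece_def by blast
  have sub: "P \<subseteq> {0..a} \<times> {0..1}" if S: "S \<in> ?R" "P \<in> S" for S P
  proof (rule piece_subset_strip_rectangle)
    have P: "P \<in> shifts_of T" using S by blast
    show "piece P" using pc P .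
    have "bounded P" using P T bounded_piece_shift unfolding shifts_of_def bounded_piece_def by blast
    have nb: "P \<noteq> left_strip 0" "P \<noteq> right_strip a"
    proof -
      obtain c where c: "\<And>z. z \<in> P \<Longrightarrow> norm z \<le> c" using \<open>bounded P\<close> bounded_iff by blast
      have "(- \<bar>c\<bar> - 1, 0) \<in> left_strip 0" "(\<bar>a\<bar> + \<bar>c\<bar> + 1, 0) \<in> right_strip a"
        by (auto simp: left_strip_def right_strip_def)
      moreover have "(- \<bar>c\<bar> - 1, 0) \<notin> P" "(\<bar>a\<bar> + \<bar>c\<bar> + 1, 0) \<notin> P"
        using c[of "(- \<bar>c\<bar> - 1, 0)"] c[of "(\<bar>a\<bar> + \<bar>c\<bar> + 1, 0)"] by (auto simp: norm_Pair)
      ultimately show "P \<noteq> left_strip 0" "P \<noteq> right_strip a" by blast+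
    qed
    then show "interior (left_strip 0) \<inter> interior P = {}" "interior P \<inter> interior (right_strip a) = {}"
      using S unfolding strip_tiling_def pairwise_def by blast+
  qed
  show ?thesis
  proof (cases "a = 0")
    case True
    \<comment> \<open>For \<open>a = 0\<close> a tile would be contained in a segment and have empty
      interior. Only the empty set remains, in accordance with the convention in
      \<open>tilings\<close>.\<close>
    have "S = {}" if "S \<in> ?R" for S
    proof (rule ccontr)
      assume "S \<noteq> {}"
      then obtain P where P: "P \<in> S" by blast
      then have "interior P \<subseteq> interior ({0..a} \<times> {0..1})" using sub that by (intro interior_mono) blast
      then have "interior P = {}" unfolding interior_rectangle True by simp
      then show False using P that pc piece_interior_nonempty by blast
    qed
    moreover have "strip_tiling {left_strip 0, right_strip 0}"
      using interior_left_right[of 0]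
      by (auto simp: strip_tiling_def pairwise_def left_strip_Un_right_strip)
    ultimately show ?thesis unfolding tilings_def using True by auto
  next
    case False
    then have a: "a > 0" using a by simp
    show ?thesis
    proof (intro set_eqI iffI)
      fix S assume "S \<in> tilings T' a"
      then have S: "\<And>P. P \<in> S \<Longrightarrow> \<exists>t\<in>T'. \<exists>v. P = (+) v ` t"
        "pairwise (\<lambda>P Q. interior P \<inter> interior Q = {}) S" "\<Union>S = {0..a} \<times> {0..1}"
        unfolding tilings_def strip_rectangle_def using False by auto
      have sub: "P \<subseteq> {0..a} \<times> {0..1}" if "P \<in> S" for P using S(3) that by blast
      have ss: "S \<subseteq> shifts_of T"
      proof
        fix P assume P: "P \<in> S"
        then have "P \<subseteq> UNIV \<times> {0..1}" using sub[OF P] by auto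
        then show "P \<in> shifts_of T" using S(1)[OF P] TT by blast
      qed
      then have fin: "finite S" using finite_pieces[OF T _ ss S(2) sub] a by simp
      have int: "interior P \<subseteq> {0<..<a} \<times> {0<..<1}" if "P \<in> S" for P
        using interior_mono[OF sub[OF that]] unfolding interior_rectangle .
      have l: "interior (left_strip 0) \<inter> interior P = {}" if "P \<in> S" for P
        using int[OF that] unfolding interior_left_strip by fastforce
      have r: "interior P \<inter> interior (right_strip a) = {}" if "P \<in> S" for P
        using int[OF that] unfolding interior_right_strip by fastforce
      have lr: "interior (left_strip 0) \<inter> interior (right_strip a) = {}"
        using a unfolding interior_left_strip interior_right_strip by auto
      have "pairwise (\<lambda>P Q. interior P \<inter> interior Q = {}) ({left_strip 0, right_strip a} \<union> S)"
        unfolding pairwise_def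
      proof (intro ballI impI)
        fix P Q assume "P \<in> {left_strip 0, right_strip a} \<union> S" "Q \<in> {left_strip 0, right_strip a} \<union> S" "P \<noteq> Q"
        then show "interior P \<inter> interior Q = {}"
          using l[of P] l[of Q] r[of P] r[of Q] lr S(2)[unfolded pairwise_def, rule_format, of P Q]
          by (auto simp: Int_commute)
      qed
      moreover have "\<Union>({left_strip 0, right_strip a} \<union> S) = UNIV \<times> {0..1}"
        using S(3) by (auto simp: left_strip_def right_strip_def)
      ultimately show "S \<in> ?R" using ss fin pc unfolding strip_tiling_def by auto
    next
      fix S assume S: "S \<in> ?R"
      have tr: "\<exists>t\<in>T'. \<exists>v. P = (+) v ` t" if P: "P \<in> S" for P
      proof -
        have "P \<in> shifts_of T" using S P by blast
        then show ?thesis unfolding TT[symmetric] by blast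
      qed
      have pw: "pairwise (\<lambda>P Q. interior P \<inter> interior Q = {}) S"
      proof (rule pairwise_subset)
        show "pairwise (\<lambda>P Q. interior P \<inter> interior Q = {}) ({left_strip 0, right_strip a} \<union> S)"
          using S unfolding strip_tiling_def by blast
      qed blast
      have "closed (\<Union>S)" using S pc unfolding strip_tiling_def piece_def by (intro closed_Union) auto
      \<comment> \<open>The half strips contain the sides at 0 and \<open>a\<close> too, so at first
        only points strictly between them are known to be covered by \<open>S\<close>; the closure
        adds the sides.\<close>
      moreover have "{0<..<a} \<times> {0..1} \<subseteq> \<Union>S"
      proof
        fix z assume z: "z \<in> {0<..<a} \<times> {0..1::real}"
        have "\<Union>({left_strip 0, right_strip a} \<union> S) = UNIV \<times> {0..1}" using S unfolding strip_tiling_def by simp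
        then have "z \<in> left_strip 0 \<or> z \<in> right_strip a \<or> z \<in> \<Union>S" using z by blast
        then show "z \<in> \<Union>S" using z by (auto simp: left_strip_def right_strip_def)
      qed
      ultimately have "closure ({0<..<a} \<times> {0..1}) \<subseteq> \<Union>S" by (intro closure_minimal)
      then have "{0..a} \<times> {0..1} \<subseteq> \<Union>S" using a by (simp add: closure_Times)
      moreover have "\<Union>S \<subseteq> {0..a} \<times> {0..1}" using sub[OF S] by blast
      ultimately have "\<Union>S = {0..a} \<times> {0..1}" by blast
      then show "S \<in> tilings T' a" using tr pw False unfolding tilings_def strip_rectangle_def by simp
    qed
  qed
qed

text \<open>A word has as many letters as its tiling has tiles, at most \<open>a / \<delta>\<close>
  by area, which leaves finitely many words over a finite alphabet.\<close>

lemma card_tilings: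
  assumes T: "finite T" "\<And>t. t \<in> T \<Longrightarrow> bounded_piece t" "shift_independent T"
    and TT: "{P. \<exists>t\<in>T'. \<exists>v. P = (+) v ` t \<and> P \<subseteq> UNIV \<times> {0..1}} = shifts_of T" and a: "a \<ge> 0"
  shows "finite (closed_words T a)" "card (tilings T' a) = card (closed_words T a)"
proof -
  have bij: "bij_betw (\<lambda>ts. set (place (left_strip 0) ts)) (closed_words T a) (tilings T' a)"
    using bij_betw_words_tilings[OF T(3,2), of a] tilings_eq[OF T(1,2) TT a] by simp
  then show "card (tilings T' a) = card (closed_words T a)" by (rule bij_betw_same_card[symmetric])
  obtain \<delta> where d: "\<delta> > 0" "\<And>P. P \<in> shifts_of T \<Longrightarrow> \<delta> \<le> measure lebesgue (interior P)"
    using area_lower_bound T(1,2) by metis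
  have "length ts \<le> nat \<lceil>a / \<delta>\<rceil>" if ts: "ts \<in> closed_words T a" for ts
  proof -
    define Ps where "Ps = place (left_strip 0) ts"
    have chain: "region_chain (left_strip 0) Ps (left_strip a)"
      using ts T unfolding Ps_def by (intro region_chain_place) (auto simp: closed_words_def)
    have sub: "set Ps \<subseteq> shifts_of T"
      using set_place ts unfolding Ps_def closed_words_def shifts_of_def by blast
    have pc: "piece P" if "P \<in> set Ps" for P
    proof -
      have "P \<in> shifts_of T" using sub that by blast
      then show ?thesis using T(2) bounded_piece_shift unfolding shifts_of_def bounded_piece_def by blast
    qed
    have "distinct (map foot Ps)"
      using region_chain_foot_sorted[OF chain pc] strict_sorted_iff by blast
    then have len: "length ts = card (set Ps)"
      unfolding distinct_map using distinct_card[of Ps] by (simp add: Ps_def)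
    have tile: "set Ps \<in> tilings T' a" using bij ts unfolding bij_betw_def Ps_def by blast
    have "real (card (set Ps)) * \<delta> \<le> a"
    proof (cases "a = 0")
      case True
      then show ?thesis using tile unfolding tilings_def by simp
    next
      case False
      then have tl: "\<Union>(set Ps) = {0..a} \<times> {0..1}"
        "pairwise (\<lambda>P Q. interior P \<inter> interior Q = {}) (set Ps)"
        using tile unfolding tilings_def strip_rectangle_def by auto
      show ?thesis
      proof (rule card_pieces_bound[OF _ tl(2) a])
        fix P assume "P \<in> set Ps"
        then show "P \<subseteq> {0..a} \<times> {0..1} \<and> \<delta> \<le> measure lebesgue (interior P)"
          using tl(1) d(2) sub by blast
      qed simp
    qed
    then have "real (length ts) \<le> a / \<delta>" using d(1) len by (simp add: field_simps)
    then show ?thesis by linarith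
  qed
  then have "closed_words T a \<subseteq> {ts. set ts \<subseteq> T \<and> length ts \<le> nat \<lceil>a / \<delta>\<rceil>}"
    unfolding closed_words_def by auto
  then show "finite (closed_words T a)"
    using finite_lists_length_le[OF T(1)] finite_subset by blast
qed

lemma tall_tiles_normalized:
  assumes T: "finite T" "\<And>t. t \<in> T \<Longrightarrow> tile t \<and> tall t"
  obtains T0 where "finite T0" "\<And>t. t \<in> T0 \<Longrightarrow> bounded_piece t"
    "\<And>a. a \<ge> 0 \<Longrightarrow> finite (closed_words T0 a) \<and> card (tilings T a) = card (closed_words T0 a)"
proof -
  have poly: "axis_parallel_polygon t \<and> tall t" if "t \<in> T" for t
    using T(2)[OF that] unfolding tile_def by blast
  let ?T0 = "nf ` base ` T"
  have bp: "bounded_piece t" if "t \<in> base ` T" for t using that bounded_piece_base poly by blast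
  then have bp0: "bounded_piece t" if "t \<in> ?T0" for t
    using that bounded_piece_shift unfolding nf_def by blast
  have ind: "shift_independent ?T0"
    using shift_independent_nf bp right_bounded_piece by blast
  have sh: "{P. \<exists>t\<in>T. \<exists>v. P = (+) v ` t \<and> P \<subseteq> UNIV \<times> {0..1}} = shifts_of ?T0"
    unfolding shifts_of_nf using translations_in_strip poly by blast
  show thesis
  proof (rule that[of ?T0])
    show "finite ?T0" using T(1) by simp
    show "finite (closed_words ?T0 a) \<and> card (tilings T a) = card (closed_words ?T0 a)" if "a \<ge> 0" for a
      using card_tilings[OF _ bp0 ind sh that] T(1) by blast
  qed (rule bp0)
qed

section \<open>Counting walks with given edge multiplicities\<close>

text \<open>Trees directed towards the root \<open>r\<close>, given by their edge sets and grown
  leaf by leaf; every other vertex has exactly one edge out of it.\<close>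

inductive in_tree :: "('e \<Rightarrow> 'v) \<Rightarrow> ('e \<Rightarrow> 'v) \<Rightarrow> 'v \<Rightarrow> 'e set \<Rightarrow> bool"
  for src tgt :: "'e \<Rightarrow> 'v" and r :: 'v where
  empty: "in_tree src tgt r {}"
| insert: "in_tree src tgt r A \<Longrightarrow> src e \<notin> src ` A \<Longrightarrow> src e \<noteq> r \<Longrightarrow> tgt e \<in> insert r (src ` A) \<Longrightarrow>
    in_tree src tgt r (insert e A)"

lemma in_tree_src: "in_tree src tgt r A \<Longrightarrow> inj_on src A \<and> r \<notin> src ` A"
  by (induction rule: in_tree.induct) auto

lemma in_tree_root: "in_tree src tgt r A \<Longrightarrow> A \<noteq> {} \<Longrightarrow> \<exists>e\<in>A. tgt e = r"
  by (induction rule: in_tree.induct) auto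

lemma in_tree_remove:
  "in_tree src tgt r A \<Longrightarrow> e \<in> A \<Longrightarrow> \<forall>e'\<in>A. tgt e' \<noteq> src e \<Longrightarrow> in_tree src tgt r (A - {e})"
proof (induction rule: in_tree.induct)
  case (insert A f)
  show ?case
  proof (cases "e = f")
    case True
    have "f \<notin> A" using insert by blast
    then show ?thesis using True insert by simp
  next
    case False
    then have e: "e \<in> A" using insert by blast
    then have tr: "in_tree src tgt r (A - {e})" using insert by blast
    have "in_tree src tgt r (insert f (A - {e}))"
    proof (rule in_tree.insert[OF tr])
      show "src f \<notin> src ` (A - {e})" "src f \<noteq> r" using insert by auto
      have "tgt f \<noteq> src e" using insert by blast
      then show "tgt f \<in> insert r (src ` (A - {e}))" using insert by blast
    qed
    moreover have "insert f A - {e} = insert f (A - {e})" using False by blast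
    ultimately show ?thesis by simp
  qed
qed simp

text \<open>For each vertex other than \<open>r\<close> that the walk leaves, the edge of its final
  departure. For walks that end in \<open>r\<close> these edges form an in-tree, which is the tree
  of the BEST theorem.\<close>

fun last_exits :: "('e \<Rightarrow> 'v) \<Rightarrow> 'v \<Rightarrow> 'e list \<Rightarrow> 'e set" where
  "last_exits src r [] = {}"
| "last_exits src r (e # es) =
     (if src e = r \<or> src e \<in> src ` set es then last_exits src r es
      else insert e (last_exits src r es))"

lemma last_exits_subset: "last_exits src r es \<subseteq> set es"
  by (induction es) auto

text \<open>With \<open>f = src\<close> this is the out-degree in the multigraph with multiplicities
  \<open>c\<close>, with \<open>f = tgt\<close> the in-degree.\<close>

definition out_deg :: "'e set \<Rightarrow> ('e \<Rightarrow> 'v) \<Rightarrow> ('e \<Rightarrow> nat) \<Rightarrow> 'v \<Rightarrow> nat" where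
  "out_deg E f c v = (\<Sum>e\<in>{e \<in> E. f e = v}. c e)"

definition walks_with :: "'e set \<Rightarrow> ('e \<Rightarrow> 'v) \<Rightarrow> ('e \<Rightarrow> 'v) \<Rightarrow> 'v \<Rightarrow> 'v \<Rightarrow> ('e \<Rightarrow> nat) \<Rightarrow> 'e set \<Rightarrow> 'e list set" where
  "walks_with E src tgt r s c A = {es \<in> lists E. walk src tgt s es r \<and>
     (\<forall>e\<in>E. count_list es e = c e) \<and> last_exits src r es = A}"

text \<open>The tree and balance conditions of the BEST theorem; \<open>A\<close> is the set of last exits.\<close>

definition eulerian :: "'e set \<Rightarrow> ('e \<Rightarrow> 'v) \<Rightarrow> ('e \<Rightarrow> 'v) \<Rightarrow> 'v \<Rightarrow> 'v \<Rightarrow> ('e \<Rightarrow> nat) \<Rightarrow> 'e set \<Rightarrow> bool" where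
  "eulerian E src tgt r s c A \<longleftrightarrow> A \<subseteq> E \<and> in_tree src tgt r A \<and> (\<forall>e\<in>A. c e > 0) \<and>
     (\<forall>v. out_deg E src c v + of_bool (v = r) = out_deg E tgt c v + of_bool (v = s)) \<and>
     (\<forall>e\<in>E. c e > 0 \<longrightarrow> src e = r \<or> src e \<in> src ` A)"

text \<open>A product of multinomial coefficients: for each vertex, the number of orders in which
  the exits counted by \<open>x\<close> can be used. In the theorem below \<open>x\<close> omits one
  copy of each last exit, whose place in the order is fixed.\<close>

definition exit_orders :: "'e set \<Rightarrow> ('e \<Rightarrow> 'v) \<Rightarrow> ('e \<Rightarrow> nat) \<Rightarrow> real" where
  "exit_orders E src x = (\<Prod>v\<in>src ` E. fact (out_deg E src x v)) / (\<Prod>e\<in>E. fact (x e))"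

abbreviation dec :: "('e \<Rightarrow> nat) \<Rightarrow> 'e \<Rightarrow> 'e \<Rightarrow> nat" where
  "dec c e \<equiv> c(e := c e - 1)"

lemma out_deg_dec:
  assumes "finite E" "e \<in> E" "c e > 0"
  shows "out_deg E f c v = out_deg E f (dec c e) v + of_bool (v = f e)"
proof (cases "f e = v")
  case True
  let ?S = "{e \<in> E. f e = v}"
  have "sum c ?S = c e + sum c (?S - {e})" using assms True by (intro sum.remove) auto
  moreover have "sum (dec c e) ?S = dec c e e + sum (dec c e) (?S - {e})" using assms True by (intro sum.remove) auto
  moreover have "sum (dec c e) (?S - {e}) = sum c (?S - {e})" by (intro sum.cong) auto
  ultimately show ?thesis using assms(3) True unfolding out_deg_def by simp
next
  case False
  then have "sum (dec c e) {e \<in> E. f e = v} = sum c {e \<in> E. f e = v}" by (intro sum.cong) auto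
  then show ?thesis using False unfolding out_deg_def by simp
qed

lemma out_deg_pos_iff: "finite E \<Longrightarrow> out_deg E f c v > 0 \<longleftrightarrow> (\<exists>e\<in>E. f e = v \<and> c e > 0)"
proof -
  assume "finite E"
  then have *: "out_deg E f c v = 0 \<longleftrightarrow> (\<forall>e\<in>{e \<in> E. f e = v}. c e = 0)" unfolding out_deg_def by simp
  show ?thesis unfolding neq0_conv[symmetric] * by auto
qed

text \<open>Pascal's rule for the multinomial coefficient at \<open>v\<close>, split by the exit
  that is used first there. It mirrors the removal of the first edge of a walk.\<close>

lemma exit_orders_pascal:
  assumes E: "finite E" and pos: "out_deg E src x v > 0"
  shows "exit_orders E src x = (\<Sum>e\<in>{e \<in> E. src e = v \<and> x e > 0}. exit_orders E src (dec x e))"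
proof -
  let ?n = "out_deg E src x v"
  obtain e0 where "e0 \<in> E" "src e0 = v" using pos out_deg_pos_iff[OF E, of src x v] by auto
  then have v: "v \<in> src ` E" by blast
  have step: "exit_orders E src (dec x e) = exit_orders E src x * (real (x e) / real ?n)"
    if e: "e \<in> E" "src e = v" "x e > 0" for e
  proof -
    let ?y = "dec x e"
    have od: "out_deg E src x u = out_deg E src ?y u + of_bool (u = src e)" for u
      using out_deg_dec[OF E, of e x src u] e by simp
    have "(\<Prod>u\<in>src ` E. fact (out_deg E src x u)) = (fact ?n :: real) * (\<Prod>u\<in>src ` E - {v}. fact (out_deg E src x u))"
      using E v by (intro prod.remove) auto
    moreover have "(\<Prod>u\<in>src ` E. fact (out_deg E src ?y u)) = (fact (out_deg E src ?y v) :: real) * (\<Prod>u\<in>src ` E - {v}. fact (out_deg E src ?y u))"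
      using E v by (intro prod.remove) auto
    moreover have "(\<Prod>u\<in>src ` E - {v}. fact (out_deg E src ?y u)) = (\<Prod>u\<in>src ` E - {v}. fact (out_deg E src x u) :: real)"
      using od e by (intro prod.cong) auto
    moreover have n: "?n = Suc (out_deg E src ?y v)" using od[of v] e by simp
    moreover have "(fact ?n :: real) = real ?n * fact (out_deg E src ?y v)" unfolding n by simp
    ultimately have 1: "(\<Prod>u\<in>src ` E. fact (out_deg E src x u)) = real ?n * (\<Prod>u\<in>src ` E. fact (out_deg E src ?y u))"
      by (simp add: mult.assoc)
    have "(\<Prod>f\<in>E. fact (x f)) = (fact (x e) :: real) * (\<Prod>f\<in>E - {e}. fact (x f))"
      using E e by (intro prod.remove) auto
    moreover have "(\<Prod>f\<in>E. fact (?y f)) = (fact (?y e) :: real) * (\<Prod>f\<in>E - {e}. fact (?y f))"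
      using E e by (intro prod.remove) auto
    moreover have "(\<Prod>f\<in>E - {e}. fact (?y f)) = (\<Prod>f\<in>E - {e}. fact (x f) :: real)" by (intro prod.cong) auto
    moreover have "(fact (x e) :: real) = real (x e) * fact (?y e)" using e(3) by (cases "x e") auto
    ultimately have 2: "(\<Prod>f\<in>E. fact (x f)) = real (x e) * (\<Prod>f\<in>E. fact (?y f) :: real)" by (simp add: mult.assoc)
    show ?thesis unfolding exit_orders_def 1 2 using e(3) pos by simp
  qed
  have "(\<Sum>e\<in>{e \<in> E. src e = v \<and> x e > 0}. exit_orders E src (dec x e)) =
      (\<Sum>e\<in>{e \<in> E. src e = v \<and> x e > 0}. exit_orders E src x * (real (x e) / real ?n))"
    using step by (intro sum.cong) auto
  also have "\<dots> = exit_orders E src x * ((\<Sum>e\<in>{e \<in> E. src e = v \<and> x e > 0}. real (x e)) / real ?n)"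
    by (simp add: sum_distrib_left sum_divide_distrib)
  also have "(\<Sum>e\<in>{e \<in> E. src e = v \<and> x e > 0}. real (x e)) = (\<Sum>e\<in>{e \<in> E. src e = v}. real (x e))"
    using E by (intro sum.mono_neutral_left) auto
  also have "\<dots> = real ?n" unfolding out_deg_def by simp
  also have "exit_orders E src x * (real ?n / real ?n) = exit_orders E src x" using pos by simp
  finally show ?thesis by (rule sym)
qed

lemma walks_with_finite:
  assumes "finite E" shows "finite (walks_with E src tgt r s c A)"
proof -
  have "length es = sum c E" if "es \<in> walks_with E src tgt r s c A" for es
  proof -
    have "set es \<subseteq> E" "\<forall>e\<in>E. count_list es e = c e" using that unfolding walks_with_def by auto
    then show ?thesis using sum_count_set[of es E] assms by simp
  qed
  then have "walks_with E src tgt r s c A \<subseteq> {es. set es \<subseteq> E \<and> length es = sum c E}"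
    unfolding walks_with_def by auto
  then show ?thesis using finite_lists_length_eq[OF assms] finite_subset by blast
qed

lemma walks_with_0:
  assumes "\<And>e. e \<in> E \<Longrightarrow> c e = 0"
  shows "walks_with E src tgt r s c A = (if s = r \<and> A = {} then {[]} else {})"
proof -
  have "es = []" if es: "es \<in> walks_with E src tgt r s c A" for es
  proof (cases es)
    case (Cons e es')
    then have "e \<in> E" "count_list es e = c e" using es unfolding walks_with_def by auto
    then show ?thesis using assms Cons by simp
  qed
  moreover have "[] \<in> walks_with E src tgt r s c A \<longleftrightarrow> s = r \<and> A = {}"
    using assms unfolding walks_with_def by auto
  ultimately show ?thesis by (cases "s = r \<and> A = {}") auto
qed

text \<open>The new first edge is a last exit exactly if its source is not the root and is never
  left again, and the latter can be read off from the remaining multiplicities.\<close>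

lemma Cons_walks_with:
  assumes E: "finite E" and e: "e \<in> E" "src e = s" "c e > 0"
  shows "e # es \<in> walks_with E src tgt r s c A \<longleftrightarrow>
    es \<in> walks_with E src tgt r (tgt e) (dec c e) (last_exits src r es) \<and>
    A = (if s = r \<or> out_deg E src (dec c e) s > 0 then last_exits src r es
         else insert e (last_exits src r es))"
proof -
  have cnt: "(\<forall>f\<in>E. count_list (e # es) f = c f) \<longleftrightarrow> (\<forall>f\<in>E. count_list es f = dec c e f)"
    using e(3) by auto
  have "src e \<in> src ` set es \<longleftrightarrow> out_deg E src (dec c e) s > 0"
    if es: "set es \<subseteq> E" "\<forall>f\<in>E. count_list es f = dec c e f"
  proof -
    have mem: "dec c e f > 0 \<longleftrightarrow> f \<in> set es" if "f \<in> E" for f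
    proof -
      have "count_list es f = dec c e f" using es(2) that by blast
      then show ?thesis using count_list_0_iff[of es f] by (simp only: neq0_conv[symmetric]) blast
    qed
    have "src e \<in> src ` set es \<longleftrightarrow> (\<exists>f\<in>E. src f = s \<and> f \<in> set es)"
      using es(1) e(2) by (auto simp: image_iff) metis
    also have "\<dots> \<longleftrightarrow> (\<exists>f\<in>E. src f = s \<and> dec c e f > 0)" using mem by (intro bex_cong refl) simp
    also have "\<dots> \<longleftrightarrow> out_deg E src (dec c e) s > 0" by (rule out_deg_pos_iff[OF E, symmetric])
    finally show ?thesis .
  qed
  note key = this
  define d where "d = dec c e"
  have lists: "e # es \<in> lists E \<longleftrightarrow> set es \<subseteq> E" "es \<in> lists E \<longleftrightarrow> set es \<subseteq> E"
    using e(1) by auto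
  show ?thesis
  proof (cases "set es \<subseteq> E \<and> (\<forall>f\<in>E. count_list es f = d f)")
    case True
    then have "src e \<in> src ` set es \<longleftrightarrow> out_deg E src d s > 0" using key unfolding d_def by blast
    then show ?thesis
      unfolding walks_with_def cnt mem_Collect_eq lists d_def[symmetric] last_exits.simps walk.simps
      using True e(2) by auto
  next
    case False
    then show ?thesis unfolding walks_with_def cnt mem_Collect_eq lists d_def[symmetric] by blast
  qed
qed

lemma walks_with_cons_cases:
  assumes es: "es \<in> walks_with E src tgt r s c A" and c: "\<exists>e\<in>E. c e > 0"
  obtains e es' where "es = e # es'" "e \<in> E" "src e = s" "c e > 0"
proof (cases es)
  case Nil
  then show thesis using es c unfolding walks_with_def by auto
next
  case (Cons e es')
  then have "e \<in> E" "src e = s" "count_list es e = c e" using es unfolding walks_with_def by auto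
  then show thesis using that Cons by simp
qed

text \<open>The start is the root or will be left again, so the first edge is not a last exit and
  \<open>A\<close> is passed on unchanged.\<close>

lemma card_walks_with_branch:
  assumes E: "finite E" and c: "\<exists>e\<in>E. c e > 0" and br: "s = r \<or> out_deg E src c s \<ge> 2"
  shows "card (walks_with E src tgt r s c A) =
    (\<Sum>e\<in>{e \<in> E. src e = s \<and> c e > 0}. card (walks_with E src tgt r (tgt e) (dec c e) A))"
proof -
  let ?I = "{e \<in> E. src e = s \<and> c e > 0}"
  have pos: "s = r \<or> out_deg E src (dec c e) s > 0" if "e \<in> ?I" for e
    using br out_deg_dec[OF E, of e c src s] that by auto
  have eq: "walks_with E src tgt r s c A =
    (\<Union>e\<in>?I. (#) e ` walks_with E src tgt r (tgt e) (dec c e) A)" (is "?L = ?R")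
  proof (intro set_eqI iffI)
    fix es assume es: "es \<in> ?L"
    obtain e es' where e: "es = e # es'" "e \<in> E" "src e = s" "c e > 0"
      using walks_with_cons_cases[OF es c] .
    have "es' \<in> walks_with E src tgt r (tgt e) (dec c e) A"
      using es pos[of e] e unfolding e(1) Cons_walks_with[where e = e and c = c and src = src and s = s, OF E e(2-4)] by auto
    then show "es \<in> ?R" using e by blast
  next
    fix es assume "es \<in> ?R"
    then obtain e es' where e: "es = e # es'" "e \<in> ?I" "es' \<in> walks_with E src tgt r (tgt e) (dec c e) A"
      by blast
    then have "last_exits src r es' = A" unfolding walks_with_def by simp
    then show "es \<in> ?L"
      using e pos[of e] Cons_walks_with[OF E, of e src s c es' tgt r A] by auto
  qed
  have "card ?R = (\<Sum>e\<in>?I. card ((#) e ` walks_with E src tgt r (tgt e) (dec c e) A))"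
    using E by (intro card_UN_disjoint ballI finite_imageI walks_with_finite[OF E] impI) auto
  also have "\<dots> = (\<Sum>e\<in>?I. card (walks_with E src tgt r (tgt e) (dec c e) A))"
    by (intro sum.cong refl card_image) auto
  finally show ?thesis unfolding eq .
qed

text \<open>The only departure from \<open>s\<close> is also the last one, so its edge must belong
  to \<open>A\<close> and cannot be a last exit of the rest.\<close>

lemma card_walks_with_single:
  assumes E: "finite E" and e: "e \<in> E" "src e = s" "c e > 0" and s: "s \<noteq> r" "out_deg E src c s = 1"
  shows "card (walks_with E src tgt r s c A) =
    (if e \<in> A then card (walks_with E src tgt r (tgt e) (dec c e) (A - {e})) else 0)"
proof -
  have c: "\<exists>e\<in>E. c e > 0" using e by blast
  have 0: "out_deg E src (dec c e) s = 0" using out_deg_dec[OF E, of e c src s] e s by simp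
  have c0: "dec c e f = 0" if "f \<in> E" "src f = s" for f
    using 0 that out_deg_pos_iff[OF E, of src "dec c e" s] by auto
  have uniq: "f = e" if "f \<in> E" "src f = s" "c f > 0" for f
    using c0[of f] that by (auto split: if_splits)
  have nin: "e \<notin> last_exits src r es" if "es \<in> walks_with E src tgt r u (dec c e) B" for es u B
  proof
    assume "e \<in> last_exits src r es"
    then have "e \<in> set es" using last_exits_subset by fast
    moreover have "count_list es e = 0" using that c0[OF e(1,2)] e(1) unfolding walks_with_def by auto
    ultimately show False by (simp add: count_list_0_iff)
  qed
  have eq: "walks_with E src tgt r s c A =
    (if e \<in> A then (#) e ` walks_with E src tgt r (tgt e) (dec c e) (A - {e}) else {})" (is "?L = ?R")
  proof (intro set_eqI iffI)
    fix es assume es: "es \<in> ?L"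
    obtain f es' where f: "es = f # es'" "f \<in> E" "src f = s" "c f > 0"
      using walks_with_cons_cases[OF es c] .
    then have "f = e" using uniq by blast
    then have *: "es' \<in> walks_with E src tgt r (tgt e) (dec c e) (last_exits src r es')"
      "A = insert e (last_exits src r es')"
      using es f s 0 unfolding f(1) by (auto simp: Cons_walks_with[where e = e and c = c and src = src and s = s, OF E e])
    then have "last_exits src r es' = A - {e}" using nin[OF *(1)] by blast
    then show "es \<in> ?R" using * f \<open>f = e\<close> by auto
  next
    fix es assume "es \<in> ?R"
    then obtain es' where e': "e \<in> A" "es = e # es'" "es' \<in> walks_with E src tgt r (tgt e) (dec c e) (A - {e})"
      by (auto split: if_splits)
    then have "last_exits src r es' = A - {e}" unfolding walks_with_def by simp
    then show "es \<in> ?L" using e' s 0 by (auto simp: Cons_walks_with[where e = e and c = c and src = src and s = s, OF E e])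
  qed
  show ?thesis unfolding eq by (simp add: card_image)
qed

text \<open>The bound on \<open>c e\<close> keeps one copy of \<open>e\<close> in reserve if
  \<open>e\<close> is a last exit.\<close>

lemma eulerian_dec_branch:
  assumes E: "finite E" and eul: "eulerian E src tgt r s c A" and e: "e \<in> E" "src e = s" "c e > of_bool (e \<in> A)"
  shows "eulerian E src tgt r (tgt e) (dec c e) A"
proof -
  have ce: "c e > 0" using e(3) by simp
  have "out_deg E src (dec c e) v + of_bool (v = r) = out_deg E tgt (dec c e) v + of_bool (v = tgt e)" for v
  proof -
    have "out_deg E src c v + of_bool (v = r) = out_deg E tgt c v + of_bool (v = s)"
      using eul unfolding eulerian_def by blast
    then show ?thesis
      using out_deg_dec[OF E, of e c src v] out_deg_dec[OF E, of e c tgt v] e ce by (simp del: fun_upd_apply)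
  qed
  moreover have "\<forall>f\<in>A. dec c e f > 0" using eul e(3) unfolding eulerian_def by auto
  moreover have "\<forall>f\<in>E. dec c e f > 0 \<longrightarrow> src f = r \<or> src f \<in> src ` A"
  proof (intro ballI impI)
    fix f assume f: "f \<in> E" "dec c e f > 0"
    then have "c f > 0" by (cases "f = e") auto
    then show "src f = r \<or> src f \<in> src ` A" using eul f(1) unfolding eulerian_def by blast
  qed
  ultimately show ?thesis using eul unfolding eulerian_def by blast
qed

lemma eulerian_inc_branch:
  assumes E: "finite E" and eul: "eulerian E src tgt r (tgt e) (dec c e) A"
    and e: "e \<in> E" "src e = s" "c e > 0" and br: "s = r \<or> out_deg E src c s \<ge> 2"
  shows "eulerian E src tgt r s c A" "c e > of_bool (e \<in> A)"
proof -
  have A: "dec c e f > 0" if "f \<in> A" for f using eul that unfolding eulerian_def by blast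
  show "c e > of_bool (e \<in> A)" using A[of e] e(3) by auto
  have "out_deg E src c v + of_bool (v = r) = out_deg E tgt c v + of_bool (v = s)" for v
  proof -
    have "out_deg E src (dec c e) v + of_bool (v = r) = out_deg E tgt (dec c e) v + of_bool (v = tgt e)"
      using eul unfolding eulerian_def by blast
    then show ?thesis
      using out_deg_dec[OF E, of e c src v] out_deg_dec[OF E, of e c tgt v] e by (auto simp del: fun_upd_apply)
  qed
  moreover have "c f > 0" if "f \<in> A" for f using A[OF that] by (auto split: if_splits)
  moreover have sup: "src f = r \<or> src f \<in> src ` A" if "f \<in> E" "dec c e f > 0" for f
    using eul that unfolding eulerian_def by blast
  moreover have "src f = r \<or> src f \<in> src ` A" if "f \<in> E" "c f > 0" for f
  proof (cases "f = e \<and> s \<noteq> r")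
    case False
    then show ?thesis using sup[OF that(1)] that e by (cases "f = e") auto
  next
    case True
    then have "out_deg E src (dec c e) s > 0"
      using br out_deg_dec[OF E, of e c src s] e by simp
    then obtain g where "g \<in> E" "src g = s" "dec c e g > 0" using out_deg_pos_iff[OF E, of src "dec c e" s] by auto
    then show ?thesis using sup[of g] True e(2) by metis
  qed
  ultimately show "eulerian E src tgt r s c A" using eul unfolding eulerian_def by blast
qed

text \<open>Makes \<open>exit_orders_pascal\<close> applicable at the start. Outside the root, at
  most one of at least two exits is reserved for the tree. No tree edge leaves the root; if the root
  had no exit at all, then by balance it would have no entrance, the tree would be empty, and every
  edge in use would have to leave the root.\<close>

lemma eulerian_out_deg_pos:
  assumes E: "finite E" and eul: "eulerian E src tgt r s c A" and c: "\<exists>e\<in>E. c e > 0"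
    and br: "s = r \<or> out_deg E src c s \<ge> 2"
  shows "out_deg E src (\<lambda>e. c e - of_bool (e \<in> A)) s > 0"
proof (cases "s = r")
  case True
  have tr: "in_tree src tgt r A" "A \<subseteq> E" using eul unfolding eulerian_def by blast+
  have "out_deg E src c r > 0"
  proof (rule ccontr)
    assume "\<not> out_deg E src c r > 0"
    moreover have "out_deg E src c r + of_bool (r = r) = out_deg E tgt c r + of_bool (r = s)"
      using eul unfolding eulerian_def by blast
    ultimately have "\<not> out_deg E tgt c r > 0" using True by simp
    have "A = {}"
    proof (rule ccontr)
      assume "A \<noteq> {}"
      then obtain e where e: "e \<in> A" "tgt e = r" using in_tree_root[OF tr(1)] by blast
      then have "c e > 0" "e \<in> E" using eul tr(2) unfolding eulerian_def by auto
      then show False using e(2) \<open>\<not> out_deg E tgt c r > 0\<close> out_deg_pos_iff[OF E, of tgt c r] by auto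
    qed
    moreover obtain e where "e \<in> E" "c e > 0" using c by blast
    ultimately have "src e = r" using eul unfolding eulerian_def by blast
    then show False using \<open>e \<in> E\<close> \<open>c e > 0\<close> \<open>\<not> out_deg E src c r > 0\<close> out_deg_pos_iff[OF E, of src c r] by auto
  qed
  moreover have "out_deg E src (\<lambda>e. c e - of_bool (e \<in> A)) r = out_deg E src c r"
    unfolding out_deg_def using in_tree_src[OF tr(1)] by (intro sum.cong) auto
  ultimately show ?thesis using True by simp
next
  case False
  have tr: "in_tree src tgt r A" "A \<subseteq> E" using eul unfolding eulerian_def by blast+
  let ?S = "{e \<in> E. src e = s}"
  have "sum c ?S \<le> (\<Sum>e\<in>?S. (c e - of_bool (e \<in> A)) + of_bool (e \<in> A))" by (intro sum_mono) auto
  also have "\<dots> = (\<Sum>e\<in>?S. c e - of_bool (e \<in> A)) + card (?S \<inter> A)"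
    using E by (simp add: sum.distrib Int_def)
  finally have "out_deg E src c s \<le> out_deg E src (\<lambda>e. c e - of_bool (e \<in> A)) s + card (?S \<inter> A)"
    unfolding out_deg_def .
  moreover have "card (?S \<inter> A) \<le> 1"
    using in_tree_src[OF tr(1)] E by (subst card_le_Suc0_iff_eq[unfolded One_nat_def[symmetric]]) (auto dest: inj_onD)
  ultimately show ?thesis using br False by linarith
qed

text \<open>By balance, a start other than \<open>r\<close> that is left only once is never entered,
  so \<open>e\<close> can be cut off as a leaf of the tree. Conversely, the target of
  \<open>e\<close> is the root or is still left later, and hence belongs to the smaller
  tree.\<close>

lemma eulerian_single_iff:
  assumes E: "finite E" and e: "e \<in> E" "src e = s" "c e > 0" and s: "s \<noteq> r" "out_deg E src c s = 1"
  shows "eulerian E src tgt r s c A \<longleftrightarrow> e \<in> A \<and> eulerian E src tgt r (tgt e) (dec c e) (A - {e})"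
proof -
  have 0: "out_deg E src (dec c e) s = 0" using out_deg_dec[OF E, of e c src s] e s by simp
  have c0: "dec c e f = 0" if "f \<in> E" "src f = s" for f
    using 0 that out_deg_pos_iff[OF E, of src "dec c e" s] by auto
  have uniq: "f = e" if "f \<in> E" "src f = s" "c f > 0" for f
    using c0[of f] that by (auto split: if_splits)
  have bal: "(out_deg E src c v + of_bool (v = r) = out_deg E tgt c v + of_bool (v = s)) \<longleftrightarrow>
     (out_deg E src (dec c e) v + of_bool (v = r) = out_deg E tgt (dec c e) v + of_bool (v = tgt e))" for v
    using out_deg_dec[OF E, of e c src v] out_deg_dec[OF E, of e c tgt v] e by (auto simp del: fun_upd_apply)
  have ce: "dec c e f = (if f = e then 0 else c f)" for f using c0[OF e(1,2)] by auto
  show ?thesis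
  proof
    assume eul: "eulerian E src tgt r s c A"
    then have "src e = r \<or> src e \<in> src ` A" using e(1,3) unfolding eulerian_def by blast
    then obtain f where f: "f \<in> A" "src f = s" using e(2) s(1) by auto
    then have "f \<in> E" "c f > 0" using eul unfolding eulerian_def by auto
    then have eA: "e \<in> A" using uniq f by blast
    have "out_deg E src c s + of_bool (s = r) = out_deg E tgt c s + of_bool (s = s)"
      using eul unfolding eulerian_def by blast
    then have "out_deg E tgt c s = 0" using s by simp
    have "\<forall>f\<in>A. tgt f \<noteq> src e"
    proof
      fix f assume "f \<in> A"
      then have "f \<in> E" "c f > 0" using eul unfolding eulerian_def by auto
      then show "tgt f \<noteq> src e" using \<open>out_deg E tgt c s = 0\<close> out_deg_pos_iff[OF E, of tgt c s] e(2) by auto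
    qed
    then have 1: "in_tree src tgt r (A - {e})" using in_tree_remove[of src tgt r A e] eA eul unfolding eulerian_def by blast
    moreover have 2: "\<forall>f\<in>A - {e}. dec c e f > 0" using eul unfolding ce eulerian_def by auto
    moreover have 3: "src f = r \<or> src f \<in> src ` (A - {e})" if f: "f \<in> E" "dec c e f > 0" for f
    proof -
      have "c f > 0" "src f \<noteq> src e" using f c0[of f] e(2) unfolding ce by (auto split: if_splits)
      then have "src f = r \<or> src f \<in> src ` A" using eul f(1) unfolding eulerian_def by blast
      then show ?thesis using \<open>src f \<noteq> src e\<close> by auto
    qed
    ultimately show "e \<in> A \<and> eulerian E src tgt r (tgt e) (dec c e) (A - {e})"
    proof -
      have "\<forall>v. out_deg E src (dec c e) v + of_bool (v = r) = out_deg E tgt (dec c e) v + of_bool (v = tgt e)"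
        using eul bal unfolding eulerian_def by blast
      moreover have "A - {e} \<subseteq> E" using eul unfolding eulerian_def by blast
      ultimately show ?thesis
        using eA 1 2 3 unfolding eulerian_def by (intro conjI) simp_all
    qed
  next
    assume asm: "e \<in> A \<and> eulerian E src tgt r (tgt e) (dec c e) (A - {e})"
    let ?B = "A - {e}"
    have B: "A = insert e ?B" using asm by blast
    have eul: "in_tree src tgt r ?B" "?B \<subseteq> E" "\<And>f. f \<in> ?B \<Longrightarrow> dec c e f > 0"
      "\<And>v. out_deg E src (dec c e) v + of_bool (v = r) = out_deg E tgt (dec c e) v + of_bool (v = tgt e)"
      "\<And>f. f \<in> E \<Longrightarrow> dec c e f > 0 \<Longrightarrow> src f = r \<or> src f \<in> src ` ?B"
      using asm unfolding eulerian_def by blast+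
    have tr: "in_tree src tgt r A"
    proof (subst B, rule in_tree.insert[OF eul(1)])
      show "src e \<notin> src ` ?B"
      proof
        assume "src e \<in> src ` ?B"
        then obtain f where f: "f \<in> ?B" "src f = s" using e(2) by force
        moreover have "f \<in> E" using f eul(2) by blast
        ultimately show False using eul(3)[of f] c0[of f] by simp
      qed
      show "src e \<noteq> r" using e s by simp
      show "tgt e \<in> insert r (src ` ?B)"
      proof (cases "tgt e = r")
        case False
        then have "out_deg E src (dec c e) (tgt e) > 0" using eul(4)[of "tgt e"] by simp
        then obtain f where "f \<in> E" "src f = tgt e" "dec c e f > 0"
          using out_deg_pos_iff[OF E, of src "dec c e" "tgt e"] by auto
        then have "src f = r \<or> src f \<in> src ` ?B" using eul(5)[of f] by blast
        then show ?thesis using \<open>src f = tgt e\<close> by auto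
      qed simp
    qed
    have "\<forall>f\<in>A. c f > 0"
    proof
      fix f assume "f \<in> A"
      then show "c f > 0" using eul(3)[of f] e(3) by (cases "f = e") auto
    qed
    moreover have "\<forall>f\<in>E. c f > 0 \<longrightarrow> src f = r \<or> src f \<in> src ` A"
    proof (intro ballI impI)
      fix f assume f: "f \<in> E" "c f > 0"
      show "src f = r \<or> src f \<in> src ` A"
      proof (cases "f = e")
        case False
        then have "dec c e f > 0" using f by simp
        then show ?thesis using eul(5)[OF f(1)] by blast
      qed (use asm in blast)
    qed
    moreover have "A \<subseteq> E" using eul(2) e(1) by blast
    ultimately show "eulerian E src tgt r s c A"
      unfolding eulerian_def bal using tr eul(4) by simp
  qed
qed

text \<open>Induction on the number of edges, with the root fixed and the start moving along. If the
  start is the root or has several exits, Pascal's rule applies; with a single exit the tree loses a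
  leaf; without an exit both sides vanish.\<close>

theorem card_walks_with:
  assumes E: "finite E"
  shows "real (card (walks_with E src tgt r s c A)) =
    (if eulerian E src tgt r s c A then exit_orders E src (\<lambda>e. c e - of_bool (e \<in> A)) else 0)"
proof (induction "sum c E" arbitrary: s c A rule: less_induct)
  case less
  have dec: "sum (dec c e) E < sum c E" if "e \<in> E" "c e > 0" for e
  proof -
    have "sum c E = c e + sum c (E - {e})" using E that by (intro sum.remove) auto
    moreover have "sum (dec c e) E = dec c e e + sum (dec c e) (E - {e})" using E that by (intro sum.remove) auto
    moreover have "sum (dec c e) (E - {e}) = sum c (E - {e})" by (intro sum.cong) auto
    ultimately show ?thesis using that by simp
  qed
  let ?x = "\<lambda>A e. c e - (of_bool (e \<in> A) :: nat)"
  show ?case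
  proof (cases "\<exists>e\<in>E. c e > 0")
    case False
    then have c: "c e = 0" if "e \<in> E" for e using that by auto
    then have "out_deg E f c v = 0" for f :: "'a \<Rightarrow> 'b" and v unfolding out_deg_def by simp
    then have "eulerian E src tgt r s c A \<longleftrightarrow> s = r \<and> A = {}"
      using c unfolding eulerian_def by (auto simp: in_tree.empty subset_eq split: if_splits)
    moreover have "exit_orders E src (?x {}) = 1" using c unfolding exit_orders_def out_deg_def by simp
    ultimately show ?thesis using walks_with_0[of E c src tgt r s A] c by auto
  next
    case c: True
    consider "s = r \<or> out_deg E src c s \<ge> 2" | "s \<noteq> r" "out_deg E src c s = 1" | "s \<noteq> r" "out_deg E src c s = 0"
      by linarith
    then show ?thesis
    proof cases
      case 1
      let ?I = "{e \<in> E. src e = s \<and> c e > 0}"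
      have "real (card (walks_with E src tgt r s c A)) =
        (\<Sum>e\<in>?I. real (card (walks_with E src tgt r (tgt e) (dec c e) A)))"
        using card_walks_with_branch[OF E c 1, of tgt A] by simp
      also have "\<dots> = (\<Sum>e\<in>?I. if eulerian E src tgt r (tgt e) (dec c e) A
          then exit_orders E src (\<lambda>f. dec c e f - of_bool (f \<in> A)) else 0)"
        using less dec by (intro sum.cong refl) simp
      also have "\<dots> = (\<Sum>e\<in>?I. if eulerian E src tgt r s c A \<and> ?x A e > 0
          then exit_orders E src (dec (?x A) e) else 0)"
      proof (rule sum.cong[OF refl])
        fix e assume e: "e \<in> ?I"
        have "eulerian E src tgt r (tgt e) (dec c e) A \<longleftrightarrow> eulerian E src tgt r s c A \<and> ?x A e > 0"
          using eulerian_dec_branch[OF E, of src tgt r s c A e] eulerian_inc_branch[OF E, of src tgt r e c A s] e 1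
          by (auto simp del: fun_upd_apply)
        moreover have "(\<lambda>f. dec c e f - of_bool (f \<in> A)) = dec (?x A) e" by auto
        ultimately show "(if eulerian E src tgt r (tgt e) (dec c e) A
          then exit_orders E src (\<lambda>f. dec c e f - of_bool (f \<in> A)) else 0) =
          (if eulerian E src tgt r s c A \<and> ?x A e > 0 then exit_orders E src (dec (?x A) e) else 0)" by presburger
      qed
      also have "\<dots> = (if eulerian E src tgt r s c A then exit_orders E src (?x A) else 0)"
      proof (cases "eulerian E src tgt r s c A")
        case True
        have "(\<Sum>e\<in>?I. if ?x A e > 0 then exit_orders E src (dec (?x A) e) else 0) =
          (\<Sum>e\<in>{e \<in> ?I. ?x A e > 0}. exit_orders E src (dec (?x A) e))"
          using E by (intro sum.inter_filter[symmetric]) auto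
        also have "{e \<in> ?I. ?x A e > 0} = {e \<in> E. src e = s \<and> ?x A e > 0}" by auto
        also have "(\<Sum>e\<in>\<dots>. exit_orders E src (dec (?x A) e)) = exit_orders E src (?x A)"
          using exit_orders_pascal[OF E eulerian_out_deg_pos[OF E True c 1]] by simp
        finally show ?thesis using True by simp
      qed simp
      finally show ?thesis .
    next
      case 2
      then obtain e where e: "e \<in> E" "src e = s" "c e > 0" using out_deg_pos_iff[OF E, of src c s] by auto
      have "real (card (walks_with E src tgt r s c A)) =
        (if e \<in> A then real (card (walks_with E src tgt r (tgt e) (dec c e) (A - {e}))) else 0)"
        using card_walks_with_single[where e = e and c = c and src = src and s = s, OF E e 2, of tgt A] by simp
      also have "\<dots> = (if e \<in> A \<and> eulerian E src tgt r (tgt e) (dec c e) (A - {e})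
          then exit_orders E src (\<lambda>f. dec c e f - of_bool (f \<in> A - {e})) else 0)"
        using less[of "dec c e" "tgt e" "A - {e}"] dec[OF e(1,3)] by presburger
      also have "e \<in> A \<and> eulerian E src tgt r (tgt e) (dec c e) (A - {e}) \<longleftrightarrow> eulerian E src tgt r s c A"
        using eulerian_single_iff[where e = e and c = c and src = src and s = s, OF E e 2] by blast
      also have "(if eulerian E src tgt r s c A then exit_orders E src (\<lambda>f. dec c e f - of_bool (f \<in> A - {e})) else 0) =
          (if eulerian E src tgt r s c A then exit_orders E src (?x A) else 0)"
      proof -
        have "(\<lambda>f. dec c e f - of_bool (f \<in> A - {e})) = ?x A" if "eulerian E src tgt r s c A"
        proof -
          have "e \<in> A" using that eulerian_single_iff[where e = e and c = c and src = src and s = s, OF E e 2] by blast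
          then show ?thesis by auto
        qed
        then show ?thesis by presburger
      qed
      finally show ?thesis .
    next
      case 3
      have "walks_with E src tgt r s c A = {}"
      proof (rule ccontr)
        assume "walks_with E src tgt r s c A \<noteq> {}"
        then obtain es where "es \<in> walks_with E src tgt r s c A" by blast
        then obtain e es' where "e \<in> E" "src e = s" "c e > 0" using walks_with_cons_cases c by metis
        then show False using 3 out_deg_pos_iff[OF E, of src c s] by auto
      qed
      moreover have "\<not> eulerian E src tgt r s c A"
      proof
        assume "eulerian E src tgt r s c A"
        then have "out_deg E src c s + of_bool (s = r) = out_deg E tgt c s + of_bool (s = s)"
          unfolding eulerian_def by blast
        then show False using 3 by simp
      qed
      ultimately show ?thesis by simp
    qed
  qed
qed

section \<open>Binomial multisums\<close>

text \<open>One real equation in integer unknowns amounts to finitely many equations with integer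
  coefficients. Either all relations have coefficient 0 at \<open>j\<close>, or a relation
  \<open>b\<close> with \<open>b j \<noteq> 0\<close> eliminates \<open>w j\<close> after
  multiplication by \<open>b j\<close>.\<close>

lemma integer_relations:
  assumes "finite I"
  shows "\<exists>M::('i \<Rightarrow> int) list. \<forall>c::'i \<Rightarrow> int.
    (\<Sum>i\<in>I. real_of_int (c i) * w i) = 0 \<longleftrightarrow> (\<forall>m\<in>set M. (\<Sum>i\<in>I. m i * c i) = 0)"
  using assms
proof (induction I)
  case empty
  show ?case by (intro exI[of _ "[]"]) simp
next
  case (insert j I)
  obtain M where M: "\<And>c::'i \<Rightarrow> int. (\<Sum>i\<in>I. real_of_int (c i) * w i) = 0 \<longleftrightarrow> (\<forall>m\<in>set M. (\<Sum>i\<in>I. m i * c i) = 0)"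
    using insert.IH by blast
  show ?case
  proof (cases "\<exists>b::'i \<Rightarrow> int. b j \<noteq> 0 \<and> (\<Sum>i\<in>insert j I. real_of_int (b i) * w i) = 0")
    case False
    have "(\<Sum>i\<in>insert j I. real_of_int (c i) * w i) = 0 \<longleftrightarrow>
      (\<forall>m\<in>set ((\<lambda>i. if i = j then 1 else 0) # map (\<lambda>m. m(j := 0)) M). (\<Sum>i\<in>insert j I. m i * c i) = 0)" for c :: "'i \<Rightarrow> int"
    proof -
      have 1: "(\<Sum>i\<in>I. (if i = j then 1 else 0) * c i) = 0" using insert by (intro sum.neutral) auto
      have 2: "(\<Sum>i\<in>I. (m(j := 0)) i * c i) = (\<Sum>i\<in>I. m i * c i)" for m
        using insert by (intro sum.cong) auto
      have "(\<Sum>i\<in>insert j I. real_of_int (c i) * w i) = 0 \<longleftrightarrow> c j = 0 \<and> (\<Sum>i\<in>I. real_of_int (c i) * w i) = 0"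
        using False insert by (cases "c j = 0") auto
      then show ?thesis using insert.hyps M[of c] 1 2 by simp
    qed
    then show ?thesis by blast
  next
    case True
    then obtain b :: "'i \<Rightarrow> int" where b: "b j \<noteq> 0" "(\<Sum>i\<in>insert j I. real_of_int (b i) * w i) = 0" by blast
    \<comment> \<open>The equation \<open>m\<close> for the coefficients
      \<open>b j * c i - c j * b i\<close>, rewritten as a linear form in \<open>c\<close>.\<close>
    let ?m = "\<lambda>m i. if i = j then - (\<Sum>k\<in>I. m k * b k) else b j * m i"
    have "(\<Sum>i\<in>insert j I. real_of_int (c i) * w i) = 0 \<longleftrightarrow>
      (\<forall>m\<in>set (map ?m M). (\<Sum>i\<in>insert j I. m i * c i) = 0)" for c :: "'i \<Rightarrow> int"
    proof -
      have wj: "real_of_int (b j) * w j = - (\<Sum>i\<in>I. real_of_int (b i) * w i)"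
        using b(2) insert.hyps by simp
      have "real_of_int (b j) * (\<Sum>i\<in>insert j I. real_of_int (c i) * w i) =
          real_of_int (c j) * (real_of_int (b j) * w j) + real_of_int (b j) * (\<Sum>i\<in>I. real_of_int (c i) * w i)"
        using insert.hyps by (simp add: algebra_simps)
      also have "\<dots> = (\<Sum>i\<in>I. real_of_int (b j * c i - c j * b i) * w i)"
        unfolding wj by (simp add: sum_distrib_left sum_subtractf[symmetric] algebra_simps)
      finally have "(\<Sum>i\<in>insert j I. real_of_int (c i) * w i) = 0 \<longleftrightarrow>
          (\<Sum>i\<in>I. real_of_int (b j * c i - c j * b i) * w i) = 0"
        using b(1) by (metis mult_eq_0_iff of_int_eq_0_iff)
      also have "\<dots> \<longleftrightarrow> (\<forall>m\<in>set M. (\<Sum>i\<in>I. m i * (b j * c i - c j * b i)) = 0)" using M .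
      also have "\<dots> \<longleftrightarrow> (\<forall>m\<in>set M. (\<Sum>i\<in>insert j I. ?m m i * c i) = 0)"
      proof -
        have "(\<Sum>i\<in>insert j I. ?m m i * c i) = (\<Sum>i\<in>I. m i * (b j * c i - c j * b i))" for m
        proof -
          have "(\<Sum>i\<in>insert j I. ?m m i * c i) = - (\<Sum>k\<in>I. m k * b k) * c j + (\<Sum>i\<in>I. ?m m i * c i)"
            using insert.hyps by simp
          also have "(\<Sum>i\<in>I. ?m m i * c i) = (\<Sum>i\<in>I. b j * m i * c i)"
            using insert.hyps by (intro sum.cong) auto
          finally show ?thesis by (simp add: sum_distrib_left sum_distrib_right sum_subtractf[symmetric] algebra_simps)
        qed
        then show ?thesis by simp
      qed
      finally show ?thesis by simp
    qed
    then show ?thesis by blast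
  qed
qed

lemma int_binom_diag: "int_binom x x = of_bool (x \<ge> 0)"
  by (auto simp: int_binom_def)

lemma int_binom_0: "int_binom 0 x = of_bool (x = 0)"
  by (auto simp: int_binom_def)

lemma int_binom_pred: "int_binom (x - 1) x = of_bool (x = 0)"
  by (auto simp: int_binom_def)

lemma exit_orders_superset:
  assumes "finite E" "finite V" "src ` E \<subseteq> V"
  shows "exit_orders E src x = (\<Prod>v\<in>V. fact (out_deg E src x v)) / (\<Prod>e\<in>E. fact (x e))"
proof -
  have "(\<Prod>v\<in>V. fact (out_deg E src x v)) = (\<Prod>v\<in>src ` E. fact (out_deg E src x v) :: real)"
  proof (rule prod.mono_neutral_right[OF assms(2,3)], intro ballI)
    fix v assume "v \<in> V - src ` E"
    then have "{e \<in> E. src e = v} = {}" by blast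
    then have "out_deg E src x v = 0" unfolding out_deg_def by (simp only: sum.empty)
    then show "fact (out_deg E src x v) = (1::real)" by simp
  qed
  then show ?thesis unfolding exit_orders_def by simp
qed

text \<open>Edges are inserted in the order of their numbers. Edge \<open>i\<close> multiplies the
  multinomial coefficient at its source by a binomial coefficient whose upper entry counts all
  copies of edges up to \<open>i\<close> with that source.\<close>

lemma exit_orders_binom:
  fixes m :: nat
  shows "exit_orders {1..m} src x =
    real (\<Prod>i=1..m. int_binom (\<Sum>j | j \<in> {1..i} \<and> src j = src i. int (x j)) (int (x i)))"
proof (induction m)
  case 0
  then show ?case by (simp add: exit_orders_def)
next
  case (Suc m)
  let ?V = "src ` {1..Suc m}" and ?v = "src (Suc m)"
  let ?n = "out_deg {1..m} src x ?v"
  have od: "out_deg {1..Suc m} src x u = out_deg {1..m} src x u + (if u = ?v then x (Suc m) else 0)" for u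
  proof -
    have "{j \<in> {1..Suc m}. src j = u} = (if u = ?v then insert (Suc m) {j \<in> {1..m}. src j = u} else {j \<in> {1..m}. src j = u})"
      by (auto simp: le_Suc_eq)
    then show ?thesis unfolding out_deg_def by simp
  qed
  have "(\<Prod>u\<in>?V. fact (out_deg {1..Suc m} src x u)) =
      fact (?n + x (Suc m)) * (\<Prod>u\<in>?V - {?v}. fact (out_deg {1..Suc m} src x u) :: real)"
    using od[of ?v] by (subst prod.remove[of _ ?v]) auto
  also have "(\<Prod>u\<in>?V - {?v}. fact (out_deg {1..Suc m} src x u)) = (\<Prod>u\<in>?V - {?v}. fact (out_deg {1..m} src x u) :: real)"
    using od by (intro prod.cong) auto
  finally have 1: "(\<Prod>u\<in>?V. fact (out_deg {1..Suc m} src x u)) =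
      fact (?n + x (Suc m)) * (\<Prod>u\<in>?V - {?v}. fact (out_deg {1..m} src x u) :: real)" .
  have 2: "(\<Prod>u\<in>?V. fact (out_deg {1..m} src x u)) = fact ?n * (\<Prod>u\<in>?V - {?v}. fact (out_deg {1..m} src x u) :: real)"
    by (subst prod.remove[of _ ?v]) auto
  have b: "real ((?n + x (Suc m)) choose x (Suc m)) = fact (?n + x (Suc m)) / (fact ?n * fact (x (Suc m)))"
    by (subst binomial_fact) auto
  have eo: "exit_orders {1..m} src x = (\<Prod>v\<in>?V. fact (out_deg {1..m} src x v)) / (\<Prod>e=1..m. fact (x e))"
    by (intro exit_orders_superset) auto
  have "exit_orders {1..Suc m} src x = exit_orders {1..m} src x * real ((?n + x (Suc m)) choose x (Suc m))"
    unfolding eo 2 b unfolding exit_orders_def 1 by (simp add: field_simps)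
  moreover have "int_binom (\<Sum>j | j \<in> {1..Suc m} \<and> src j = src (Suc m). int (x j)) (int (x (Suc m))) =
      (?n + x (Suc m)) choose x (Suc m)"
  proof -
    have "(\<Sum>j | j \<in> {1..Suc m} \<and> src j = src (Suc m). int (x j)) = int (?n + x (Suc m))"
    proof -
      have "int (out_deg {1..Suc m} src x ?v) = int (?n + x (Suc m))" unfolding od by simp
      then show ?thesis unfolding out_deg_def of_nat_sum .
    qed
    then show ?thesis by (simp add: int_binom_def nat_add_distrib)
  qed
  ultimately show ?case using Suc by simp
qed

section \<open>Finite sums and products of binomials of affine forms\<close>

lemma has_finite_sum_inj:
  assumes inj: "inj_on h Y" and h: "\<And>y. y \<in> Y \<Longrightarrow> h y \<in> X \<and> g (h y) = g' y"
    and supp: "\<And>x. x \<in> X \<Longrightarrow> g x \<noteq> 0 \<Longrightarrow> x \<in> h ` Y" and s: "has_finite_sum g' Y s"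
  shows "has_finite_sum g X s"
proof -
  let ?Y = "{y \<in> Y. g' y \<noteq> 0}"
  have X: "{x \<in> X. g x \<noteq> 0} = h ` ?Y"
  proof (intro set_eqI iffI)
    fix x assume x: "x \<in> {x \<in> X. g x \<noteq> 0}"
    then obtain y where "y \<in> Y" "x = h y" using supp by blast
    then show "x \<in> h ` ?Y" using h[of y] x by auto
  next
    fix x assume "x \<in> h ` ?Y"
    then show "x \<in> {x \<in> X. g x \<noteq> 0}" using h by auto
  qed
  have "inj_on h ?Y" using inj by (rule inj_on_subset) auto
  then have "sum g (h ` ?Y) = (\<Sum>y\<in>?Y. g (h y))" by (rule sum.reindex_cong) auto
  also have "\<dots> = sum g' ?Y" using h by (intro sum.cong) auto
  finally show ?thesis using s unfolding has_finite_sum_def X by simp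
qed

lemma has_finite_sum_Sigma:
  assumes "finite K" "\<And>k. k \<in> K \<Longrightarrow> has_finite_sum (g k) X (s k)"
  shows "has_finite_sum (\<lambda>(k, x). g k x) (K \<times> X) (\<Sum>k\<in>K. s k)"
proof -
  have eq: "{z \<in> K \<times> X. (case z of (k, x) \<Rightarrow> g k x) \<noteq> 0} = Sigma K (\<lambda>k. {x \<in> X. g k x \<noteq> 0})" by auto
  have fin: "\<forall>k\<in>K. finite {x \<in> X. g k x \<noteq> 0}" using assms(2) unfolding has_finite_sum_def by blast
  have "(\<Sum>k\<in>K. s k) = (\<Sum>k\<in>K. \<Sum>x\<in>{x \<in> X. g k x \<noteq> 0}. g k x)"
    using assms(2) unfolding has_finite_sum_def by (intro sum.cong) auto
  also have "\<dots> = (\<Sum>(k, x)\<in>Sigma K (\<lambda>k. {x \<in> X. g k x \<noteq> 0}). g k x)"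
    using assms(1) fin by (rule sum.Sigma)
  finally show ?thesis unfolding has_finite_sum_def eq using fin assms(1) by (auto intro: finite_SigmaI)
qed

text \<open>The multisums use \<open>aff_val\<close> at \<open>p = n\<close>, \<open>q = 1\<close>; taking \<open>p = q = 0\<close> switches the constant part of
  an affine form off.\<close>

type_synonym 'j aff = "('j \<Rightarrow> int) \<times> int \<times> int"

definition aff_val :: "'j set \<Rightarrow> ('j \<Rightarrow> int) \<Rightarrow> int \<Rightarrow> int \<Rightarrow> 'j aff \<Rightarrow> int" where
  "aff_val J v p q F = (\<Sum>j\<in>J. fst F j * v j) + fst (snd F) * p + snd (snd F) * q"

definition binom_term :: "'j set \<Rightarrow> ('j aff \<times> 'j aff) list \<Rightarrow> ('j \<Rightarrow> int) \<Rightarrow> int \<Rightarrow> int \<Rightarrow> nat" where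
  "binom_term J Fs v p q = (\<Prod>(F, G)\<leftarrow>Fs. int_binom (aff_val J v p q F) (aff_val J v p q G))"

lemma binom_term_append: "binom_term J (Fs @ Gs) v p q = binom_term J Fs v p q * binom_term J Gs v p q"
  unfolding binom_term_def by simp

lemma binom_term_zero_vector: "(\<And>j. j \<in> J \<Longrightarrow> v j = 0) \<Longrightarrow> binom_term J Fs v 0 0 = 1"
proof -
  assume "\<And>j. j \<in> J \<Longrightarrow> v j = 0"
  then have "aff_val J v 0 0 F = 0" for F unfolding aff_val_def by simp
  then show ?thesis unfolding binom_term_def by (induction Fs) (auto simp: int_binom_def)
qed

lemma binom_term_concat: "binom_term J (concat Fss) v p q = (\<Prod>Fs\<leftarrow>Fss. binom_term J Fs v p q)"
  by (induction Fss) (simp_all add: binom_term_append, simp add: binom_term_def)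

lemma binom_term_cong:
  assumes "\<And>j. j \<in> J \<Longrightarrow> v j = w j"
  shows "binom_term J Fs v p q = binom_term J Fs w p q"
proof -
  have "aff_val J v p q = aff_val J w p q" unfolding aff_val_def using assms by (auto intro!: ext sum.cong)
  then show ?thesis unfolding binom_term_def by simp
qed

lemma binom_multisum_standard:
  fixes J :: "'j set" and Fs :: "('j aff \<times> 'j aff) list"
  assumes J: "finite J" and s: "\<And>n. has_finite_sum (\<lambda>v. binom_term J Fs v (int n) 1) (J \<rightarrow>\<^sub>E UNIV) (f n)"
  shows "\<exists>(r::nat) (d::nat) (a :: nat \<Rightarrow> nat \<Rightarrow> int) (b :: nat \<Rightarrow> nat \<Rightarrow> int)
       (a' :: nat \<Rightarrow> int) (b' :: nat \<Rightarrow> int) (a'' :: nat \<Rightarrow> int) (b'' :: nat \<Rightarrow> int).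
       \<forall>n::nat.
         has_finite_sum
           (\<lambda>v. \<Prod>i=1..r. int_binom
              ((\<Sum>j=1..d. a i j * v j) + a' i * int n + a'' i)
              ((\<Sum>j=1..d. b i j * v j) + b' i * int n + b'' i))
           (int_vectors d) (f n)"
proof -
  obtain h where h: "bij_betw h {1..card J} J" using ex_bij_betw_nat_finite_1[OF J] by blast
  define F G where "F = (\<lambda>i. fst (Fs ! (i - 1)))" and "G = (\<lambda>i. snd (Fs ! (i - 1)))" for i :: nat
  let ?d = "card J"
  define H where "H = (\<lambda>v::nat \<Rightarrow> int. restrict (v \<circ> inv_into {1..?d} h) J)"
  have Hh: "H v (h i) = v i" if "i \<in> {1..?d}" for v i
    using h that unfolding H_def bij_betw_def by (auto simp: inv_into_f_f)
  have val: "aff_val J (H v) p 1 K = (\<Sum>j=1..?d. fst K (h j) * v j) + fst (snd K) * p + snd (snd K)" for v p K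
  proof -
    have "(\<Sum>j\<in>J. fst K j * H v j) = (\<Sum>j=1..?d. fst K (h j) * H v (h j))"
      using sum.reindex_bij_betw[OF h, of "\<lambda>j. fst K j * H v j"] by simp
    also have "\<dots> = (\<Sum>j=1..?d. fst K (h j) * v j)" using Hh by (intro sum.cong) auto
    finally show ?thesis unfolding aff_val_def by simp
  qed
  have trm: "binom_term J Fs (H v) p 1 = (\<Prod>i=1..length Fs. int_binom
      ((\<Sum>j=1..?d. fst (F i) (h j) * v j) + fst (snd (F i)) * p + snd (snd (F i)))
      ((\<Sum>j=1..?d. fst (G i) (h j) * v j) + fst (snd (G i)) * p + snd (snd (G i))))" for v p
  proof -
    have "binom_term J Fs (H v) p 1 = (\<Prod>i<length Fs. int_binom (aff_val J (H v) p 1 (fst (Fs ! i))) (aff_val J (H v) p 1 (snd (Fs ! i))))"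
      unfolding binom_term_def by (simp add: prod.list_conv_set_nth lessThan_atLeast0 case_prod_beta)
    also have "\<dots> = (\<Prod>i=1..length Fs. int_binom (aff_val J (H v) p 1 (F i)) (aff_val J (H v) p 1 (G i)))"
      unfolding F_def G_def by (rule prod.reindex_bij_witness[of _ "\<lambda>i. i - 1" Suc]) auto
    finally show ?thesis unfolding val .
  qed
  have "has_finite_sum (\<lambda>v. \<Prod>i=1..length Fs. int_binom
      ((\<Sum>j=1..?d. fst (F i) (h j) * v j) + fst (snd (F i)) * int n + snd (snd (F i)))
      ((\<Sum>j=1..?d. fst (G i) (h j) * v j) + fst (snd (G i)) * int n + snd (snd (G i)))) (int_vectors ?d) (f n)" for n
  proof (rule has_finite_sum_inj[where h = "\<lambda>x. restrict (x \<circ> h) {1..card J}", OF _ _ _ s])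
    let ?h = "\<lambda>x. restrict (x \<circ> h) {1..?d}"
    have inv: "H (?h x) = x" if "x \<in> J \<rightarrow>\<^sub>E UNIV" for x
    proof
      fix j show "H (?h x) j = x j"
      proof (cases "j \<in> J")
        case True
        then obtain i where "i \<in> {1..?d}" "j = h i" using h unfolding bij_betw_def by blast
        then show ?thesis using Hh by simp
      next
        case False
        then show ?thesis using that by (auto simp: H_def)
      qed
    qed
    show "inj_on ?h (J \<rightarrow>\<^sub>E (UNIV :: int set))"
    proof (rule inj_onI)
      fix x y :: "'j \<Rightarrow> int" assume "x \<in> J \<rightarrow>\<^sub>E UNIV" "y \<in> J \<rightarrow>\<^sub>E UNIV" "?h x = ?h y"
      then show "x = y" using inv[of x] inv[of y] by simp
    qed
    show "?h x \<in> int_vectors ?d \<and> (\<Prod>i=1..length Fs. int_binom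
      ((\<Sum>j=1..?d. fst (F i) (h j) * ?h x j) + fst (snd (F i)) * int n + snd (snd (F i)))
      ((\<Sum>j=1..?d. fst (G i) (h j) * ?h x j) + fst (snd (G i)) * int n + snd (snd (G i)))) = binom_term J Fs x (int n) 1"
      if "x \<in> J \<rightarrow>\<^sub>E UNIV" for x
    proof
      show "?h x \<in> int_vectors ?d" unfolding int_vectors_def by auto
    qed (subst trm[symmetric], simp only: inv[OF that])
    show "v \<in> ?h ` (J \<rightarrow>\<^sub>E UNIV)" if "v \<in> int_vectors ?d" for v
    proof (rule image_eqI)
      show "v = ?h (H v)"
      proof
        fix i show "v i = ?h (H v) i"
          using that Hh[of i v] unfolding int_vectors_def by (cases "i \<in> {1..?d}") (auto simp: PiE_def extensional_def)
      qed
      show "H v \<in> J \<rightarrow>\<^sub>E UNIV" unfolding H_def by auto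
    qed
  qed
  then show ?thesis
    by (rule_tac exI[of _ "length Fs"], rule_tac exI[of _ "card J"],
        rule_tac exI[of _ "\<lambda>i j. fst (F i) (h j)"], rule_tac exI[of _ "\<lambda>i j. fst (G i) (h j)"],
        rule_tac exI[of _ "\<lambda>i. fst (snd (F i))"], rule_tac exI[of _ "\<lambda>i. fst (snd (G i))"],
        rule_tac exI[of _ "\<lambda>i. snd (snd (F i))"], rule_tac exI[of _ "\<lambda>i. snd (snd (G i))"]) simp
qed

section \<open>Sums of several multisums\<close>

definition var :: "'j \<Rightarrow> 'j aff" where
  "var z = ((\<lambda>x. of_bool (x = z)), 0, 0)"

definition guard :: "'j \<Rightarrow> 'j \<Rightarrow> 'j aff" where
  "guard u z = ((\<lambda>x. of_bool (x = z) + of_bool (x = u)), 0, - 1)"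

lemma aff_val_var: "finite J \<Longrightarrow> z \<in> J \<Longrightarrow> aff_val J v p q (var z) = v z"
  by (simp add: aff_val_def var_def)

lemma aff_val_guard:
  "finite J \<Longrightarrow> z \<in> J \<Longrightarrow> u \<in> J \<Longrightarrow> aff_val J v p q (guard u z) = v z + v u - q"
  by (simp add: aff_val_def guard_def distrib_right sum.distrib)

text \<open>In a sum over \<open>k\<close>, the variable \<open>Inr (k, True)\<close> selects the summand \<open>k\<close>, and
  \<open>Inr (k, False)\<close> stands for \<open>n\<close> in the selected summand and for 0 in the others.\<close>

type_synonym ('k, 'j) sum_var = "'k \<times> 'j + 'k \<times> bool"

lemma sum_Times_singleton:
  "(\<Sum>z\<in>{k} \<times> J. g z) = (\<Sum>j\<in>J. g (k, j))" "(\<Sum>z\<in>K \<times> {b}. g z) = (\<Sum>k\<in>K. g (k, b))"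
  by (rule sum.reindex_bij_witness[of _ "\<lambda>j. (k, j)" snd], auto)
    (rule sum.reindex_bij_witness[of _ "\<lambda>j. (j, b)" fst], auto)

text \<open>The form becomes homogeneous: its constant and its coefficient of \<open>n\<close> are
  attached to the two extra variables of block \<open>k\<close>. Where all variables of a block
  vanish, every localized factor is therefore \<open>int_binom 0 0 = 1\<close>.\<close>

definition localize :: "'k \<Rightarrow> 'j aff \<Rightarrow> ('k, 'j) sum_var aff" where
  "localize k F = ((\<lambda>x. case x of Inl z \<Rightarrow> if fst z = k then fst F (snd z) else 0
     | Inr z \<Rightarrow> if fst z = k then (if snd z then snd (snd F) else fst (snd F)) else 0), 0, 0)"

lemma aff_val_localize:
  assumes "finite K" "finite J" "k \<in> K"
  shows "aff_val (K \<times> J <+> K \<times> UNIV) w p q (localize k F) =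
    aff_val J (\<lambda>j. w (Inl (k, j))) (w (Inr (k, False))) (w (Inr (k, True))) F"
proof -
  have "(\<Sum>z\<in>K \<times> J. (if fst z = k then fst F (snd z) else 0) * w (Inl z)) = (\<Sum>z\<in>{k} \<times> J. fst F (snd z) * w (Inl z))"
    using assms by (intro sum.mono_neutral_cong_right) auto
  also have "\<dots> = (\<Sum>j\<in>J. fst F j * w (Inl (k, j)))" by (simp add: sum_Times_singleton)
  finally have 1: "(\<Sum>z\<in>K \<times> J. (if fst z = k then fst F (snd z) else 0) * w (Inl z)) = (\<Sum>j\<in>J. fst F j * w (Inl (k, j)))" .
  have "(\<Sum>z\<in>K \<times> UNIV. (if fst z = k then (if snd z then snd (snd F) else fst (snd F)) else 0) * w (Inr z)) =
      (\<Sum>z\<in>{k} \<times> UNIV. (if snd z then snd (snd F) else fst (snd F)) * w (Inr z))"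
    using assms by (intro sum.mono_neutral_cong_right) auto
  also have "\<dots> = snd (snd F) * w (Inr (k, True)) + fst (snd F) * w (Inr (k, False))"
    by (simp add: sum_Times_singleton UNIV_bool)
  finally have 2: "(\<Sum>z\<in>K \<times> UNIV. (if fst z = k then (if snd z then snd (snd F) else fst (snd F)) else 0) * w (Inr z)) =
    snd (snd F) * w (Inr (k, True)) + fst (snd F) * w (Inr (k, False))" .
  show ?thesis unfolding aff_val_def localize_def fst_conv snd_conv
    using assms by (subst sum.Plus) (simp_all add: 1 2)
qed

text \<open>Used as lower entry below the upper entry 0, this expresses that the selectors add up to
  1, or that the block copies of \<open>n\<close> add up to \<open>n\<close>.\<close>

definition selector_total :: "bool \<Rightarrow> ('k, 'j) sum_var aff" where
  "selector_total b = ((\<lambda>x. case x of Inl z \<Rightarrow> 0 | Inr z \<Rightarrow> of_bool (snd z = b)), (if b then 0 else - 1), (if b then - 1 else 0))"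

lemma aff_val_selector_total:
  assumes "finite K" "finite J"
  shows "aff_val (K \<times> J <+> K \<times> UNIV) w p q (selector_total b) =
    (\<Sum>k\<in>K. w (Inr (k, b))) - (if b then q else p)"
proof -
  have "(\<Sum>z\<in>K \<times> UNIV. of_bool (snd z = b) * w (Inr z)) = (\<Sum>z\<in>K \<times> {b}. w (Inr z))"
    using assms by (intro sum.mono_neutral_cong_right) auto
  also have "\<dots> = (\<Sum>k\<in>K. w (Inr (k, b)))" by (simp add: sum_Times_singleton)
  finally have 1: "(\<Sum>z\<in>K \<times> UNIV. of_bool (snd z = b) * w (Inr z)) = (\<Sum>k\<in>K. w (Inr (k, b)))" .
  show ?thesis unfolding aff_val_def selector_total_def fst_conv snd_conv
    using assms by (subst sum.Plus) (auto simp: 1)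
qed

text \<open>The selectors are nonnegative integers with sum 1, so exactly one block is active, and
  the guards set all variables of the other blocks to 0. In the active block the guards only demand
  nonnegative variables, and by \<open>nonneg\<close> this holds wherever the summand is not
  0.\<close>

theorem binom_multisum_sum:
  fixes J :: "'j set" and K :: "'k set" and Fs :: "'k \<Rightarrow> ('j aff \<times> 'j aff) list"
  assumes J: "finite J" and K: "finite K"
    and nonneg: "\<And>k n v j. k \<in> K \<Longrightarrow> v \<in> J \<rightarrow>\<^sub>E UNIV \<Longrightarrow> binom_term J (Fs k) v (int n) 1 \<noteq> 0 \<Longrightarrow> j \<in> J \<Longrightarrow> v j \<ge> 0"
    and s: "\<And>k n. k \<in> K \<Longrightarrow> has_finite_sum (\<lambda>v. binom_term J (Fs k) v (int n) 1) (J \<rightarrow>\<^sub>E UNIV) (s k n)"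
  shows "\<exists>JJ Gs. finite (JJ :: ('k, 'j) sum_var set) \<and>
    (\<forall>n. has_finite_sum (\<lambda>v. binom_term JJ Gs v (int n) 1) (JJ \<rightarrow>\<^sub>E UNIV) (\<Sum>k\<in>K. s k n))"
proof -
  obtain ks where ks: "set ks = K" "distinct ks" using finite_distinct_list[OF K] by blast
  obtain js where js: "set js = J" "distinct js" using finite_distinct_list[OF J] by blast
  define JJ :: "('k, 'j) sum_var set" where "JJ = K \<times> J <+> K \<times> UNIV"
  have fin: "finite JJ" unfolding JJ_def using J K by auto
  define u p where "u = (\<lambda>k::'k. Inr (k, True) :: ('k, 'j) sum_var)" and "p = (\<lambda>k::'k. Inr (k, False) :: ('k, 'j) sum_var)"
  have inJJ: "u k \<in> JJ" "p k \<in> JJ" if "k \<in> K" for k using that unfolding u_def p_def JJ_def by auto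
  have inJJ': "Inl (k, j) \<in> JJ" if "k \<in> K" "j \<in> J" for k j using that unfolding JJ_def by auto
  \<comment> \<open>The last pair makes the selector nonnegative, since \<open>int_binom x x\<close>
    vanishes for \<open>x < 0\<close>.\<close>
  define block where "block = (\<lambda>k. map (map_prod (localize k) (localize k)) (Fs k) @
      map (\<lambda>j. (guard (u k) (Inl (k, j)), var (Inl (k, j)))) js @
      [(guard (u k) (p k), var (p k)), (var (u k), var (u k))])"
  define Gs where "Gs = concat (map block ks) @
      [(((\<lambda>x. 0), 0, 0), selector_total True), (((\<lambda>x. 0), 0, 0), selector_total False)]"
  have block: "binom_term JJ (block k) w n 1 = binom_term J (Fs k) (\<lambda>j. w (Inl (k, j))) (w (p k)) (w (u k)) *
      (\<Prod>j\<in>J. int_binom (w (Inl (k, j)) + w (u k) - 1) (w (Inl (k, j)))) *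
      (int_binom (w (p k) + w (u k) - 1) (w (p k)) * int_binom (w (u k)) (w (u k)))" if k: "k \<in> K" for k w n
  proof -
    have "binom_term JJ (map (map_prod (localize k) (localize k)) (Fs k)) w n 1 =
        binom_term J (Fs k) (\<lambda>j. w (Inl (k, j))) (w (p k)) (w (u k))"
      unfolding binom_term_def JJ_def u_def p_def
      by (simp add: o_def case_prod_unfold aff_val_localize[OF K J k])
    moreover have "binom_term JJ (map (\<lambda>j. (guard (u k) (Inl (k, j)), var (Inl (k, j)))) js) w n 1 =
        (\<Prod>j\<in>J. int_binom (w (Inl (k, j)) + w (u k) - 1) (w (Inl (k, j))))"
    proof -
      have "binom_term JJ (map (\<lambda>j. (guard (u k) (Inl (k, j)), var (Inl (k, j)))) js) w n 1 =
        (\<Prod>j\<in>J. int_binom (aff_val JJ w n 1 (guard (u k) (Inl (k, j)))) (aff_val JJ w n 1 (var (Inl (k, j)))))"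
        unfolding binom_term_def map_map o_def case_prod_conv js(1)[symmetric]
        using js(2) by (simp add: prod.distinct_set_conv_list)
      also have "\<dots> = (\<Prod>j\<in>J. int_binom (w (Inl (k, j)) + w (u k) - 1) (w (Inl (k, j))))"
        using fin inJJ inJJ' k by (intro prod.cong refl) (simp add: aff_val_var aff_val_guard)
      finally show ?thesis .
    qed
    moreover have "binom_term JJ [(guard (u k) (p k), var (p k)), (var (u k), var (u k))] w n 1 =
        int_binom (w (p k) + w (u k) - 1) (w (p k)) * int_binom (w (u k)) (w (u k))"
      using fin inJJ k by (simp add: binom_term_def aff_val_var aff_val_guard)
    ultimately show ?thesis unfolding block_def binom_term_append by (simp add: mult.assoc)
  qed
  have trm: "binom_term JJ Gs w n 1 = (\<Prod>k\<in>K. binom_term JJ (block k) w n 1) *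
      (of_bool ((\<Sum>k\<in>K. w (u k)) = 1) * of_bool ((\<Sum>k\<in>K. w (p k)) = n))" for w n
  proof -
    have "binom_term JJ (concat (map block ks)) w n 1 = (\<Prod>k\<in>K. binom_term JJ (block k) w n 1)"
      unfolding binom_term_concat map_map o_def ks(1)[symmetric]
      using ks(2) by (simp add: prod.distinct_set_conv_list)
    moreover have "binom_term JJ [(((\<lambda>x. 0), 0, 0), selector_total True), (((\<lambda>x. 0), 0, 0), selector_total False)] w n 1 =
        of_bool ((\<Sum>k\<in>K. w (u k)) = 1) * of_bool ((\<Sum>k\<in>K. w (p k)) = n)"
    proof -
      have "aff_val JJ w n 1 ((\<lambda>x. 0), 0, 0) = 0" by (simp add: aff_val_def)
      then show ?thesis unfolding binom_term_def u_def p_def JJ_def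
        by (simp add: aff_val_selector_total[OF K J] int_binom_0)
    qed
    ultimately show ?thesis unfolding Gs_def binom_term_append by simp
  qed
  define h where "h = (\<lambda>n (k, v). restrict (\<lambda>x. case x of Inl z \<Rightarrow> if fst z = k then v (snd z) else 0
      | Inr z \<Rightarrow> if fst z = k then (if snd z then 1 else int n) else 0) JJ)"
  have hv: "h n (k, v) (Inl (k', j)) = (if k' = k then v j else 0)" if "k' \<in> K" "j \<in> J" for n k v k' j
    using inJJ' that unfolding h_def by simp
  have hu: "h n (k, v) (u k') = of_bool (k' = k)" "h n (k, v) (p k') = (if k' = k then int n else 0)" if "k' \<in> K" for n k v k'
    using inJJ that unfolding h_def u_def p_def by auto
  have "has_finite_sum (\<lambda>v. binom_term JJ Gs v (int n) 1) (JJ \<rightarrow>\<^sub>E UNIV) (\<Sum>k\<in>K. s k n)" for n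
  proof (rule has_finite_sum_inj[where h = "h n" and Y = "K \<times> (J \<rightarrow>\<^sub>E UNIV)"])
    show "has_finite_sum (\<lambda>(k, v). binom_term J (Fs k) v (int n) 1) (K \<times> (J \<rightarrow>\<^sub>E UNIV)) (\<Sum>k\<in>K. s k n)"
      using K s by (rule has_finite_sum_Sigma)
    show "inj_on (h n) (K \<times> (J \<rightarrow>\<^sub>E UNIV))"
    proof (rule inj_onI, clarify)
      fix k v k' v' assume k: "k \<in> K" "k' \<in> K" and v: "v \<in> J \<rightarrow>\<^sub>E UNIV" "v' \<in> J \<rightarrow>\<^sub>E UNIV" and eq: "h n (k, v) = h n (k', v')"
      have "k = k'" using hu(1)[OF k(1), of n k v] hu(1)[OF k(1), of n k' v'] eq by (auto split: if_splits)
      moreover have "v j = v' j" for j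
      proof (cases "j \<in> J")
        case True
        then show ?thesis using hv[OF k(1) True, of n k v] hv[OF k(1) True, of n k' v'] eq \<open>k = k'\<close> by simp
      next
        case False
        then show ?thesis using v by (auto simp: PiE_def extensional_def)
      qed
      ultimately show "k = k' \<and> v = v'" by blast
    qed
    show "h n y \<in> JJ \<rightarrow>\<^sub>E UNIV \<and> binom_term JJ Gs (h n y) (int n) 1 = (case y of (k, v) \<Rightarrow> binom_term J (Fs k) v (int n) 1)"
      if y: "y \<in> K \<times> (J \<rightarrow>\<^sub>E UNIV)" for y
    proof -
      obtain k v where kv: "y = (k, v)" "k \<in> K" "v \<in> J \<rightarrow>\<^sub>E UNIV" using y by blast
      let ?w = "h n (k, v)"
      have "binom_term JJ (block k') ?w (int n) 1 = 1" if k': "k' \<in> K - {k}" for k'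
      proof -
        have "binom_term J (Fs k') (\<lambda>j. ?w (Inl (k', j))) 0 0 = 1"
          using hv k' by (intro binom_term_zero_vector) auto
        moreover have "(\<Prod>j\<in>J. int_binom (?w (Inl (k', j)) + 0 - 1) (?w (Inl (k', j)))) = 1"
          using hv k' by (intro prod.neutral) (auto simp: int_binom_def)
        ultimately show ?thesis using k' by (simp add: block hu int_binom_def)
      qed
      then have "(\<Prod>k'\<in>K. binom_term JJ (block k') ?w (int n) 1) = binom_term JJ (block k) ?w (int n) 1"
        using K kv(2) by (subst prod.remove[of _ k]) auto
      moreover have "binom_term JJ (block k) ?w (int n) 1 = binom_term J (Fs k) v (int n) 1"
      proof -
        have 1: "binom_term J (Fs k) (\<lambda>j. ?w (Inl (k, j))) (int n) 1 = binom_term J (Fs k) v (int n) 1"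
          using hv kv(2) by (intro binom_term_cong) auto
        have 2: "(\<Prod>j\<in>J. int_binom (?w (Inl (k, j)) + 1 - 1) (?w (Inl (k, j)))) = 1" if "binom_term J (Fs k) v (int n) 1 \<noteq> 0"
          using hv kv(2) nonneg[OF kv(2,3) that] by (intro prod.neutral) (auto simp: int_binom_diag)
        show ?thesis using kv(2) 1 2
          by (cases "binom_term J (Fs k) v (int n) 1 = 0") (simp_all add: block hu int_binom_diag)
      qed
      moreover have "(\<Sum>k'\<in>K. ?w (u k')) = 1" "(\<Sum>k'\<in>K. ?w (p k')) = int n"
        using hu K kv(2) by (simp_all add: of_bool_def)
      ultimately have "binom_term JJ Gs ?w (int n) 1 = binom_term J (Fs k) v (int n) 1" unfolding trm by simp
      moreover have "?w \<in> JJ \<rightarrow>\<^sub>E UNIV" unfolding h_def by auto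
      ultimately show ?thesis using kv(1) by simp
    qed
    show "w \<in> h n ` (K \<times> (J \<rightarrow>\<^sub>E UNIV))" if w: "w \<in> JJ \<rightarrow>\<^sub>E UNIV" "binom_term JJ Gs w (int n) 1 \<noteq> 0" for w
    proof -
      have nz: "binom_term JJ (block k) w (int n) 1 \<noteq> 0" if "k \<in> K" for k
        using w(2) that K unfolding trm by auto
      have tot: "(\<Sum>k\<in>K. w (u k)) = 1" "(\<Sum>k\<in>K. w (p k)) = int n" using w(2) unfolding trm by (auto split: if_splits)
      have u0: "w (u k) \<ge> 0" if "k \<in> K" for k
        using nz[OF that] unfolding block[OF that] by (simp add: int_binom_diag)
      obtain k where k: "k \<in> K" "w (u k) \<noteq> 0" using tot(1) by (metis sum.neutral zero_neq_one)
      have "(\<Sum>k\<in>K. w (u k)) = w (u k) + (\<Sum>k'\<in>K - {k}. w (u k'))" using K k by (intro sum.remove) auto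
      moreover have "(\<Sum>k'\<in>K - {k}. w (u k')) \<ge> 0" using u0 by (intro sum_nonneg) auto
      ultimately have uk: "w (u k) = 1" "(\<Sum>k'\<in>K - {k}. w (u k')) = 0" using tot(1) u0[OF k(1)] k(2) by linarith+
      then have u1: "w (u k') = 0" if "k' \<in> K - {k}" for k'
        using that K u0 sum_nonneg_eq_0_iff[of "K - {k}" "\<lambda>k'. w (u k')"] by auto
      have v1: "w (Inl (k', j)) = 0" if k': "k' \<in> K - {k}" "j \<in> J" for k' j
      proof -
        have "(\<Prod>j\<in>J. int_binom (w (Inl (k', j)) + w (u k') - 1) (w (Inl (k', j)))) \<noteq> 0"
          using nz[of k'] k' by (auto simp: block)
        then have "int_binom (w (Inl (k', j)) - 1) (w (Inl (k', j))) \<noteq> 0" using J k' u1[OF k'(1)] by auto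
        then show ?thesis by (simp add: int_binom_pred)
      qed
      have p1: "w (p k') = 0" if k': "k' \<in> K - {k}" for k'
        using nz[of k'] k' u1[OF k'] by (auto simp: block int_binom_pred)
      have "(\<Sum>k\<in>K. w (p k)) = w (p k) + (\<Sum>k'\<in>K - {k}. w (p k'))" using K k by (intro sum.remove) auto
      then have pk: "w (p k) = int n" using tot(2) p1 by simp
      let ?v = "restrict (\<lambda>j. w (Inl (k, j))) J"
      have "w = h n (k, ?v)"
      proof
        fix x
        show "w x = h n (k, ?v) x"
        proof (cases "x \<in> JJ")
          case True
          then consider k' j where "x = Inl (k', j)" "k' \<in> K" "j \<in> J" | k' where "x = u k'" "k' \<in> K" | k' where "x = p k'" "k' \<in> K"
            unfolding JJ_def u_def p_def by (auto split: bool.splits)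
          then show ?thesis
            using hv hu v1 p1 u1 uk pk k(1) by cases (auto simp: Diff_iff)
        next
          case False
          then show ?thesis using w(1) unfolding h_def by (auto simp: PiE_def extensional_def)
        qed
      qed
      then show ?thesis using k(1) by (intro image_eqI[of _ _ "(k, ?v)"]) auto
    qed
  qed
  then show ?thesis using fin by blast
qed

section \<open>Tile counting functions are binomial multisums\<close>

lemma sum_list_count:
  fixes w :: "'e \<Rightarrow> real"
  assumes "finite E" "set es \<subseteq> E"
  shows "sum_list (map w es) = (\<Sum>e\<in>E. real (count_list es e) * w e)"
  using assms(2)
proof (induction es)
  case (Cons a es)
  have "(\<Sum>e\<in>E. real (count_list (a # es) e) * w e) =
      (\<Sum>e\<in>E. real (count_list es e) * w e + (if e = a then w e else 0))"
    by (intro sum.cong) (auto simp: algebra_simps)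
  then show ?case using Cons assms(1) by (simp add: sum.distrib)
qed simp

lemma walk_map: "walk src tgt u (map g es) v \<longleftrightarrow> walk (src \<circ> g) (tgt \<circ> g) u es v"
  by (induction es arbitrary: u) auto

definition zero_aff :: "'j aff" where
  "zero_aff = ((\<lambda>_. 0), 0, 0)"

lemma aff_val_zero [simp]: "aff_val J v p q zero_aff = 0"
  by (simp add: aff_val_def zero_aff_def)

lemma binom_term_equations:
  "binom_term J (map (\<lambda>G. (zero_aff, G)) Gs) v p q = of_bool (\<forall>G\<in>set Gs. aff_val J v p q G = 0)"
  unfolding binom_term_def by (induction Gs) (auto simp: int_binom_0)

text \<open>The binomials of \<open>exit_orders_binom\<close>, with one copy of each last exit taken
  out of the multiplicities.\<close>

definition exit_factors :: "nat \<Rightarrow> (nat \<Rightarrow> 'v) \<Rightarrow> nat set \<Rightarrow> (nat aff \<times> nat aff) list" where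
  "exit_factors m src A = map (\<lambda>i.
     (((\<lambda>j. of_bool (j \<le> i \<and> src j = src i)), 0, - (\<Sum>j | j \<in> {1..i} \<and> src j = src i. of_bool (j \<in> A))),
      ((\<lambda>j. of_bool (j = i)), 0, - of_bool (i \<in> A)))) [1..<Suc m]"

lemma binom_term_exit_factors:
  fixes v :: "nat \<Rightarrow> int" and A :: "nat set"
  defines "x \<equiv> \<lambda>i. v i - of_bool (i \<in> A)"
  shows "real (binom_term {1..m} (exit_factors m src A) v p 1) =
    (if \<forall>i\<in>{1..m}. x i \<ge> 0 then exit_orders {1..m} src (\<lambda>i. nat (x i)) else 0)"
proof -
  have val: "aff_val {1..m} v p 1 ((\<lambda>j. of_bool (j \<le> i \<and> src j = src i)), 0,
      - (\<Sum>j | j \<in> {1..i} \<and> src j = src i. of_bool (j \<in> A))) = (\<Sum>j | j \<in> {1..i} \<and> src j = src i. x j)"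
    "aff_val {1..m} v p 1 ((\<lambda>j. of_bool (j = i)), 0, - of_bool (i \<in> A)) = x i" if "i \<in> {1..m}" for i
  proof -
    have "(\<Sum>j=1..m. of_bool (j \<le> i \<and> src j = src i) * v j) = (\<Sum>j | j \<in> {1..i} \<and> src j = src i. v j)"
      using that by (intro sum.mono_neutral_cong_right) auto
    then show "aff_val {1..m} v p 1 ((\<lambda>j. of_bool (j \<le> i \<and> src j = src i)), 0,
      - (\<Sum>j | j \<in> {1..i} \<and> src j = src i. of_bool (j \<in> A))) = (\<Sum>j | j \<in> {1..i} \<and> src j = src i. x j)"
      unfolding aff_val_def x_def sum_subtractf by simp
    show "aff_val {1..m} v p 1 ((\<lambda>j. of_bool (j = i)), 0, - of_bool (i \<in> A)) = x i"
      unfolding aff_val_def x_def using that by simp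
  qed
  have "binom_term {1..m} (exit_factors m src A) v p 1 =
      (\<Prod>i\<leftarrow>[1..<Suc m]. int_binom (\<Sum>j | j \<in> {1..i} \<and> src j = src i. x j) (x i))"
    unfolding binom_term_def exit_factors_def map_map o_def case_prod_conv
    by (intro arg_cong[where f = prod_list] map_cong refl) (simp only: set_upt val atLeastLessThanSuc_atLeastAtMost)
  also have "\<dots> = (\<Prod>i=1..m. int_binom (\<Sum>j | j \<in> {1..i} \<and> src j = src i. x j) (x i))"
    by (simp add: prod.distinct_set_conv_list[symmetric] atLeastLessThanSuc_atLeastAtMost del: upt_Suc)
  finally have trm: "binom_term {1..m} (exit_factors m src A) v p 1 =
    (\<Prod>i=1..m. int_binom (\<Sum>j | j \<in> {1..i} \<and> src j = src i. x j) (x i))" .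
  show ?thesis
  proof (cases "\<forall>i\<in>{1..m}. x i \<ge> 0")
    case True
    have "exit_orders {1..m} src (\<lambda>i. nat (x i)) =
        real (\<Prod>i=1..m. int_binom (\<Sum>j | j \<in> {1..i} \<and> src j = src i. int (nat (x j))) (int (nat (x i))))"
      by (rule exit_orders_binom)
    also have "(\<Prod>i=1..m. int_binom (\<Sum>j | j \<in> {1..i} \<and> src j = src i. int (nat (x j))) (int (nat (x i)))) =
        (\<Prod>i=1..m. int_binom (\<Sum>j | j \<in> {1..i} \<and> src j = src i. x j) (x i))"
      using True by (intro prod.cong refl arg_cong2[where f = int_binom] sum.cong) auto
    finally show ?thesis using True trm by simp
  next
    case False
    then obtain i where "i \<in> {1..m}" "x i < 0" by fastforce
    then have "\<exists>i\<in>{1..m}. int_binom (\<Sum>j | j \<in> {1..i} \<and> src j = src i. x j) (x i) = 0"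
      by (intro bexI[of _ i]) (auto simp: int_binom_def)
    then have "binom_term {1..m} (exit_factors m src A) v p 1 = 0" unfolding trm by simp
    then show ?thesis using False by auto
  qed
qed

definition balance_equations :: "nat \<Rightarrow> (nat \<Rightarrow> 'v) \<Rightarrow> (nat \<Rightarrow> 'v) \<Rightarrow> 'v list \<Rightarrow> nat aff list" where
  "balance_equations m src tgt vs = map (\<lambda>u. ((\<lambda>j. of_bool (src j = u) - of_bool (tgt j = u)), 0, 0)) vs"

lemma out_deg_int: "finite E \<Longrightarrow> int (out_deg E f c u) = (\<Sum>j\<in>E. of_bool (f j = u) * int (c j))"
  unfolding out_deg_def of_nat_sum by (intro sum.mono_neutral_cong_left) auto

lemma aff_val_balance:
  fixes v :: "nat \<Rightarrow> int" and src tgt :: "nat \<Rightarrow> 'b"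
  assumes "\<And>j. j \<in> {1..m} \<Longrightarrow> v j \<ge> 0"
  shows "aff_val {1..m} v p q ((\<lambda>j. of_bool (src j = u) - of_bool (tgt j = u)), 0, 0) = 0 \<longleftrightarrow>
    out_deg {1..m} src (\<lambda>j. nat (v j)) u = out_deg {1..m} tgt (\<lambda>j. nat (v j)) u"
proof -
  have "aff_val {1..m} v p q ((\<lambda>j. of_bool (src j = u) - of_bool (tgt j = u)), 0, 0) =
      (\<Sum>j=1..m. of_bool (src j = u) * v j) - (\<Sum>j=1..m. of_bool (tgt j = u) * v j)"
    unfolding aff_val_def by (simp add: left_diff_distrib sum_subtractf)
  moreover have "(\<Sum>j=1..m. of_bool (f j = u) * v j) = int (out_deg {1..m} f (\<lambda>j. nat (v j)) u)" for f :: "nat \<Rightarrow> 'b"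
    using assms by (subst out_deg_int) (auto intro!: sum.cong)
  ultimately show ?thesis by simp
qed

text \<open>The integer variables are the edge multiplicities, that is, the numbers of copies of
  each prototile. Each possible set \<open>A\<close> of last exits contributes one multisum, and
  \<open>binom_multisum_sum\<close> adds them up.\<close>

theorem tile_counting_imp_multisum:
  assumes "f \<in> tile_counting_functions"
  shows "\<exists>(J :: (nat set, nat) sum_var set) Gs. finite J \<and>
    (\<forall>n. has_finite_sum (\<lambda>v. binom_term J Gs v (int n) 1) (J \<rightarrow>\<^sub>E UNIV) (f n))"
proof -
  obtain T \<epsilon> where T: "finite T" "\<And>t. t \<in> T \<Longrightarrow> tile t \<and> tall t" "\<epsilon> \<ge> 0" "f = tile_count T \<epsilon>"
    using assms unfolding tile_counting_functions_def by blast
  obtain T0 where T0: "finite T0" and words: "\<And>a. a \<ge> 0 \<Longrightarrow> finite (closed_words T0 a) \<and> card (tilings T a) = card (closed_words T0 a)"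
    using tall_tiles_normalized[OF T(1,2)] by metis
  define m where "m = card T0"
  obtain g where g: "bij_betw g {1..m} T0" using ex_bij_betw_nat_finite_1[OF T0] unfolding m_def by blast
  define E where "E = {1..m}"
  have E: "finite E" unfolding E_def by simp
  define src tgt w r where "src = tail_of \<circ> g" and "tgt = head_of \<circ> g" and "w = advance \<circ> g" and "r = left_strip 0"
  define W where "W = (\<lambda>n. {es \<in> lists E. walk src tgt r es r \<and> sum_list (map w es) = real n + \<epsilon>})"
  have bij: "bij_betw (map g) (W n) (closed_words T0 (real n + \<epsilon>))" for n
  proof -
    have "closed_words T0 (real n + \<epsilon>) = map g ` W n"
    proof (intro set_eqI iffI)
      fix ts assume ts: "ts \<in> closed_words T0 (real n + \<epsilon>)"
      let ?es = "map (inv_into E g) ts"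
      have inE: "set ts \<subseteq> g ` E" using ts g unfolding closed_words_def E_def bij_betw_def by auto
      then have "map g ?es = ts" by (auto simp: f_inv_into_f subset_iff intro!: map_idI)
      moreover have "?es \<in> lists E" using inE inv_into_into[of _ g E] by (auto simp: subset_iff)
      moreover have "sum_list (map w ?es) = sum_list (map advance (map g ?es))" unfolding w_def by (simp add: comp_assoc)
      ultimately have "?es \<in> W n" using ts walk_map[of tail_of head_of r g ?es r]
        unfolding W_def closed_words_def src_def tgt_def r_def by simp
      then show "ts \<in> map g ` W n" using \<open>map g ?es = ts\<close> by (metis imageI)
    next
      fix ts assume "ts \<in> map g ` W n"
      then obtain es where es: "ts = map g es" "es \<in> W n" by blast
      then show "ts \<in> closed_words T0 (real n + \<epsilon>)"
        using g walk_map[of tail_of head_of r g es r]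
        unfolding W_def closed_words_def src_def tgt_def r_def w_def bij_betw_def E_def by auto
    qed
    moreover have "inj_on (map g) (W n)"
    proof (rule inj_on_subset)
      have "inj_on g E" using g unfolding bij_betw_def E_def by blast
      moreover have "\<Union>(set ` lists E) \<subseteq> E" by auto
      ultimately show "inj_on (map g) (lists E)" by (intro inj_on_mapI) (rule inj_on_subset)
      show "W n \<subseteq> lists E" unfolding W_def by blast
    qed
    ultimately show ?thesis unfolding bij_betw_def by simp
  qed
  have fW: "finite (W n)" "f n = card (W n)" for n
    using words[of "real n + \<epsilon>"] T(3) bij[of n] bij_betw_finite bij_betw_same_card
    unfolding T(4) tile_count_def by fastforce+
  define K where "K = {A. A \<subseteq> E \<and> in_tree src tgt r A}"
  have K: "finite K" using E unfolding K_def by simp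
  obtain vs where vs: "set vs = src ` E \<union> tgt ` E" using finite_list[of "src ` E \<union> tgt ` E"] E by blast
  \<comment> \<open>The two extra indices have weights -1 and \<open>- \<epsilon>\<close> and
    coefficients \<open>n\<close> and 1, so that the length condition becomes a homogeneous integer
    relation.\<close>
  let ?I = "E <+> (UNIV :: bool set)"
  have fI: "finite ?I" using E by simp
  obtain M :: "(nat + bool \<Rightarrow> int) list" where M: "\<forall>c. (\<Sum>i\<in>?I. real_of_int (c i) * (case i of Inl j \<Rightarrow> w j | Inr b \<Rightarrow> if b then - 1 else - \<epsilon>)) = 0 \<longleftrightarrow>
     (\<forall>m\<in>set M. (\<Sum>i\<in>?I. m i * c i) = 0)"
    using integer_relations[OF fI, of "case_sum w (\<lambda>b. if b then - 1 else - \<epsilon>)"] by (rule exE)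
  define length_eqs where "length_eqs = map (\<lambda>m. ((\<lambda>j. m (Inl j)), m (Inr True), m (Inr False)) :: nat aff) M"
  have length_eqs: "(\<forall>G\<in>set length_eqs. aff_val E v (int n) 1 G = 0) \<longleftrightarrow> (\<Sum>j\<in>E. real_of_int (v j) * w j) = real n + \<epsilon>" for v n
  proof -
    let ?c = "case_sum v (\<lambda>b. if b then int n else 1)"
    have "(\<Sum>i\<in>?I. m i * ?c i) = aff_val E v (int n) 1 ((\<lambda>j. m (Inl j)), m (Inr True), m (Inr False))" for m
      using E by (simp add: sum.Plus UNIV_bool aff_val_def)
    moreover have "(\<Sum>i\<in>?I. real_of_int (?c i) * (case i of Inl j \<Rightarrow> w j | Inr b \<Rightarrow> if b then - 1 else - \<epsilon>)) =
        (\<Sum>j\<in>E. real_of_int (v j) * w j) - real n - \<epsilon>"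
      using E by (simp add: sum.Plus UNIV_bool)
    ultimately show ?thesis using M[rule_format, of ?c] unfolding length_eqs_def by auto
  qed
  \<comment> \<open>The equations express balance at the vertices, absence of edges whose source
    lies outside the tree, and the total length; together they describe \<open>eulerian\<close> and
    the length condition.\<close>
  define Fs where "Fs = (\<lambda>A. exit_factors m src A @ map (\<lambda>G. (zero_aff, G))
      (balance_equations m src tgt vs @ map var (filter (\<lambda>i. src i \<noteq> r \<and> src i \<notin> src ` A) [1..<Suc m]) @ length_eqs))"
  have key: "real (binom_term E (Fs A) v (int n) 1) =
      (if (\<forall>i\<in>E. v i \<ge> 0) \<and> (\<Sum>j\<in>E. real_of_int (v j) * w j) = real n + \<epsilon>
       then real (card (walks_with E src tgt r r (\<lambda>i. nat (v i)) A)) else 0)" if A: "A \<in> K" for A v n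
  proof (cases "\<forall>i\<in>E. v i - of_bool (i \<in> A) \<ge> 0")
    case False
    \<comment> \<open>For nonnegative \<open>v\<close> the failure means that some edge of
      \<open>A\<close> has multiplicity 0, which \<open>eulerian\<close> excludes. The binomial
      factors vanish as well, so both sides are 0.\<close>
    have "\<not> eulerian E src tgt r r (\<lambda>i. nat (v i)) A" if "\<forall>i\<in>E. v i \<ge> 0"
    proof
      assume eul: "eulerian E src tgt r r (\<lambda>i. nat (v i)) A"
      have "v i - of_bool (i \<in> A) \<ge> 0" if "i \<in> E" for i
        using eul \<open>\<forall>i\<in>E. v i \<ge> 0\<close> that unfolding eulerian_def by (cases "i \<in> A") auto
      then show False using False by blast
    qed
    moreover have "binom_term E (exit_factors m src A) v (int n) 1 = 0"
      using binom_term_exit_factors[of m src A v "int n"] False unfolding E_def by (auto split: if_splits)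
    ultimately show ?thesis unfolding Fs_def binom_term_append card_walks_with[OF E] by simp
  next
    case True
    have v0: "v i \<ge> 0" if "i \<in> E" for i using True that by (cases "i \<in> A") auto
    have 1: "real (binom_term E (exit_factors m src A) v (int n) 1) = exit_orders E src (\<lambda>i. nat (v i) - of_bool (i \<in> A))"
    proof -
      have "nat (v i - of_bool (i \<in> A)) = nat (v i) - of_bool (i \<in> A)" for i by (cases "i \<in> A") auto
      then show ?thesis using binom_term_exit_factors[of m src A v "int n"] True unfolding E_def by simp
    qed
    have bal: "(\<forall>G\<in>set (balance_equations m src tgt vs). aff_val E v (int n) 1 G = 0) \<longleftrightarrow>
        (\<forall>u. out_deg E src (\<lambda>i. nat (v i)) u + of_bool (u = r) = out_deg E tgt (\<lambda>i. nat (v i)) u + of_bool (u = r))"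
    proof -
      have "(\<forall>G\<in>set (balance_equations m src tgt vs). aff_val E v (int n) 1 G = 0) \<longleftrightarrow>
          (\<forall>u\<in>src ` E \<union> tgt ` E. out_deg E src (\<lambda>i. nat (v i)) u = out_deg E tgt (\<lambda>i. nat (v i)) u)"
        unfolding balance_equations_def set_map vs using aff_val_balance[of m v "int n" 1 src _ tgt] v0
        unfolding E_def by simp
      moreover have "out_deg E src c u = 0" "out_deg E tgt c u = 0" if "u \<notin> src ` E \<union> tgt ` E" for c u
      proof -
        have "{e \<in> E. src e = u} = {}" "{e \<in> E. tgt e = u} = {}" using that by blast+
        then show "out_deg E src c u = 0" "out_deg E tgt c u = 0" unfolding out_deg_def by (simp_all only: sum.empty)
      qed
      ultimately show ?thesis by (metis add_right_cancel)
    qed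
    have supp: "(\<forall>G\<in>set (map var (filter (\<lambda>i. src i \<noteq> r \<and> src i \<notin> src ` A) [1..<Suc m])). aff_val E v (int n) 1 G = 0) \<longleftrightarrow>
        (\<forall>e\<in>E. nat (v e) > 0 \<longrightarrow> src e = r \<or> src e \<in> src ` A)"
    proof -
      have "set (filter (\<lambda>i. src i \<noteq> r \<and> src i \<notin> src ` A) [1..<Suc m]) = {i \<in> E. src i \<noteq> r \<and> src i \<notin> src ` A}"
        unfolding E_def by auto
      then have "(\<forall>G\<in>set (map var (filter (\<lambda>i. src i \<noteq> r \<and> src i \<notin> src ` A) [1..<Suc m])). aff_val E v (int n) 1 G = 0) \<longleftrightarrow>
          (\<forall>i\<in>{i \<in> E. src i \<noteq> r \<and> src i \<notin> src ` A}. v i = 0)"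
        using E by (simp add: aff_val_var del: upt_Suc)
      also have "\<dots> \<longleftrightarrow> (\<forall>e\<in>E. nat (v e) > 0 \<longrightarrow> src e = r \<or> src e \<in> src ` A)"
      proof -
        have "v e = 0 \<longleftrightarrow> \<not> nat (v e) > 0" if "e \<in> E" for e using v0[OF that] by auto
        then show ?thesis by blast
      qed
      finally show ?thesis .
    qed
    have pos: "\<forall>e\<in>A. nat (v e) > 0" using True A unfolding K_def by fastforce
    have "binom_term E (Fs A) v (int n) 1 = binom_term E (exit_factors m src A) v (int n) 1 *
        of_bool (eulerian E src tgt r r (\<lambda>i. nat (v i)) A \<and> (\<Sum>j\<in>E. real_of_int (v j) * w j) = real n + \<epsilon>)"
    proof -
      have "(\<forall>G\<in>set (balance_equations m src tgt vs @ map var (filter (\<lambda>i. src i \<noteq> r \<and> src i \<notin> src ` A) [1..<Suc m]) @ length_eqs). aff_val E v (int n) 1 G = 0) \<longleftrightarrow>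
          eulerian E src tgt r r (\<lambda>i. nat (v i)) A \<and> (\<Sum>j\<in>E. real_of_int (v j) * w j) = real n + \<epsilon>"
        unfolding set_append ball_Un bal supp length_eqs eulerian_def using pos A unfolding K_def by blast
      then show ?thesis unfolding Fs_def binom_term_append[of E "exit_factors m src A"] binom_term_equations by (simp only:)
    qed
    then show ?thesis using 1 v0 card_walks_with[OF E, of src tgt r r "\<lambda>i. nat (v i)" A] by auto
  qed
  have fib: "has_finite_sum (\<lambda>v. binom_term E (Fs A) v (int n) 1) (E \<rightarrow>\<^sub>E UNIV) (card {es \<in> W n. last_exits src r es = A})"
    if A: "A \<in> K" for A n
  proof -
    let ?g = "\<lambda>v. binom_term E (Fs A) v (int n) 1"
    let ?S = "{v \<in> E \<rightarrow>\<^sub>E UNIV. ?g v \<noteq> 0}"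
    let ?Y = "\<lambda>v::nat \<Rightarrow> int. walks_with E src tgt r r (\<lambda>i. nat (v i)) A"
    let ?h = "\<lambda>es. restrict (\<lambda>i. int (count_list es i)) E"
    have g: "?g v = card (?Y v)" "\<forall>i\<in>E. v i \<ge> 0" "(\<Sum>j\<in>E. real_of_int (v j) * w j) = real n + \<epsilon>" if "?g v \<noteq> 0" for v
      using key[OF A, of v n] that by (auto split: if_splits)
    have wl: "sum_list (map w es) = (\<Sum>j\<in>E. real_of_int (?h es j) * w j)" if "es \<in> lists E" for es
      using sum_list_count[OF E, of es w] that by (auto intro!: sum.cong)
    have mem: "es \<in> ?Y v \<longleftrightarrow> es \<in> W n \<and> last_exits src r es = A \<and> v = ?h es" if v: "v \<in> ?S" for v es
    proof
      assume es: "es \<in> ?Y v"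
      have "v = ?h es"
      proof
        fix i show "v i = ?h es i"
          using v es g(2)[of v] unfolding walks_with_def by (cases "i \<in> E") (auto simp: PiE_def extensional_def)
      qed
      moreover have "es \<in> lists E" "walk src tgt r es r" "last_exits src r es = A" using es unfolding walks_with_def by auto
      moreover have "sum_list (map w es) = real n + \<epsilon>"
        using wl[OF \<open>es \<in> lists E\<close>] g(3)[of v] v \<open>v = ?h es\<close> by simp
      ultimately show "es \<in> W n \<and> last_exits src r es = A \<and> v = ?h es" unfolding W_def by blast
    next
      assume es: "es \<in> W n \<and> last_exits src r es = A \<and> v = ?h es"
      then show "es \<in> ?Y v" unfolding W_def walks_with_def by auto
    qed
    have cover: "?h es \<in> ?S" if es: "es \<in> W n" "last_exits src r es = A" for es
    proof -
      have "es \<in> ?Y (?h es)" using es unfolding W_def walks_with_def by auto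
      then have "card (?Y (?h es)) \<noteq> 0" using walks_with_finite[OF E] by (metis card_0_eq empty_iff)
      moreover have "(\<Sum>j\<in>E. real_of_int (?h es j) * w j) = real n + \<epsilon>"
        using wl[of es] es unfolding W_def by simp
      ultimately have "?g (?h es) \<noteq> 0" using key[OF A, of "?h es" n] by auto
      then show ?thesis by auto
    qed
    \<comment> \<open>The support is finite because each vector in it is the count vector of one of
      the finitely many walks in \<open>W n\<close>.\<close>
    have "?S \<subseteq> ?h ` W n"
    proof
      fix v assume v: "v \<in> ?S"
      then have "?Y v \<noteq> {}" using g(1)[of v] by auto
      then show "v \<in> ?h ` W n" using mem[OF v] by blast
    qed
    then have finS: "finite ?S" using fW(1) finite_surj by blast
    have "{es \<in> W n. last_exits src r es = A} = (\<Union>v\<in>?S. ?Y v)"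
    proof (intro set_eqI iffI)
      fix es assume "es \<in> {es \<in> W n. last_exits src r es = A}"
      then have "?h es \<in> ?S" "es \<in> ?Y (?h es)" using cover[of es] mem[of "?h es" es] by simp_all
      then show "es \<in> (\<Union>v\<in>?S. ?Y v)" using UN_I[of "?h es" ?S es ?Y] by simp
    next
      fix es assume "es \<in> (\<Union>v\<in>?S. ?Y v)"
      then obtain v where "v \<in> ?S" "es \<in> ?Y v" by (rule UN_E)
      then show "es \<in> {es \<in> W n. last_exits src r es = A}" using mem[of v es] by simp
    qed
    moreover have "card (\<Union>v\<in>?S. ?Y v) = (\<Sum>v\<in>?S. card (?Y v))"
    proof (intro card_UN_disjoint finS ballI walks_with_finite[OF E] impI)
      fix u v assume uv: "u \<in> ?S" "v \<in> ?S" "u \<noteq> v"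
      have "u = v" if "es \<in> ?Y u" "es \<in> ?Y v" for es
        using mem[OF uv(1), of es] mem[OF uv(2), of es] that by simp
      then show "?Y u \<inter> ?Y v = {}" using uv(3) by blast
    qed
    moreover have "\<dots> = (\<Sum>v\<in>?S. ?g v)" using g(1) by (intro sum.cong) auto
    ultimately show ?thesis using finS unfolding has_finite_sum_def by simp
  qed
  have total: "(\<Sum>A\<in>K. card {es \<in> W n. last_exits src r es = A}) = f n" for n
  proof -
    have "last_exits src r es \<in> K" if "es \<in> W n" for es
    proof -
      let ?Y = "walks_with E src tgt r r (count_list es) (last_exits src r es)"
      have "es \<in> ?Y" using that unfolding W_def walks_with_def by auto
      then have "card ?Y \<noteq> 0" using walks_with_finite[OF E] by (metis card_0_eq empty_iff)
      then have "eulerian E src tgt r r (count_list es) (last_exits src r es)"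
        using card_walks_with[OF E, of src tgt r r "count_list es" "last_exits src r es"] by (auto split: if_splits)
      then show ?thesis unfolding eulerian_def K_def by blast
    qed
    then have "W n = (\<Union>A\<in>K. {es \<in> W n. last_exits src r es = A})" by blast
    then have "card (W n) = card (\<Union>A\<in>K. {es \<in> W n. last_exits src r es = A})" by simp
    also have "\<dots> = (\<Sum>A\<in>K. card {es \<in> W n. last_exits src r es = A})"
      using K fW(1) by (intro card_UN_disjoint) auto
    finally show ?thesis using fW(2) by simp
  qed
  have nonneg: "v j \<ge> 0" if "A \<in> K" "binom_term E (Fs A) v (int n) 1 \<noteq> 0" "j \<in> E" for A n v j
    using key[OF that(1), of v n] that(2,3) by (auto split: if_splits)
  have "\<exists>(J :: (nat set, nat) sum_var set) Gs. finite J \<and>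
    (\<forall>n. has_finite_sum (\<lambda>v. binom_term J Gs v (int n) 1) (J \<rightarrow>\<^sub>E UNIV) (\<Sum>A\<in>K. card {es \<in> W n. last_exits src r es = A}))"
  proof (rule binom_multisum_sum[where Fs = Fs and s = "\<lambda>A n. card {es \<in> W n. last_exits src r es = A}", OF E K])
    show "v j \<ge> 0" if "A \<in> K" "binom_term E (Fs A) v (int n) 1 \<noteq> 0" "j \<in> E" for A n v j
      using nonneg that by blast
    show "has_finite_sum (\<lambda>v. binom_term E (Fs A) v (int n) 1) (E \<rightarrow>\<^sub>E UNIV) (card {es \<in> W n. last_exits src r es = A})"
      if "A \<in> K" for A n using fib that by blast
  qed
  then show ?thesis unfolding total .
qed

section \<open>Tiles with prescribed boundaries\<close>

lemma piece_closure:
  assumes "open D" "connected D" "D \<subseteq> open_strip" "feet D \<noteq> {}" "heads D \<noteq> {}"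
  shows "piece (closure D)"
proof -
  have D: "D \<subseteq> interior (closure D)" using assms(1) by (simp add: closure_subset interior_maximal)
  have "closure D \<subseteq> closure open_strip" using assms(3) by (rule closure_mono)
  then have "closure D \<subseteq> UNIV \<times> {0..1}" unfolding open_strip_def by (simp add: closure_Times)
  moreover have "connected (interior (closure D))"
    using connected_intermediate_closure[OF assms(2) D] interior_subset by blast
  moreover have "closure D \<subseteq> closure (interior (closure D))" using D by (rule closure_mono)
  ultimately show ?thesis
    using assms(4,5) feet_mono[OF D] heads_mono[OF D] unfolding piece_def by auto
qed

lemma interior_closure_disjoint:
  assumes "open D" "open D'" "D \<inter> D' = {}"
  shows "interior (closure D) \<inter> interior (closure D') = {}"
proof -
  have "D \<inter> closure D' = {}" using assms by (simp add: open_Int_closure_eq_empty)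
  then have "interior (closure D') \<inter> D = {}" using interior_subset[of "closure D'"] by blast
  then have "interior (closure D') \<inter> closure D = {}" by (simp add: open_Int_closure_eq_empty)
  then show ?thesis using interior_subset[of "closure D"] by blast
qed

text \<open>The right boundary in state \<open>u\<close> is the vertical line at \<open>c\<close> with a bump of width \<open>\<delta>\<close> at the
  bottom, of height \<open>1 / (u + 1)\<close>; it is straight exactly for \<open>u = 0\<close>.\<close>

definition bump :: "nat \<Rightarrow> real" where
  "bump u = 1 / (real u + 1)"

lemma bump_bounds: "0 < bump u" "bump u \<le> 1" "u \<noteq> 0 \<Longrightarrow> bump u < 1"
  by (auto simp: bump_def field_simps)

lemma bump_0 [simp]: "bump 0 = 1"
  by (simp add: bump_def)

lemma bump_inj: "bump u = bump v \<Longrightarrow> u = v"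
  by (simp add: bump_def field_simps)

definition left_profile :: "real \<Rightarrow> nat \<Rightarrow> real \<Rightarrow> (real \<times> real) set" where
  "left_profile \<delta> u c = {..c} \<times> {0..1} \<union> {..c + \<delta>} \<times> {0..bump u}"

text \<open>The case \<open>v = 0\<close> is separate since the part above a bump of height 1 would
  degenerate to a segment. The same holds for \<open>u = 0\<close> in
  \<open>profile_tile\<close>.\<close>

definition right_profile :: "real \<Rightarrow> nat \<Rightarrow> real \<Rightarrow> (real \<times> real) set" where
  "right_profile \<delta> v c = {c + \<delta>..} \<times> {0..1} \<union> (if v = 0 then {} else {c..} \<times> {bump v..1})"

text \<open>The region between the boundary in state \<open>u\<close> at 0 and the boundary in state
  \<open>v\<close> at \<open>l\<close>.\<close>

definition profile_tile :: "real \<Rightarrow> nat \<times> real \<times> nat \<Rightarrow> (real \<times> real) set" where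
  "profile_tile \<delta> = (\<lambda>(u, l, v). {\<delta>..l} \<times> {0..1} \<union> (if u = 0 then {} else {0..l} \<times> {bump u..1}) \<union>
     {\<delta>..l + \<delta>} \<times> {0..bump v})"

definition left_profile_interior :: "real \<Rightarrow> nat \<Rightarrow> real \<Rightarrow> (real \<times> real) set" where
  "left_profile_interior \<delta> u c = {..<c} \<times> {0<..<1} \<union> {..<c + \<delta>} \<times> {0<..<bump u}"

definition right_profile_interior :: "real \<Rightarrow> nat \<Rightarrow> real \<Rightarrow> (real \<times> real) set" where
  "right_profile_interior \<delta> v c = {c + \<delta><..} \<times> {0<..<1} \<union> (if v = 0 then {} else {c<..} \<times> {bump v<..<1})"

definition profile_tile_interior :: "real \<Rightarrow> nat \<Rightarrow> real \<Rightarrow> nat \<Rightarrow> (real \<times> real) set" where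
  "profile_tile_interior \<delta> u l v = {\<delta><..<l} \<times> {0<..<1} \<union> (if u = 0 then {} else {0<..<l} \<times> {bump u<..<1}) \<union>
     {\<delta><..<l + \<delta>} \<times> {0<..<bump v}"

lemma closure_profiles:
  assumes "0 < \<delta>"
  shows "closure (left_profile_interior \<delta> u c) = left_profile \<delta> u c"
    "closure (right_profile_interior \<delta> v c) = right_profile \<delta> v c"
  using bump_bounds[of u] bump_bounds[of v] assms
  unfolding left_profile_interior_def left_profile_def right_profile_interior_def right_profile_def
  by (simp_all add: closure_Times)

lemma closure_profile_tile:
  assumes "0 < \<delta>" "\<delta> < l"
  shows "closure (profile_tile_interior \<delta> u l v) = profile_tile \<delta> (u, l, v)"
  using bump_bounds[of u] bump_bounds[of v] assms
  unfolding profile_tile_interior_def profile_tile_def by (simp add: closure_Times)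

lemma open_profiles:
  "open (left_profile_interior \<delta> u c)" "open (right_profile_interior \<delta> v c)"
  "open (profile_tile_interior \<delta> u l v)"
  unfolding left_profile_interior_def right_profile_interior_def profile_tile_interior_def
  by (auto intro!: open_Un open_Times)

lemma connected_open_boxes: "connected ({a<..<b} \<times> {c<..<d::real})" "connected ({..<b} \<times> {c<..<d})"
  "connected ({a<..} \<times> {c<..<d})" for a b :: real
  by (intro connected_Times; simp)+

lemma connected_profiles:
  assumes "0 < \<delta>"
  shows "connected (left_profile_interior \<delta> u c)" "connected (right_profile_interior \<delta> v c)"
proof -
  have "(c - 1, bump u / 2) \<in> {..<c} \<times> {0<..<1} \<inter> {..<c + \<delta>} \<times> {0<..<bump u}"
    using bump_bounds(1,2)[of u] assms by auto
  then show "connected (left_profile_interior \<delta> u c)"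
    unfolding left_profile_interior_def by (intro connected_Un connected_open_boxes) blast
  show "connected (right_profile_interior \<delta> v c)"
  proof (cases "v = 0")
    case False
    then have "(c + \<delta> + 1, (bump v + 1) / 2) \<in> {c + \<delta><..} \<times> {0<..<1} \<inter> {c<..} \<times> {bump v<..<1}"
      using bump_bounds[of v] assms by auto
    then show ?thesis
      using False unfolding right_profile_interior_def
      by (simp only: if_False) (intro connected_Un connected_open_boxes; blast)
  qed (simp add: right_profile_interior_def connected_open_boxes)
qed

lemma connected_profile_tile:
  assumes "0 < \<delta>" "\<delta> < l"
  shows "connected (profile_tile_interior \<delta> u l v)"
proof -
  have 1: "connected ({\<delta><..<l} \<times> {0<..<1::real} \<union> (if u = 0 then {} else {0<..<l} \<times> {bump u<..<1}))"
  proof (cases "u = 0")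
    case False
    then have "((\<delta> + l) / 2, (bump u + 1) / 2) \<in> {\<delta><..<l} \<times> {0<..<1} \<inter> {0<..<l} \<times> {bump u<..<1}"
      using bump_bounds[of u] assms by auto
    then show ?thesis using False
      by (simp only: if_False) (intro connected_Un connected_open_boxes; blast)
  qed (simp add: connected_open_boxes)
  have "((\<delta> + l) / 2, bump v / 2) \<in> {\<delta><..<l} \<times> {0<..<1} \<inter> {\<delta><..<l + \<delta>} \<times> {0<..<bump v}"
    using bump_bounds(1,2)[of v] assms by auto
  then show ?thesis unfolding profile_tile_interior_def
    by (intro connected_Un[OF 1] connected_open_boxes) blast
qed

lemma feet_heads_superset:
  assumes "I \<times> {0<..<1} \<subseteq> D" "x \<in> I" shows "x \<in> feet D" "x \<in> heads D"
  using feet_mono[OF assms(1)] heads_mono[OF assms(1)] assms(2) by (auto simp: feet_Times)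

lemma piece_profiles:
  assumes "0 < \<delta>"
  shows "piece (left_profile \<delta> u c)" "c - 1 \<in> feet (interior (left_profile \<delta> u c))"
    "piece (right_profile \<delta> v c)" "c + 2 * \<delta> \<in> feet (interior (right_profile \<delta> v c))"
proof -
  let ?L = "left_profile_interior \<delta> u c" and ?R = "right_profile_interior \<delta> v c"
  have L: "c - 1 \<in> feet ?L" "c - 1 \<in> heads ?L"
    by (rule feet_heads_superset[of "{..<c}"]; auto simp: left_profile_interior_def)+
  have R: "c + 2 * \<delta> \<in> feet ?R" "c + 2 * \<delta> \<in> heads ?R"
    using assms by (rule_tac feet_heads_superset[of "{c + \<delta><..}"]; auto simp: right_profile_interior_def)+
  have s: "?L \<subseteq> open_strip" "?R \<subseteq> open_strip"
    using bump_bounds[of u] bump_bounds[of v]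
    by (auto simp: left_profile_interior_def right_profile_interior_def open_strip_def split: if_splits)
  show "piece (left_profile \<delta> u c)" "piece (right_profile \<delta> v c)"
    using piece_closure[OF open_profiles(1) connected_profiles(1)[OF assms] s(1)] L
      piece_closure[OF open_profiles(2) connected_profiles(2)[OF assms] s(2)] R
    unfolding closure_profiles[OF assms] by blast+
  show "c - 1 \<in> feet (interior (left_profile \<delta> u c))" "c + 2 * \<delta> \<in> feet (interior (right_profile \<delta> v c))"
    using feet_mono[of ?L "interior (left_profile \<delta> u c)"] feet_mono[of ?R "interior (right_profile \<delta> v c)"] L R
      interior_maximal[OF closure_subset open_profiles(1), of \<delta> u c] interior_maximal[OF closure_subset open_profiles(2), of \<delta> v c]
    unfolding closure_profiles[OF assms] by blast+
qed

lemma piece_profile_tile: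
  assumes "0 < \<delta>" "\<delta> < l"
  shows "bounded_piece (profile_tile \<delta> (u, l, v))" "(\<delta> + l) / 2 \<in> feet (interior (profile_tile \<delta> (u, l, v)))"
proof -
  let ?D = "profile_tile_interior \<delta> u l v"
  have D: "(\<delta> + l) / 2 \<in> feet ?D" "(\<delta> + l) / 2 \<in> heads ?D"
    using assms by (rule_tac feet_heads_superset[of "{\<delta><..<l}"]; auto simp: profile_tile_interior_def)+
  have s: "?D \<subseteq> open_strip"
    using bump_bounds[of u] bump_bounds[of v]
    by (auto simp: profile_tile_interior_def open_strip_def split: if_splits)
  have "bounded (profile_tile \<delta> (u, l, v))"
    unfolding profile_tile_def by (auto intro!: bounded_Times)
  then show "bounded_piece (profile_tile \<delta> (u, l, v))"
    using piece_closure[OF open_profiles(3) connected_profile_tile[OF assms] s] D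
    unfolding closure_profile_tile[OF assms] bounded_piece_def by blast
  show "(\<delta> + l) / 2 \<in> feet (interior (profile_tile \<delta> (u, l, v)))"
    using feet_mono[of ?D "interior (profile_tile \<delta> (u, l, v))"] D
      interior_maximal[OF closure_subset open_profiles(3), of \<delta> u l v]
    unfolding closure_profile_tile[OF assms] by blast
qed

text \<open>One explicit tiling through the tile is enough to read off its left region by
  \<open>left_region_eq\<close>.\<close>

lemma profile_strip_tiling:
  assumes d: "0 < \<delta>" "\<delta> < l"
  shows "strip_tiling {left_profile \<delta> u 0, profile_tile \<delta> (u, l, v), right_profile \<delta> v l}"
proof -
  let ?L = "left_profile_interior \<delta> u 0" and ?T = "profile_tile_interior \<delta> u l v" and ?R = "right_profile_interior \<delta> v l"
  note b = bump_bounds[of u] bump_bounds[of v]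
  have e: "?L \<inter> ?T = {}" "?T \<inter> ?R = {}" "?L \<inter> ?R = {}"
    using b d by (auto simp: left_profile_interior_def profile_tile_interior_def right_profile_interior_def split: if_splits)
  have "interior (left_profile \<delta> u 0) \<inter> interior (profile_tile \<delta> (u, l, v)) = {}"
    using interior_closure_disjoint[OF open_profiles(1) open_profiles(3) e(1)]
    by (simp only: closure_profiles[OF d(1)] closure_profile_tile[OF d])
  moreover have "interior (profile_tile \<delta> (u, l, v)) \<inter> interior (right_profile \<delta> v l) = {}"
    using interior_closure_disjoint[OF open_profiles(3) open_profiles(2) e(2)]
    by (simp only: closure_profiles[OF d(1)] closure_profile_tile[OF d])
  moreover have "interior (left_profile \<delta> u 0) \<inter> interior (right_profile \<delta> v l) = {}"
    using interior_closure_disjoint[OF open_profiles(1) open_profiles(2) e(3)]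
    by (simp only: closure_profiles[OF d(1)])
  ultimately have "pairwise (\<lambda>P Q. interior P \<inter> interior Q = {})
      {left_profile \<delta> u 0, profile_tile \<delta> (u, l, v), right_profile \<delta> v l}"
    unfolding pairwise_insert by (auto simp: pairwise_def Int_commute)
  moreover have "left_profile \<delta> u 0 \<union> profile_tile \<delta> (u, l, v) \<union> right_profile \<delta> v l = UNIV \<times> {0..1}"
  proof
    show "left_profile \<delta> u 0 \<union> profile_tile \<delta> (u, l, v) \<union> right_profile \<delta> v l \<subseteq> UNIV \<times> {0..1}"
      using b by (auto simp: left_profile_def profile_tile_def right_profile_def split: if_splits)
    show "UNIV \<times> {0..1} \<subseteq> left_profile \<delta> u 0 \<union> profile_tile \<delta> (u, l, v) \<union> right_profile \<delta> v l"
    proof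
      fix z :: "real \<times> real" assume "z \<in> UNIV \<times> {0..1}"
      then obtain x y where z: "z = (x, y)" "0 \<le> y" "y \<le> 1" by auto
      consider "x \<le> \<delta>" "y \<le> bump u" | "x \<le> 0" "bump u < y" | "0 \<le> x" "x \<le> \<delta>" "bump u < y" | "\<delta> \<le> x" "x \<le> l"
        | "l \<le> x" "x \<le> l + \<delta>" "y \<le> bump v" | "l \<le> x" "bump v < y" | "l + \<delta> \<le> x"
        by linarith
      then show "z \<in> left_profile \<delta> u 0 \<union> profile_tile \<delta> (u, l, v) \<union> right_profile \<delta> v l"
        using z b d by cases (auto simp: left_profile_def profile_tile_def right_profile_def)
    qed
  qed
  ultimately show ?thesis
    using piece_profiles[OF d(1)] piece_profile_tile[OF d] unfolding strip_tiling_def bounded_piece_def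
    by (auto simp: Un_assoc)
qed

lemma regions_profile_tile:
  assumes d: "0 < \<delta>" "\<delta> < l"
  shows "left_region (profile_tile \<delta> (u, l, v)) = left_profile \<delta> u 0"
    "right_region (profile_tile \<delta> (u, l, v)) = left_profile \<delta> v l"
proof -
  let ?L = "left_profile \<delta> u 0" and ?T = "profile_tile \<delta> (u, l, v)" and ?R = "right_profile \<delta> v l"
  have tl: "strip_tiling {?L, ?T, ?R}" by (rule profile_strip_tiling[OF d])
  have x: "0 - 1 \<in> feet (interior ?L)" "(\<delta> + l) / 2 \<in> feet (interior ?T)" "l + 2 * \<delta> \<in> feet (interior ?R)"
    using piece_profiles[OF d(1)] piece_profile_tile[OF d] by blast+
  have p: "piece ?L" "piece ?T" "piece ?R" using tl unfolding strip_tiling_def by blast+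
  have LT: "precedes ?L ?T" "precedes ?T ?R"
    unfolding precedes_def using x d
    by (auto intro!: bexI[OF _ x(1)] bexI[OF _ x(2)] bexI[OF _ x(3)])
  have nb: "\<not> bounded ?L" "\<not> bounded ?R" "bounded ?T"
  proof -
    have "\<exists>z\<in>?L. norm z > c" for c
      by (intro bexI[of _ "(- \<bar>c\<bar> - 1, 0)"]) (auto simp: left_profile_def norm_Pair)
    then show "\<not> bounded ?L" unfolding bounded_iff by (meson not_less)
    have "\<exists>z\<in>?R. norm z > c" for c
      using d by (intro bexI[of _ "(l + \<delta> + \<bar>c\<bar> + 1, 0)"]) (auto simp: right_profile_def norm_Pair)
    then show "\<not> bounded ?R" unfolding bounded_iff by (meson not_less)
    show "bounded ?T" using piece_profile_tile[OF d] unfolding bounded_piece_def by blast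
  qed
  then have ne: "?L \<noteq> ?T" "?R \<noteq> ?T" by auto
  then have "interior ?T \<inter> interior ?R = {}" using tl unfolding strip_tiling_def pairwise_def by blast
  then have "\<not> precedes ?R ?T" using precedes_asym[OF p(2,3)] LT(2) by blast
  then have "{Q \<in> {?L, ?T, ?R}. Q \<noteq> ?T \<and> precedes Q ?T} = {?L}" using LT ne by blast
  then show L: "left_region ?T = ?L" using left_region_eq[OF tl, of ?T] by simp
  note b = bump_bounds[of u] bump_bounds[of v]
  have "z \<in> ?L \<union> ?T \<longleftrightarrow> z \<in> left_profile \<delta> v l" for z
  proof -
    obtain x y where z: "z = (x, y)" by fastforce
    consider "x \<le> 0" | "0 < x" "x \<le> \<delta>" | "\<delta> < x" "x \<le> l" | "l < x" by linarith
    then show ?thesis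
      using b d unfolding z by cases (auto simp: left_profile_def profile_tile_def)
  qed
  then show "right_region ?T = left_profile \<delta> v l" unfolding right_region_def L by blast
qed

lemma axis_rectangleI: "a < b \<Longrightarrow> c < d \<Longrightarrow> axis_rectangle ({a..b} \<times> {c..d})"
  unfolding axis_rectangle_def by blast

lemma profile_tile_polygon:
  assumes d: "0 < \<delta>" "\<delta> < l"
  shows "axis_parallel_polygon (profile_tile \<delta> (u, l, v))"
proof -
  note b = bump_bounds[of u] bump_bounds[of v]
  \<comment> \<open>For \<open>u = 0\<close> the first rectangle is repeated to avoid a degenerate
    one.\<close>
  let ?B = "{{\<delta>..l} \<times> {0..1}, if u = 0 then {\<delta>..l} \<times> {0..1} else {0..l} \<times> {bump u..1}, {\<delta>..l + \<delta>} \<times> {0..bump v}}"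
  have "\<forall>Q\<in>?B. axis_rectangle Q" using b d by (auto intro!: axis_rectangleI)
  moreover have "profile_tile \<delta> (u, l, v) = \<Union>?B" unfolding profile_tile_def by auto
  moreover have "profile_tile \<delta> (u, l, v) \<noteq> {}" "connected (interior (profile_tile \<delta> (u, l, v)))"
    using piece_profile_tile(1)[OF d, of u v] piece_interior_nonempty interior_subset
    unfolding bounded_piece_def piece_def by blast+
  ultimately show ?thesis unfolding axis_parallel_polygon_def by (intro conjI exI[of _ ?B]) simp_all
qed

text \<open>The tile retracts onto a vertical segment along horizontal lines.\<close>

lemma profile_tile_contractible:
  assumes d: "0 < \<delta>" "\<delta> < l"
  shows "contractible (profile_tile \<delta> (u, l, v))"
proof -
  let ?P = "profile_tile \<delta> (u, l, v)" and ?c = "(\<delta> + l) / 2"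
  note b = bump_bounds[of u] bump_bounds[of v]
  have seg: "closed_segment (x, y) (?c, y) \<subseteq> ?P" if xy: "(x, y) \<in> ?P" for x y
  proof -
    have *: "closed_segment (x, y) (?c, y) \<subseteq> I \<times> J" if "(x, y) \<in> I \<times> J" "?c \<in> I" "convex I" "convex J" for I J
      using that by (intro closed_segment_subset convex_Times) auto
    consider "(x, y) \<in> {\<delta>..l} \<times> {0..1}" | "u \<noteq> 0" "(x, y) \<in> {0..l} \<times> {bump u..1}" | "(x, y) \<in> {\<delta>..l + \<delta>} \<times> {0..bump v}"
      using xy unfolding profile_tile_def by (auto split: if_splits)
    then show ?thesis
    proof cases
      case 1
      then have "closed_segment (x, y) (?c, y) \<subseteq> {\<delta>..l} \<times> {0..1}" using d by (intro *) auto
      then show ?thesis unfolding profile_tile_def by auto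
    next
      case 2
      then have "closed_segment (x, y) (?c, y) \<subseteq> {0..l} \<times> {bump u..1}" using d by (intro *) auto
      then show ?thesis using 2(1) unfolding profile_tile_def by auto
    next
      case 3
      then have "closed_segment (x, y) (?c, y) \<subseteq> {\<delta>..l + \<delta>} \<times> {0..bump v}" using d by (intro *) auto
      then show ?thesis unfolding profile_tile_def by auto
    qed
  qed
  have 1: "homotopic_with_canon (\<lambda>z. True) ?P ?P id (\<lambda>z. (?c, snd z))"
  proof (rule homotopic_with_linear)
    show "closed_segment (id z) (?c, snd z) \<subseteq> ?P" if "z \<in> ?P" for z
      using seg[of "fst z" "snd z"] that by simp
  qed (auto intro!: continuous_intros)
  have 2: "homotopic_with_canon (\<lambda>z. True) ?P ?P (\<lambda>z. (?c, snd z)) (\<lambda>z. (?c, 0))"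
  proof (rule homotopic_with_linear)
    show "closed_segment (?c, snd z) (?c, 0) \<subseteq> ?P" if "z \<in> ?P" for z
    proof -
      have "snd z \<in> {0..1}" using that b d unfolding profile_tile_def by (auto split: if_splits)
      then have "closed_segment (?c, snd z) (?c, 0) \<subseteq> {\<delta>..l} \<times> {0..1}"
        using d by (intro closed_segment_subset convex_Times) auto
      then show ?thesis unfolding profile_tile_def by auto
    qed
  qed (auto intro!: continuous_intros)
  show ?thesis unfolding contractible_def using homotopic_with_trans[OF 1 2] by blast
qed

lemma snd_profile_tile:
  assumes d: "0 < \<delta>" "\<delta> < l"
  shows "snd ` profile_tile \<delta> (u, l, v) = {0..1}"
proof
  show "snd ` profile_tile \<delta> (u, l, v) \<subseteq> {0..1}"
    using bump_bounds[of u] bump_bounds[of v] unfolding profile_tile_def by (auto split: if_splits)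
  show "{0..1} \<subseteq> snd ` profile_tile \<delta> (u, l, v)"
  proof
    fix y :: real assume "y \<in> {0..1}"
    then have "(l, y) \<in> profile_tile \<delta> (u, l, v)" using d unfolding profile_tile_def by auto
    then show "y \<in> snd ` profile_tile \<delta> (u, l, v)" by force
  qed
qed

lemma tile_profile_tile:
  assumes d: "0 < \<delta>" "\<delta> < l"
  shows "tile (profile_tile \<delta> (u, l, v))" "tall (profile_tile \<delta> (u, l, v))"
  using profile_tile_polygon[OF d] contractible_imp_simply_connected[OF profile_tile_contractible[OF d]]
    snd_profile_tile[OF d, of u v]
  unfolding tile_def tall_def height_def by simp_all

lemma off_left_profile: "0 < \<delta> \<Longrightarrow> off (left_profile \<delta> u c) = c + \<delta>"
proof -
  assume "0 < \<delta>"
  have "fst ` left_profile \<delta> u c = {..c} \<union> {..c + \<delta>}"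
    using bump_bounds(1)[of u] unfolding left_profile_def image_Un fst_image_times by auto
  also have "\<dots> = {..c + \<delta>}" using \<open>0 < \<delta>\<close> by auto
  finally show ?thesis unfolding off_def by simp
qed

lemma shift_left_profile: "shift s (left_profile \<delta> u c) = left_profile \<delta> u (s + c)"
proof -
  have "(x, y) \<in> shift s (left_profile \<delta> u c) \<longleftrightarrow> (x, y) \<in> left_profile \<delta> u (s + c)" for x y
    unfolding mem_shift left_profile_def by auto
  then show ?thesis by auto
qed

lemma nf_left_profile: "0 < \<delta> \<Longrightarrow> nf (left_profile \<delta> u c) = left_profile \<delta> u (- \<delta>)"
  unfolding nf_def by (simp add: off_left_profile shift_left_profile)

lemma left_profile_0: "0 < \<delta> \<Longrightarrow> left_profile \<delta> 0 (- \<delta>) = left_strip 0"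
  by (auto simp: left_profile_def left_strip_def)

lemma left_profile_inj:
  assumes "0 < \<delta>" "left_profile \<delta> u (- \<delta>) = left_profile \<delta> v (- \<delta>)" shows "u = v"
proof -
  have "(0, y) \<in> left_profile \<delta> u (- \<delta>) \<longleftrightarrow> 0 \<le> y \<and> y \<le> bump u" for u y
    using assms(1) by (auto simp: left_profile_def)
  then have "bump u \<le> bump v" "bump v \<le> bump u" using assms(2) bump_bounds(1) by (metis less_imp_le order_refl)+
  then show ?thesis using bump_inj by simp
qed

lemma profile_tile_data:
  assumes d: "0 < \<delta>" "\<delta> < l"
  shows "tail_of (profile_tile \<delta> (u, l, v)) = left_profile \<delta> u (- \<delta>)"
    "head_of (profile_tile \<delta> (u, l, v)) = left_profile \<delta> v (- \<delta>)"
    "advance (profile_tile \<delta> (u, l, v)) = l"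
  unfolding tail_of_def head_of_def advance_def regions_profile_tile[OF d]
  using d by (simp_all add: nf_left_profile off_left_profile)

text \<open>Every finite graph with positive real edge lengths is realized by tiles. The base vertex
  0 has the straight boundary, so its region is a half strip, as at the ends of a rectangle.\<close>

theorem walks_are_tilings:
  fixes E :: "(nat \<times> real \<times> nat) set"
  assumes E: "finite E" and pos: "\<And>e. e \<in> E \<Longrightarrow> fst (snd e) > 0"
  obtains T where "finite T" "\<And>t. t \<in> T \<Longrightarrow> tile t \<and> tall t"
    "\<And>a. a \<ge> 0 \<Longrightarrow> card (tilings T a) =
      card {es \<in> lists E. walk fst (\<lambda>e. snd (snd e)) 0 es 0 \<and> sum_list (map (\<lambda>e. fst (snd e)) es) = a}"
proof -
  \<comment> \<open>Half of the shortest length, so that bumps are narrower than every tile is long;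
    the 1 covers the empty edge set.\<close>
  define \<delta> where "\<delta> = Min (insert 1 ((\<lambda>e. fst (snd e)) ` E)) / 2"
  have "Min (insert 1 ((\<lambda>e. fst (snd e)) ` E)) > 0" using E pos by (subst Min_gr_iff) auto
  then have d: "0 < \<delta>" unfolding \<delta>_def by simp
  have dl: "\<delta> < fst (snd e)" if "e \<in> E" for e
  proof -
    have "Min (insert 1 ((\<lambda>e. fst (snd e)) ` E)) \<le> fst (snd e)" using E that by (intro Min_le) auto
    then have "2 * \<delta> \<le> fst (snd e)" unfolding \<delta>_def by simp
    then show ?thesis using d by linarith
  qed
  let ?t = "profile_tile \<delta>"
  have data: "tail_of (?t e) = left_profile \<delta> (fst e) (- \<delta>)" "head_of (?t e) = left_profile \<delta> (snd (snd e)) (- \<delta>)"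
    "advance (?t e) = fst (snd e)" "tile (?t e) \<and> tall (?t e)" "bounded_piece (?t e)" "base (?t e) = ?t e"
    "left_region (?t e) = left_profile \<delta> (fst e) 0" if "e \<in> E" for e
  proof -
    obtain u l v where e: "e = (u, l, v)" by (metis prod_cases3)
    have l: "\<delta> < l" using dl[OF that] e by simp
    show "tail_of (?t e) = left_profile \<delta> (fst e) (- \<delta>)" "head_of (?t e) = left_profile \<delta> (snd (snd e)) (- \<delta>)"
      "advance (?t e) = fst (snd e)" "tile (?t e) \<and> tall (?t e)" "bounded_piece (?t e)"
      "left_region (?t e) = left_profile \<delta> (fst e) 0"
      using profile_tile_data[OF d l] tile_profile_tile[OF d l] piece_profile_tile(1)[OF d l] regions_profile_tile(1)[OF d l]
      unfolding e by simp_all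
    show "base (?t e) = ?t e"
      unfolding base_def e snd_profile_tile[OF d l] by (simp add: zero_prod_def[symmetric])
  qed
  have inj: "inj_on ?t E"
  proof (rule inj_onI)
    fix e f assume "e \<in> E" "f \<in> E" "?t e = ?t f"
    then have "fst e = fst f" "snd (snd e) = snd (snd f)" "fst (snd e) = fst (snd f)"
      using data(1-3)[of e] data(1-3)[of f] left_profile_inj[OF d] by auto
    then show "e = f" by (simp add: prod_eq_iff)
  qed
  let ?T = "?t ` E"
  have bp: "bounded_piece t" if "t \<in> ?T" for t using that data(5) by blast
  \<comment> \<open>The left regions of all these tiles end at \<open>\<delta>\<close>, so a
    translation that takes one tile to another is trivial.\<close>
  have ind: "shift_independent ?T"
    unfolding shift_independent_def
  proof (intro ballI allI impI)
    fix t u s assume tu: "t \<in> ?T" "u \<in> ?T" "shift s t = u"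
    have "off (left_region t) = \<delta>" "off (left_region u) = \<delta>"
      using tu(1,2) data(7) off_left_profile[OF d] by auto
    moreover have "off (left_region u) = s + off (left_region t)"
      unfolding tu(3)[symmetric] left_region_shift using off_shift right_bounded_left_region bp tu(1) by blast
    ultimately show "t = u" using tu(3) by simp
  qed
  have sh: "{P. \<exists>t\<in>?T. \<exists>v. P = (+) v ` t \<and> P \<subseteq> UNIV \<times> {0..1}} = shifts_of ?T"
  proof -
    have "{P. \<exists>t\<in>?T. \<exists>v. P = (+) v ` t \<and> P \<subseteq> UNIV \<times> {0..1}} = shifts_of (base ` ?T)"
      using data(4) by (intro translations_in_strip) (auto simp: tile_def)
    also have "base ` ?T = ?T" using data(6) by (auto simp: image_image)
    finally show ?thesis .
  qed
  have walk: "walk tail_of head_of (left_profile \<delta> u (- \<delta>)) (map ?t es) (left_profile \<delta> v (- \<delta>)) \<longleftrightarrow>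
      walk fst (\<lambda>e. snd (snd e)) u es v" if "es \<in> lists E" for es u v
    using that
  proof (induction es arbitrary: u rule: list.induct)
    case Nil
    then show ?case using left_profile_inj[OF d] by auto
  next
    case (Cons e es)
    then show ?case using data(1,2)[of e] left_profile_inj[OF d] by auto
  qed
  have adv: "sum_list (map advance (map ?t es)) = sum_list (map (\<lambda>e. fst (snd e)) es)" if "es \<in> lists E" for es
    using that data(3) by (induction es) auto
  have card: "card (tilings ?T a) =
      card {es \<in> lists E. walk fst (\<lambda>e. snd (snd e)) 0 es 0 \<and> sum_list (map (\<lambda>e. fst (snd e)) es) = a}" (is "_ = card ?W")
    if "a \<ge> 0" for a
  proof -
    have "closed_words ?T a = map ?t ` ?W"
    proof (intro set_eqI iffI)
      fix ts assume ts: "ts \<in> closed_words ?T a"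
      then have "ts \<in> map ?t ` lists E" unfolding closed_words_def by (simp add: lists_image)
      then obtain es where es: "es \<in> lists E" "ts = map ?t es" by blast
      have "walk tail_of head_of (left_strip 0) (map ?t es) (left_strip 0)" "sum_list (map advance (map ?t es)) = a"
        using ts unfolding es(2) closed_words_def by simp_all
      then have "es \<in> ?W"
        using es(1) walk[OF es(1), of 0 0] adv[OF es(1)] unfolding left_profile_0[OF d] by simp
      then show "ts \<in> map ?t ` ?W" using es(2) by (rule rev_image_eqI)
    next
      fix ts assume "ts \<in> map ?t ` ?W"
      then obtain es where es: "es \<in> ?W" "ts = map ?t es" by (rule imageE)
      then have E': "es \<in> lists E" by simp
      have "walk tail_of head_of (left_strip 0) ts (left_strip 0)" "sum_list (map advance ts) = a"
        using es walk[OF E', of 0 0] adv[OF E'] unfolding left_profile_0[OF d] by simp_all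
      moreover have "ts \<in> lists ?T" using E' unfolding es(2) by (auto simp: lists_image)
      ultimately show "ts \<in> closed_words ?T a" unfolding closed_words_def by simp
    qed
    moreover have "inj_on (map ?t) ?W"
    proof (rule inj_on_mapI)
      have "\<Union>(set ` ?W) \<subseteq> E" by auto
      then show "inj_on ?t (\<Union>(set ` ?W))" using inj by (rule inj_on_subset[rotated])
    qed
    moreover have "card (tilings ?T a) = card (closed_words ?T a)"
      using card_tilings(2)[OF _ bp ind sh that] E by blast
    ultimately show ?thesis by (simp add: card_image)
  qed
  show thesis
  proof (rule that[of ?T])
    show "finite ?T" using E by simp
    show "tile t \<and> tall t" if "t \<in> ?T" for t using that data(4) by blast
  qed (rule card)
qed

section \<open>Bounds on the support\<close>

text \<open>Dickson's lemma for the vectors \<open>k s\<close>. By induction, \<open>F\<close> lies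
  below all of \<open>S\<close> in the old coordinates. Where the new coordinate is at least
  \<open>N\<close>, the elements of \<open>F\<close> are below in that coordinate too; the rest
  falls into finitely many slices with constant new coordinate, each with a finite set of its
  own.\<close>

lemma dickson:
  fixes k :: "'a \<Rightarrow> 'q \<Rightarrow> nat"
  assumes "finite Q"
  shows "\<exists>F\<subseteq>S. finite F \<and> (\<forall>s\<in>S. \<exists>f\<in>F. \<forall>q\<in>Q. k f q \<le> k s q)"
  using assms
proof (induction Q arbitrary: S rule: finite_induct)
  case empty
  show ?case
  proof (cases "S = {}")
    case False
    then obtain s where "s \<in> S" by blast
    then show ?thesis by (intro exI[of _ "{s}"]) auto
  qed auto
next
  case (insert i Q)
  obtain F where F: "F \<subseteq> S" "finite F" "\<forall>s\<in>S. \<exists>f\<in>F. \<forall>q\<in>Q. k f q \<le> k s q"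
    using insert.IH[of S] by blast
  define N where "N = (\<Sum>f\<in>F. k f i)"
  have N: "k f i \<le> N" if "f \<in> F" for f using that F(2) unfolding N_def by (intro member_le_sum) auto
  have "\<forall>m. \<exists>G\<subseteq>{s \<in> S. k s i = m}. finite G \<and> (\<forall>s\<in>{s \<in> S. k s i = m}. \<exists>f\<in>G. \<forall>q\<in>Q. k f q \<le> k s q)"
    using insert.IH by blast
  then have "\<exists>G. \<forall>m. G m \<subseteq> {s \<in> S. k s i = m} \<and> finite (G m) \<and>
      (\<forall>s\<in>{s \<in> S. k s i = m}. \<exists>f\<in>G m. \<forall>q\<in>Q. k f q \<le> k s q)" by (rule choice)
  then obtain G where G0: "\<forall>m. G m \<subseteq> {s \<in> S. k s i = m} \<and> finite (G m) \<and>
      (\<forall>s\<in>{s \<in> S. k s i = m}. \<exists>f\<in>G m. \<forall>q\<in>Q. k f q \<le> k s q)" by (rule exE)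
  have G: "\<And>m. G m \<subseteq> {s \<in> S. k s i = m}" "\<And>m. finite (G m)"
    "\<And>m s. s \<in> S \<Longrightarrow> k s i = m \<Longrightarrow> \<exists>f\<in>G m. \<forall>q\<in>Q. k f q \<le> k s q"
    using G0 by blast+
  let ?F = "F \<union> (\<Union>m<N. G m)"
  have "\<exists>f\<in>?F. \<forall>q\<in>insert i Q. k f q \<le> k s q" if s: "s \<in> S" for s
  proof (cases "k s i < N")
    case True
    obtain f where f: "f \<in> G (k s i)" "\<forall>q\<in>Q. k f q \<le> k s q" using G(3)[OF s refl] by blast
    moreover have "k f i = k s i" using f G(1) by blast
    ultimately show ?thesis using True by (intro bexI[of _ f]) auto
  next
    case False
    obtain f where "f \<in> F" "\<forall>q\<in>Q. k f q \<le> k s q" using F(3) s by blast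
    then show ?thesis using N[of f] False by (intro bexI[of _ f]) auto
  qed
  moreover have "?F \<subseteq> S" using F(1) G(1) by blast
  moreover have "finite ?F" using F(2) G(2) by simp
  ultimately show ?case by blast
qed

text \<open>The slacks \<open>L q v n + c q\<close> order the solutions, and a difference of comparable solutions solves the
  homogeneous system. A homogeneous solution with \<open>n = 0\<close> has to vanish by finiteness.\<close>

theorem linear_solutions_bound:
  fixes J :: "'j set" and Q :: "'q set" and l :: "'q \<Rightarrow> 'j \<Rightarrow> int" and b c :: "'q \<Rightarrow> int"
  defines "L \<equiv> \<lambda>q (v::'j \<Rightarrow> int) (n::int). (\<Sum>j\<in>J. l q j * v j) + b q * n"
  assumes J: "finite J" and Q: "finite Q"
    and fin: "\<And>n::nat. finite {v \<in> J \<rightarrow>\<^sub>E UNIV. \<forall>q\<in>Q. L q v (int n) + c q \<ge> 0}"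
  shows "\<exists>C. \<forall>n::nat. \<forall>v. (\<forall>q\<in>Q. L q v (int n) + c q \<ge> 0) \<longrightarrow> (\<Sum>j\<in>J. \<bar>v j\<bar>) \<le> C * (int n + 1)"
proof -
  define size where "size = (\<lambda>v::'j \<Rightarrow> int. \<Sum>j\<in>J. \<bar>v j\<bar>)"
  have size0: "size v \<ge> 0" for v unfolding size_def by (intro sum_nonneg) auto
  have tri: "size v \<le> size w + size (\<lambda>j. v j - w j)" for v w
    unfolding size_def sum.distrib[symmetric] by (intro sum_mono) auto
  have Ldiff: "L q (\<lambda>j. v j - w j) (m - n) = L q v m - L q w n" for q v w m n
    unfolding L_def by (simp add: right_diff_distrib sum_subtractf)
  define Hom where "Hom = {(h, m). \<forall>q\<in>Q. L q h (int m) \<ge> 0}"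
  define Sol where "Sol = {(v, n). \<forall>q\<in>Q. L q v (int n) + c q \<ge> 0}"
  show ?thesis
  proof (cases "Sol = {}")
    case True
    then have "\<not> (\<forall>q\<in>Q. L q v (int n) + c q \<ge> 0)" for v n unfolding Sol_def by blast
    then show ?thesis by blast
  next
    case False
    then obtain v0 n0 where v0: "(v0, n0) \<in> Sol" by auto
    have hom0: "size h = 0" if h: "(h, 0) \<in> Hom" for h
    proof (rule ccontr)
      assume "size h \<noteq> 0"
      then obtain j where j: "j \<in> J" "h j \<noteq> 0" unfolding size_def by (metis abs_zero sum.neutral)
      let ?v = "\<lambda>t::nat. restrict (\<lambda>j. v0 j + int t * h j) J"
      have "?v t \<in> {v \<in> J \<rightarrow>\<^sub>E UNIV. \<forall>q\<in>Q. L q v (int n0) + c q \<ge> 0}" for t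
      proof -
        have "L q (?v t) (int n0) = L q v0 (int n0) + int t * L q h 0" for q
          unfolding L_def by (simp add: distrib_left sum.distrib sum_distrib_left mult.left_commute)
        moreover have "L q v0 (int n0) + c q \<ge> 0" "int t * L q h 0 \<ge> 0" if "q \<in> Q" for q
          using v0 h that unfolding Sol_def Hom_def by auto
        ultimately have "L q (?v t) (int n0) + c q \<ge> 0" if "q \<in> Q" for q
          using that by (smt (verit))
        then show ?thesis by auto
      qed
      moreover have "inj ?v"
      proof (rule injI)
        fix s t assume "?v s = ?v t"
        then have "?v s j = ?v t j" by simp
        then show "s = t" using j by simp
      qed
      ultimately have "infinite {v \<in> J \<rightarrow>\<^sub>E UNIV. \<forall>q\<in>Q. L q v (int n0) + c q \<ge> 0}"
        using infinite_UNIV_nat by (meson finite_imageD finite_subset image_subset_iff inj_on_subset subset_UNIV)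
      then show False using fin by blast
    qed
    \<comment> \<open>The coordinate \<open>None\<close> compares the values of \<open>n\<close>, so
      that the difference of comparable solutions again has a natural number there.\<close>
    let ?H = "{x \<in> Hom. snd x > 0}"
    obtain F where F: "F \<subseteq> ?H" "finite F"
      "\<forall>x\<in>?H. \<exists>f\<in>F. \<forall>q\<in>insert None (Some ` Q). (case q of None \<Rightarrow> snd f | Some q \<Rightarrow> nat (L q (fst f) (int (snd f)))) \<le>
         (case q of None \<Rightarrow> snd x | Some q \<Rightarrow> nat (L q (fst x) (int (snd x))))"
      using dickson[of "insert None (Some ` Q)" ?H "\<lambda>x q. case q of None \<Rightarrow> snd x | Some q \<Rightarrow> nat (L q (fst x) (int (snd x)))"] Q
      by auto
    define C where "C = (\<Sum>f\<in>F. size (fst f))"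
    have C0: "C \<ge> 0" unfolding C_def using size0 by (intro sum_nonneg) auto
    have C: "size (fst f) \<le> C" if "f \<in> F" for f
      using that F(2) size0 unfolding C_def by (intro member_le_sum) auto
    \<comment> \<open>Descent: subtracting one of the finitely many solutions in \<open>F\<close>
      lowers \<open>m\<close> by at least 1 and \<open>size\<close> by at most
      \<open>C\<close>.\<close>
    have hom: "size h \<le> C * int m" if "(h, m) \<in> Hom" for h m
      using that
    proof (induction m arbitrary: h rule: less_induct)
      case (less m)
      show ?case
      proof (cases "m = 0")
        case True
        then show ?thesis using hom0 less.prems by simp
      next
        case False
        then have "(h, m) \<in> ?H" using less.prems by simp
        then obtain f where f: "f \<in> F" "\<forall>q\<in>insert None (Some ` Q). (case q of None \<Rightarrow> snd f | Some q \<Rightarrow> nat (L q (fst f) (int (snd f)))) \<le>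
         (case q of None \<Rightarrow> snd (h, m) | Some q \<Rightarrow> nat (L q (fst (h, m)) (int (snd (h, m)))))"
          using F(3) by blast
        obtain g k where fgk: "f = (g, k)" by fastforce
        have gk: "(g, k) \<in> Hom" "k > 0" "k \<le> m" "\<And>q. q \<in> Q \<Longrightarrow> nat (L q g (int k)) \<le> nat (L q h (int m))"
          using f F(1) fgk by auto
        have "(\<lambda>j. h j - g j, m - k) \<in> Hom"
        proof -
          have "L q (\<lambda>j. h j - g j) (int (m - k)) \<ge> 0" if "q \<in> Q" for q
          proof -
            have "L q h (int m) \<ge> 0" "L q g (int k) \<ge> 0" using less.prems gk(1) that unfolding Hom_def by auto
            then show ?thesis using gk(4)[OF that] gk(3) Ldiff[of q h g "int m" "int k"] by (simp add: of_nat_diff)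
          qed
          then show ?thesis unfolding Hom_def by simp
        qed
        then have "size (\<lambda>j. h j - g j) \<le> C * int (m - k)" using less.IH[of "m - k"] gk(2,3) by simp
        moreover have "size g \<le> C * int k"
        proof -
          have "size g \<le> C * 1" using C[OF f(1)] fgk by simp
          also have "\<dots> \<le> C * int k" using C0 gk(2) by (intro mult_left_mono) auto
          finally show ?thesis .
        qed
        ultimately have "size h \<le> C * int k + C * int (m - k)" using tri[of h g] by linarith
        also have "\<dots> = C * int m" using gk(3) by (simp add: of_nat_diff right_diff_distrib)
        finally show ?thesis .
      qed
    qed
    obtain D where D: "D \<subseteq> Sol" "finite D"
      "\<forall>x\<in>Sol. \<exists>f\<in>D. \<forall>q\<in>insert None (Some ` Q). (case q of None \<Rightarrow> snd f | Some q \<Rightarrow> nat (L q (fst f) (int (snd f)) + c q)) \<le>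
         (case q of None \<Rightarrow> snd x | Some q \<Rightarrow> nat (L q (fst x) (int (snd x)) + c q))"
      using dickson[of "insert None (Some ` Q)" Sol "\<lambda>x q. case q of None \<Rightarrow> snd x | Some q \<Rightarrow> nat (L q (fst x) (int (snd x)) + c q)"] Q
      by auto
    define B where "B = (\<Sum>f\<in>D. size (fst f))"
    have B: "size (fst f) \<le> B" if "f \<in> D" for f
      using that D(2) size0 unfolding B_def by (intro member_le_sum) auto
    have B0: "B \<ge> 0" unfolding B_def using size0 by (intro sum_nonneg) auto
    have "size v \<le> (B + C) * (int n + 1)" if v: "(v, n) \<in> Sol" for v n
    proof -
      obtain f where f: "f \<in> D" "\<forall>q\<in>insert None (Some ` Q). (case q of None \<Rightarrow> snd f | Some q \<Rightarrow> nat (L q (fst f) (int (snd f)) + c q)) \<le>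
         (case q of None \<Rightarrow> snd (v, n) | Some q \<Rightarrow> nat (L q (fst (v, n)) (int (snd (v, n))) + c q))"
        using D(3) v by blast
      obtain g k where fgk: "f = (g, k)" by fastforce
      have gk: "(g, k) \<in> Sol" "k \<le> n" "\<And>q. q \<in> Q \<Longrightarrow> nat (L q g (int k) + c q) \<le> nat (L q v (int n) + c q)"
        using f D(1) fgk by auto
      have "(\<lambda>j. v j - g j, n - k) \<in> Hom"
      proof -
        have "L q (\<lambda>j. v j - g j) (int (n - k)) \<ge> 0" if "q \<in> Q" for q
        proof -
          have "L q v (int n) + c q \<ge> 0" "L q g (int k) + c q \<ge> 0" using v gk(1) that unfolding Sol_def by auto
          then show ?thesis using gk(3)[OF that] gk(2) Ldiff[of q v g "int n" "int k"] by (simp add: of_nat_diff)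
        qed
        then show ?thesis unfolding Hom_def by simp
      qed
      then have "size (\<lambda>j. v j - g j) \<le> C * int (n - k)" by (rule hom)
      also have "\<dots> \<le> C * int n" using C0 by (intro mult_left_mono) auto
      finally have "size v \<le> B + C * int n" using tri[of v g] B[OF f(1)] fgk by simp
      also have "\<dots> \<le> (B + C) * (int n + 1)" using B0 C0 by (simp add: algebra_simps)
      finally show ?thesis .
    qed
    then show ?thesis unfolding Sol_def size_def by auto
  qed
qed

lemma int_binom_nonzero_iff: "int_binom a b \<noteq> 0 \<longleftrightarrow> 0 \<le> b \<and> b \<le> a \<or> a = -1 \<and> b = 0"
  by (auto simp: int_binom_def zero_less_binomial_iff nat_le_iff)

lemma Ball_Times: "(\<forall>q\<in>I \<times> J. P q) \<longleftrightarrow> (\<forall>i\<in>I. \<forall>j\<in>J. P (i, j))"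
  by blast

text \<open>A binomial is nonzero on the cone \<open>0 \<le> B \<le> A\<close> and at the point
  \<open>A = -1\<close>, \<open>B = 0\<close>. Once the set \<open>Z\<close> of indices at the
  exceptional point is fixed, the support is given by linear inequalities, so the bound holds for
  each of the finitely many \<open>Z\<close>.\<close>

lemma support_bound:
  fixes r d :: nat and a b :: "nat \<Rightarrow> nat \<Rightarrow> int" and a' b' a'' b'' :: "nat \<Rightarrow> int"
  defines "A \<equiv> \<lambda>i (v::nat \<Rightarrow> int) n. (\<Sum>j=1..d. a i j * v j) + a' i * int n + a'' i"
    and "B \<equiv> \<lambda>i (v::nat \<Rightarrow> int) n. (\<Sum>j=1..d. b i j * v j) + b' i * int n + b'' i"
  assumes fin: "\<And>n. finite {v \<in> int_vectors d. (\<Prod>i=1..r. int_binom (A i v n) (B i v n)) \<noteq> 0}"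
  shows "\<exists>K. \<forall>n v. (\<Prod>i=1..r. int_binom (A i v n) (B i v n)) \<noteq> 0 \<longrightarrow>
    (\<Sum>j=1..d. \<bar>v j\<bar>) + (\<Sum>i=1..r. \<bar>A i v n\<bar>) \<le> K * (int n + 1)"
proof -
  have nz: "(\<Prod>i=1..r. int_binom (A i v n) (B i v n)) \<noteq> 0 \<longleftrightarrow>
      (\<forall>i\<in>{1..r}. 0 \<le> B i v n \<and> B i v n \<le> A i v n \<or> A i v n = -1 \<and> B i v n = 0)" for v n
    by (simp add: int_binom_nonzero_iff[symmetric])
  \<comment> \<open>Four inequalities per index. For \<open>i \<in> Z\<close> the two equations
    become \<open>x + 1 \<ge> 0\<close>, \<open>- x - 1 \<ge> 0\<close>, \<open>y \<ge> 0\<close>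
    and \<open>- y \<ge> 0\<close>, with the constants supplied separately; otherwise they are
    \<open>y \<ge> 0\<close> and three copies of \<open>x - y \<ge> 0\<close>.\<close>
  define pick where "pick = (\<lambda>(Z::nat set) (i::nat, t::nat) (x::int) (y::int). if i \<in> Z
      then (if t = 0 then x else if t = 1 then - x else if t = 2 then y else - y)
      else (if t = 0 then y else x - y))"
  let ?Q = "{1..r} \<times> {..<4::nat}"
  have pick: "(\<Sum>j=1..d. pick Z q (a (fst q) j) (b (fst q) j) * v j) + pick Z q (a' (fst q)) (b' (fst q)) * int n +
      (pick Z q (a'' (fst q)) (b'' (fst q)) + (if fst q \<in> Z \<and> snd q = 0 then 1 else if fst q \<in> Z \<and> snd q = 1 then - 1 else 0)) =
      pick Z q (A (fst q) v n) (B (fst q) v n) + (if fst q \<in> Z \<and> snd q = 0 then 1 else if fst q \<in> Z \<and> snd q = 1 then - 1 else 0)" for Z q v n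
    unfolding A_def B_def pick_def
    by (cases q) (auto simp: sum_negf sum_subtractf algebra_simps)
  have sys: "(\<forall>q\<in>?Q. pick Z q (A (fst q) v n) (B (fst q) v n) + (if fst q \<in> Z \<and> snd q = 0 then 1 else if fst q \<in> Z \<and> snd q = 1 then - 1 else 0) \<ge> 0) \<longleftrightarrow>
      (\<forall>i\<in>{1..r}. if i \<in> Z then A i v n = -1 \<and> B i v n = 0 else 0 \<le> B i v n \<and> B i v n \<le> A i v n)" for Z v n
  proof -
    have "(\<forall>t\<in>{..<4::nat}. pick Z (i, t) x y + (if i \<in> Z \<and> t = 0 then 1 else if i \<in> Z \<and> t = 1 then - 1 else 0) \<ge> 0) \<longleftrightarrow>
        (if i \<in> Z then x = -1 \<and> y = 0 else 0 \<le> y \<and> y \<le> x)" for i :: nat and x y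
    proof -
      have 4: "{..<4::nat} = {0, 1, 2, 3}" by auto
      show ?thesis unfolding 4 pick_def by (cases "i \<in> Z") (simp_all, linarith?)
    qed
    then have "(\<forall>i\<in>{1..r}. \<forall>t\<in>{..<4::nat}. pick Z (i, t) (A i v n) (B i v n) + (if i \<in> Z \<and> t = 0 then 1 else if i \<in> Z \<and> t = 1 then - 1 else 0) \<ge> 0) \<longleftrightarrow>
      (\<forall>i\<in>{1..r}. if i \<in> Z then A i v n = -1 \<and> B i v n = 0 else 0 \<le> B i v n \<and> B i v n \<le> A i v n)"
      by (simp only:)
    then show ?thesis unfolding Ball_Times fst_conv snd_conv .
  qed
  have "\<exists>C. \<forall>n v. (\<forall>i\<in>{1..r}. if i \<in> Z then A i v n = -1 \<and> B i v n = 0 else 0 \<le> B i v n \<and> B i v n \<le> A i v n) \<longrightarrow>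
      (\<Sum>j=1..d. \<bar>v j\<bar>) \<le> C * (int n + 1)" for Z
  proof -
    let ?l = "\<lambda>q j. pick Z q (a (fst q) j) (b (fst q) j)" and ?b = "\<lambda>q. pick Z q (a' (fst q)) (b' (fst q))"
      and ?c = "\<lambda>q. pick Z q (a'' (fst q)) (b'' (fst q)) + (if fst q \<in> Z \<and> snd q = 0 then 1 else if fst q \<in> Z \<and> snd q = 1 then - 1 else 0)"
    have eq: "(\<forall>q\<in>?Q. (\<Sum>j=1..d. ?l q j * v j) + ?b q * int n + ?c q \<ge> 0) \<longleftrightarrow>
        (\<forall>i\<in>{1..r}. if i \<in> Z then A i v n = -1 \<and> B i v n = 0 else 0 \<le> B i v n \<and> B i v n \<le> A i v n)" for v n
      unfolding pick sys ..
    have "finite {v \<in> {1..d} \<rightarrow>\<^sub>E UNIV. \<forall>q\<in>?Q. (\<Sum>j=1..d. ?l q j * v j) + ?b q * int n + ?c q \<ge> 0}" for n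
    proof (rule finite_subset[OF _ fin[of n]])
      show "{v \<in> {1..d} \<rightarrow>\<^sub>E UNIV. \<forall>q\<in>?Q. (\<Sum>j=1..d. ?l q j * v j) + ?b q * int n + ?c q \<ge> 0} \<subseteq>
          {v \<in> int_vectors d. (\<Prod>i=1..r. int_binom (A i v n) (B i v n)) \<noteq> 0}"
        unfolding eq nz int_vectors_def by (auto split: if_splits)
    qed
    then have "\<exists>C. \<forall>n v. (\<forall>q\<in>?Q. (\<Sum>j=1..d. ?l q j * v j) + ?b q * int n + ?c q \<ge> 0) \<longrightarrow> (\<Sum>j=1..d. \<bar>v j\<bar>) \<le> C * (int n + 1)"
      by (intro linear_solutions_bound) auto
    then show ?thesis unfolding eq .
  qed
  then obtain C where C: "\<And>Z n v. (\<forall>i\<in>{1..r}. if i \<in> Z then A i v n = -1 \<and> B i v n = 0 else 0 \<le> B i v n \<and> B i v n \<le> A i v n) \<Longrightarrow>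
      (\<Sum>j=1..d. \<bar>v j\<bar>) \<le> C Z * (int n + 1)" by metis
  define M where "M = (\<Sum>Z\<in>Pow {1..r}. \<bar>C Z\<bar>)"
  have M0: "M \<ge> 0" unfolding M_def by (intro sum_nonneg) auto
  have vb: "(\<Sum>j=1..d. \<bar>v j\<bar>) \<le> M * (int n + 1)" if "(\<Prod>i=1..r. int_binom (A i v n) (B i v n)) \<noteq> 0" for v n
  proof -
    let ?Z = "{i \<in> {1..r}. A i v n = -1 \<and> B i v n = 0}"
    have "(\<Sum>j=1..d. \<bar>v j\<bar>) \<le> C ?Z * (int n + 1)" using that unfolding nz by (intro C) auto
    also have "C ?Z \<le> \<bar>C ?Z\<bar>" by simp
    also have "\<bar>C ?Z\<bar> \<le> M" unfolding M_def by (intro member_le_sum) auto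
    finally show ?thesis by (simp add: mult_right_mono)
  qed
  define S where "S = (\<lambda>i. \<Sum>j=1..d. \<bar>a i j\<bar>)"
  have Ab: "\<bar>A i v n\<bar> \<le> (S i * M + \<bar>a' i\<bar> + \<bar>a'' i\<bar>) * (int n + 1)" if "(\<Prod>i=1..r. int_binom (A i v n) (B i v n)) \<noteq> 0" for i v n
  proof -
    have S0: "S i \<ge> 0" unfolding S_def by (intro sum_nonneg) auto
    have "\<bar>a i j * v j\<bar> \<le> S i * \<bar>v j\<bar>" if "j \<in> {1..d}" for j
      unfolding abs_mult S_def using that by (intro mult_right_mono member_le_sum) auto
    then have "(\<Sum>j=1..d. \<bar>a i j * v j\<bar>) \<le> (\<Sum>j=1..d. S i * \<bar>v j\<bar>)" by (intro sum_mono) auto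
    also have "\<dots> = S i * (\<Sum>j=1..d. \<bar>v j\<bar>)" by (simp add: sum_distrib_left)
    also have "\<dots> \<le> S i * (M * (int n + 1))" using vb[OF that] S0 by (rule mult_left_mono)
    finally have "\<bar>\<Sum>j=1..d. a i j * v j\<bar> \<le> S i * (M * (int n + 1))" by (rule order_trans[OF sum_abs])
    moreover have "\<bar>a' i * int n\<bar> \<le> \<bar>a' i\<bar> * (int n + 1)" unfolding abs_mult by (intro mult_left_mono) auto
    moreover have "\<bar>a'' i\<bar> \<le> \<bar>a'' i\<bar> * (int n + 1)" by (simp add: mult_le_cancel_left1)
    ultimately have "\<bar>A i v n\<bar> \<le> S i * (M * (int n + 1)) + \<bar>a' i\<bar> * (int n + 1) + \<bar>a'' i\<bar> * (int n + 1)"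
      unfolding A_def by linarith
    also have "\<dots> = (S i * M + \<bar>a' i\<bar> + \<bar>a'' i\<bar>) * (int n + 1)" by (simp only: distrib_right mult.assoc)
    finally show ?thesis .
  qed
  show ?thesis
  proof (intro exI allI impI)
    fix n v assume nz: "(\<Prod>i=1..r. int_binom (A i v n) (B i v n)) \<noteq> 0"
    have "(\<Sum>i=1..r. \<bar>A i v n\<bar>) \<le> (\<Sum>i=1..r. (S i * M + \<bar>a' i\<bar> + \<bar>a'' i\<bar>) * (int n + 1))"
      using Ab[OF nz] by (intro sum_mono) auto
    then show "(\<Sum>j=1..d. \<bar>v j\<bar>) + (\<Sum>i=1..r. \<bar>A i v n\<bar>) \<le> (M + (\<Sum>i=1..r. S i * M + \<bar>a' i\<bar> + \<bar>a'' i\<bar>)) * (int n + 1)"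
      using vb[OF nz] by (simp add: distrib_right sum_distrib_right)
  qed
qed

text \<open>A new real only has to avoid the countably many values that satisfy a relation with the
  reals found so far.\<close>

lemma independent_reals:
  assumes "finite I"
  shows "\<exists>g::'i \<Rightarrow> real. \<forall>(c::'i \<Rightarrow> int) c0. of_int c0 + (\<Sum>i\<in>I. of_int (c i) * g i) = 0 \<longrightarrow> c0 = 0 \<and> (\<forall>i\<in>I. c i = 0)"
  using assms
proof (induction I rule: finite_induct)
  case (insert j I)
  obtain g :: "'i \<Rightarrow> real" where g: "\<forall>(c::'i \<Rightarrow> int) c0. of_int c0 + (\<Sum>i\<in>I. of_int (c i) * g i) = 0 \<longrightarrow> c0 = 0 \<and> (\<forall>i\<in>I. c i = 0)"
    using insert.IH by (rule exE)
  let ?D = "UNIV \<times> UNIV \<times> (I \<rightarrow>\<^sub>E (UNIV :: int set))"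
  let ?f = "\<lambda>(q::int, c0::int, c). - (of_int c0 + (\<Sum>i\<in>I. of_int (c i) * g i)) / of_int q"
  define S where "S = ?f ` ?D"
  have "countable S"
    unfolding S_def using insert.hyps by (intro countable_image countable_SIGMA countable_PiE) auto
  then have "S \<noteq> UNIV" using uncountable_UNIV_real by metis
  then obtain x where x: "x \<notin> S" by blast
  let ?g = "g(j := x)"
  have "c0 = 0 \<and> (\<forall>i\<in>insert j I. c i = 0)" if z: "of_int c0 + (\<Sum>i\<in>insert j I. of_int (c i) * ?g i) = 0" for c :: "'i \<Rightarrow> int" and c0
  proof -
    have "(\<Sum>i\<in>I. of_int (c i) * ?g i) = (\<Sum>i\<in>I. of_int (c i) * g i)" using insert.hyps by (intro sum.cong) auto
    then have z': "of_int c0 + (of_int (c j) * x + (\<Sum>i\<in>I. of_int (c i) * g i)) = 0" using z insert.hyps by simp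
    have "c j = 0"
    proof (rule ccontr)
      assume "c j \<noteq> 0"
      then have "x = ?f (c j, c0, restrict c I)" using z' by (simp add: field_simps)
      moreover have "(c j, c0, restrict c I) \<in> ?D" by simp
      ultimately have "x \<in> S" unfolding S_def by (rule image_eqI)
      then show False using x by contradiction
    qed
    then have "of_int c0 + (\<Sum>i\<in>I. of_int (c i) * g i) = 0" using z' by simp
    then have "c0 = 0 \<and> (\<forall>i\<in>I. c i = 0)" by (rule g[rule_format])
    then show ?thesis using \<open>c j = 0\<close> by blast
  qed
  then show ?case by (intro exI[of _ ?g] allI impI)
qed simp

lemma walk_unit [simp]: "walk f g (u :: unit) es v"
  by (induction es arbitrary: u) auto

text \<open>Words are closed walks in a graph with a single vertex; all edges leave the root, so
  there are no last exits, and \<open>card_walks_with\<close> yields the binomial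
  coefficient.\<close>

lemma card_two_letter_words:
  fixes x y :: 'a
  assumes "x \<noteq> y"
  shows "card {w \<in> lists {x, y}. count_list w x = p \<and> count_list w y = q} = (p + q) choose q"
proof -
  let ?E = "{x, y}" and ?u = "\<lambda>_::'a. ()"
  let ?c = "\<lambda>z. if z = x then p else q"
  have le: "last_exits ?u () es = {}" for es by (induction es) auto
  have "{w \<in> lists {x, y}. count_list w x = p \<and> count_list w y = q} = walks_with ?E ?u ?u () () ?c {}"
    using assms unfolding walks_with_def le by auto
  moreover have "eulerian ?E ?u ?u () () ?c {}" unfolding eulerian_def by (auto intro: in_tree.empty)
  moreover have "exit_orders ?E ?u ?c = fact (p + q) / (fact p * fact q)"
  proof -
    have "{e \<in> ?E. () = v} = ?E" for v by auto
    then show ?thesis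
      using assms unfolding exit_orders_def out_deg_def by (simp only: image_constant_conv) simp
  qed
  moreover have "real ((p + q) choose q) = fact (p + q) / (fact p * fact q)" by (subst binomial_fact) (auto simp: mult.commute)
  ultimately have "real (card {w \<in> lists {x, y}. count_list w x = p \<and> count_list w y = q}) = real ((p + q) choose q)"
    using card_walks_with[of ?E ?u ?u "()" "()" ?c "{}"] by simp
  then show ?thesis by simp
qed

section \<open>Chain graphs\<close>

text \<open>A walk in the chain graph passes levels \<open>1, \<dots>, m\<close> one after the other; at level \<open>k\<close> it enters
  one of two states \<open>s\<close>, with weight \<open>\<alpha> k s\<close>, and then runs through loops with weights in \<open>X k s\<close>.
  Levels with \<open>s \<notin> S k\<close> lack the state \<open>s\<close>.\<close>

type_synonym edge = "nat \<times> real \<times> nat"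

text \<open>Levels start at 1, which leaves 0 free for the base vertex.\<close>

definition st :: "nat \<Rightarrow> bool \<Rightarrow> nat" where
  "st k s = 2 * k + of_bool s"

lemma st_inj: "st k s = st k' s' \<longleftrightarrow> k = k' \<and> s = s'"
  by (cases s; cases s') (auto simp: st_def, presburger+)

lemma st_pos: "k \<ge> 1 \<Longrightarrow> st k s \<noteq> 0"
  by (simp add: st_def)

locale chain_graph =
  fixes m :: nat and S :: "nat \<Rightarrow> bool set" and \<alpha> :: "nat \<Rightarrow> bool \<Rightarrow> real" and X :: "nat \<Rightarrow> bool \<Rightarrow> real set"
  assumes m: "m \<ge> 1" and X: "\<And>k s. finite (X k s)"
begin

definition prev :: "nat \<Rightarrow> nat set" where
  "prev k = (if k = 1 then {0} else st (k - 1) ` S (k - 1))"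

definition edges :: "edge set" where
  "edges = (\<Union>k\<in>{1..m}. \<Union>s\<in>S k. (\<lambda>u. (u, \<alpha> k s, st k s)) ` prev k \<union> (\<lambda>x. (st k s, x, st k s)) ` X k s) \<union>
     (\<lambda>s. (st m s, 0, 0)) ` S m"

abbreviation src :: "edge \<Rightarrow> nat" where "src e \<equiv> fst e"
abbreviation tgt :: "edge \<Rightarrow> nat" where "tgt e \<equiv> snd (snd e)"
abbreviation wt :: "edge \<Rightarrow> real" where "wt e \<equiv> fst (snd e)"

lemma finite_edges: "finite edges"
  unfolding edges_def prev_def using X by (auto intro: finite_subset[OF subset_UNIV])

lemma edge_intros:
  "k \<in> {1..m} \<Longrightarrow> s \<in> S k \<Longrightarrow> u \<in> prev k \<Longrightarrow> (u, \<alpha> k s, st k s) \<in> edges"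
  "k \<in> {1..m} \<Longrightarrow> s \<in> S k \<Longrightarrow> x \<in> X k s \<Longrightarrow> (st k s, x, st k s) \<in> edges"
  "s \<in> S m \<Longrightarrow> (st m s, 0, 0) \<in> edges"
  unfolding edges_def by blast+

lemma edge_cases:
  assumes "e \<in> edges"
  obtains (enter) k s u where "e = (u, \<alpha> k s, st k s)" "u \<in> prev k" "k \<in> {1..m}" "s \<in> S k"
    | (loop) k s x where "e = (st k s, x, st k s)" "x \<in> X k s" "k \<in> {1..m}"
    | (exit) s where "e = (st m s, 0, 0)" "s \<in> S m"
  using assms unfolding edges_def by blast

text \<open>What a walk may do on level \<open>k\<close>: the state that it enters and the weights
  of the loops that it then runs through.\<close>

definition block :: "nat \<Rightarrow> (bool \<times> real list) set" where
  "block k = {(s, \<omega>). s \<in> S k \<and> \<omega> \<in> lists (X k s)}"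

fun path :: "nat \<Rightarrow> nat \<Rightarrow> (bool \<times> real list) list \<Rightarrow> edge list" where
  "path u k [] = [(u, 0, 0)]"
| "path u k ((s, \<omega>) # bs) = (u, \<alpha> k s, st k s) # map (\<lambda>x. (st k s, x, st k s)) \<omega> @ path (st k s) (Suc k) bs"

fun blocks :: "nat \<Rightarrow> (bool \<times> real list) list \<Rightarrow> bool" where
  "blocks k [] \<longleftrightarrow> k = Suc m"
| "blocks k (b # bs) \<longleftrightarrow> k \<le> m \<and> b \<in> block k \<and> blocks (Suc k) bs"

lemma walk_append:
  "walk f g u (es @ fs) v \<longleftrightarrow> (\<exists>w. walk f g u es w \<and> walk f g w fs v)"
  by (induction es arbitrary: u) auto

lemma walk_loops: "walk src tgt u (map (\<lambda>x. (u, x, u)) \<omega>) w \<longleftrightarrow> u = w"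
  by (induction \<omega>) auto

lemma path_walk:
  assumes "blocks k bs" "u \<in> prev k" "1 \<le> k"
  shows "path u k bs \<in> lists edges" "walk src tgt u (path u k bs) 0"
    "\<forall>e\<in>set (tl (path u k bs)). src e \<noteq> 0"
  using assms
proof (induction bs arbitrary: u k)
  case Nil
  {
    case 1
    then show ?case using m unfolding edges_def prev_def by auto
  next
    case 2
    then show ?case by simp
  next
    case 3
    then show ?case by simp
  }
next
  case (Cons b bs)
  obtain s \<omega> where b: "b = (s, \<omega>)" by fastforce
  {
    case 1
    then have k: "k \<le> m" "s \<in> S k" "\<omega> \<in> lists (X k s)" "blocks (Suc k) bs" unfolding b by (auto simp: block_def)
    then have "path (st k s) (Suc k) bs \<in> lists edges" using Cons.IH(1)[of "Suc k" "st k s"] 1 by (auto simp: prev_def)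
    moreover have "k \<in> {1..m}" using k(1) 1 by simp
    ultimately show ?case using k 1 edge_intros(1,2) unfolding b by auto
  next
    case 2
    then have "blocks (Suc k) bs" "st k s \<in> prev (Suc k)" unfolding b by (auto simp: block_def prev_def)
    then show ?case using Cons.IH(2)[of "Suc k" "st k s"] unfolding b by (auto simp: walk_append walk_loops)
  next
    case 3
    then have *: "blocks (Suc k) bs" "st k s \<in> prev (Suc k)" unfolding b by (auto simp: block_def prev_def)
    have "src (hd (path (st k s) (Suc k) bs)) = st k s" by (cases bs) auto
    then have "\<forall>e\<in>set (path (st k s) (Suc k) bs). src e \<noteq> 0"
      using Cons.IH(3)[OF *] st_pos[OF 3(3)] by (cases "path (st k s) (Suc k) bs") auto
    then show ?case using st_pos[OF 3(3)] unfolding b by auto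
  }
qed

lemma walk_from_state:
  assumes "es \<in> lists edges" "walk src tgt (st k s) es 0" "\<forall>e\<in>set es. src e \<noteq> 0" "1 \<le> k" "k \<le> m" "s \<in> S k"
  shows "\<exists>\<omega> bs. \<omega> \<in> lists (X k s) \<and> blocks (Suc k) bs \<and>
    es = map (\<lambda>x. (st k s, x, st k s)) \<omega> @ path (st k s) (Suc k) bs"
  using assms
proof (induction es arbitrary: k s rule: list.induct)
  case Nil
  then show ?case using st_pos by simp
next
  case (Cons e es)
  have e: "e \<in> edges" "src e = st k s" and es: "es \<in> lists edges" "walk src tgt (tgt e) es 0" "\<forall>e\<in>set es. src e \<noteq> 0"
    using Cons.prems by auto
  from e(1) show ?case
  proof (cases rule: edge_cases)
    case (enter k' s' u)
    then have "k' \<noteq> 1" using e(2) Cons.prems(4) st_pos[of k s] by (auto simp: prev_def)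
    then have k': "k' = Suc k" "u = st k s" using enter e(2) by (auto simp: prev_def st_inj)
    then obtain \<omega> bs where "\<omega> \<in> lists (X k' s')" "blocks (Suc k') bs"
        "es = map (\<lambda>x. (st k' s', x, st k' s')) \<omega> @ path (st k' s') (Suc k') bs"
      using Cons.IH[of k' s'] es enter by auto
    then show ?thesis using enter k'
      by (intro exI[of _ "[]"] exI[of _ "(s', \<omega>) # bs"]) (auto simp: block_def)
  next
    case (loop k' s' x)
    then have k': "k' = k" "s' = s" using e(2) by (auto simp: st_inj)
    then obtain \<omega> bs where "\<omega> \<in> lists (X k s)" "blocks (Suc k) bs"
        "es = map (\<lambda>x. (st k s, x, st k s)) \<omega> @ path (st k s) (Suc k) bs"
      using Cons.IH[of k s] es loop Cons.prems(4-) by auto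
    then show ?thesis using loop k' by (intro exI[of _ "x # \<omega>"] exI[of _ bs]) auto
  next
    case (exit s')
    then have k': "k = m" "s' = s" using e(2) by (auto simp: st_inj)
    have "es = []" using es exit by (cases es) auto
    then show ?thesis using exit k' by (intro exI[of _ "[]"]) auto
  qed
qed

text \<open>An edge raises the level by 1, stays in its state, or returns from level
  \<open>m\<close> to 0. A closed walk with a single edge out of 0 is therefore one round through
  all levels.\<close>

lemma closed_walks_eq:
  "{es \<in> lists edges. walk src tgt 0 es 0 \<and> length (filter (\<lambda>e. src e = 0) es) = 1} = path 0 1 ` {bs. blocks 1 bs}"
proof (intro set_eqI iffI)
  fix es assume "es \<in> path 0 1 ` {bs. blocks 1 bs}"
  then obtain bs where bs: "es = path 0 1 bs" "blocks 1 bs" by blast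
  have "0 \<in> prev 1" by (simp add: prev_def)
  note p = path_walk[OF bs(2) this order.refl]
  have "src (hd es) = 0" "es \<noteq> []" unfolding bs(1) by (cases bs; auto)+
  then have "filter (\<lambda>e. src e = 0) es = [hd es]" using p(3) unfolding bs(1)[symmetric] by (cases es) (auto simp: filter_empty_conv)
  then show "es \<in> {es \<in> lists edges. walk src tgt 0 es 0 \<and> length (filter (\<lambda>e. src e = 0) es) = 1}"
    using p bs(1) by simp
next
  fix es assume es: "es \<in> {es \<in> lists edges. walk src tgt 0 es 0 \<and> length (filter (\<lambda>e. src e = 0) es) = 1}"
  then obtain e es' where e: "es = e # es'" by (cases es) auto
  then have e': "e \<in> edges" "src e = 0" "es' \<in> lists edges" "walk src tgt (tgt e) es' 0" using es by auto
  then have no: "\<forall>e\<in>set es'. src e \<noteq> 0" using es e by (auto simp: filter_empty_conv)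
  obtain s where s: "e = (0, \<alpha> 1 s, st 1 s)" "s \<in> S 1"
    using e'(1)
  proof (cases rule: edge_cases)
    case (enter k s u)
    have "k = 1"
    proof (rule ccontr)
      assume "k \<noteq> 1"
      then have "u \<in> st (k - 1) ` S (k - 1)" "1 \<le> k - 1" using enter by (auto simp: prev_def)
      then have "u \<noteq> 0" using st_pos[of "k - 1"] by auto
      then show False using enter e'(2) by simp
    qed
    then show thesis using enter e'(2) that by auto
  next
    case (loop k s x)
    then show thesis using e'(2) st_pos[of k s] by auto
  next
    case (exit s)
    then show thesis using e'(2) st_pos[OF m, of s] by auto
  qed
  then obtain \<omega> bs where "\<omega> \<in> lists (X 1 s)" "blocks (Suc 1) bs" "es' = map (\<lambda>x. (st 1 s, x, st 1 s)) \<omega> @ path (st 1 s) (Suc 1) bs"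
    using walk_from_state[of es' 1 s] e' no m by auto
  then show "es \<in> path 0 1 ` {bs. blocks 1 bs}"
    using s e m by (intro image_eqI[of _ _ "(s, \<omega>) # bs"]) (auto simp: block_def)
qed

lemma loops_append_inj:
  assumes "map (\<lambda>x. (u, x, u)) \<omega> @ e # r = map (\<lambda>x. (u, x, u)) \<omega>' @ e' # r'" "snd (snd e) \<noteq> u" "snd (snd e') \<noteq> u"
  shows "\<omega> = \<omega>' \<and> e = e' \<and> r = r'"
  using assms
proof (induction \<omega> arbitrary: \<omega>')
  case Nil
  then show ?case by (cases \<omega>') auto
next
  case (Cons x \<omega>)
  then show ?case by (cases \<omega>') auto
qed

lemma path_inj:
  assumes "blocks k bs" "blocks k cs" "path u k bs = path u k cs" "1 \<le> k"
  shows "bs = cs"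
  using assms
proof (induction bs arbitrary: u k cs)
  case Nil
  then show ?case by (cases cs) auto
next
  case (Cons b bs)
  obtain s \<omega> where b: "b = (s, \<omega>)" by fastforce
  obtain c cs' where cs: "cs = c # cs'" using Cons.prems(1,2) by (cases cs) auto
  obtain s' \<omega>' where c: "c = (s', \<omega>')" by fastforce
  have s: "s' = s" using Cons.prems(3) unfolding b c cs by (auto simp: st_inj)
  have eq: "map (\<lambda>x. (st k s, x, st k s)) \<omega> @ path (st k s) (Suc k) bs = map (\<lambda>x. (st k s, x, st k s)) \<omega>' @ path (st k s) (Suc k) cs'"
    using Cons.prems(3) unfolding b c cs s by simp
  \<comment> \<open>The edge after the loops leads into another state, so the end of the loop word
    can be recognized.\<close>
  have step: "\<exists>e r. path (st k s) (Suc k) ds = e # r \<and> snd (snd e) \<noteq> st k s" for ds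
    using st_pos[OF Cons.prems(4), of s] by (cases ds) (auto simp: st_inj)
  obtain e r where e: "path (st k s) (Suc k) bs = e # r" "snd (snd e) \<noteq> st k s" using step by blast
  obtain e' r' where e': "path (st k s) (Suc k) cs' = e' # r'" "snd (snd e') \<noteq> st k s" using step by blast
  have "\<omega> = \<omega>' \<and> e = e' \<and> r = r'" using eq e e' by (intro loops_append_inj) simp_all
  moreover from this have "bs = cs'"
    using Cons.IH[of "Suc k" cs' "st k s"] e e' Cons.prems unfolding cs by simp
  ultimately show ?case using b c cs s by simp
qed

definition block_weight :: "nat \<Rightarrow> bool \<times> real list \<Rightarrow> real" where
  "block_weight k b = \<alpha> k (fst b) + sum_list (snd b)"

lemma path_map:
  assumes "k \<le> Suc m"
  shows "sum_list (map wt (path u k (map \<beta> [k..<Suc m]))) = (\<Sum>i=k..m. block_weight i (\<beta> i))"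
    "length (path u k (map \<beta> [k..<Suc m])) = 1 + (\<Sum>i=k..m. 1 + length (snd (\<beta> i)))"
  using assms
proof (induction "Suc m - k" arbitrary: k u)
  case 0
  {
    case 1
    then show ?case using 0 by simp
  next
    case 2
    then show ?case using 0 by simp
  }
next
  case (Suc j)
  obtain s \<omega> where b: "\<beta> k = (s, \<omega>)" by fastforce
  have k: "k \<le> m" "j = Suc m - Suc k" using Suc.hyps(3) by auto
  then have upt: "[k..<Suc m] = k # [Suc k..<Suc m]" by (simp add: upt_conv_Cons del: upt_Suc)
  have sum: "(\<Sum>i=k..m. f i) = f k + (\<Sum>i=Suc k..m. f i)" for f :: "nat \<Rightarrow> 'c::comm_monoid_add"
    using k(1) by (rule sum.atLeast_Suc_atMost)
  {
    case 1
    show ?case unfolding upt sum using Suc.hyps(1)[OF k(2), of "st k s"] k(1) b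
      by (simp add: block_weight_def o_def del: upt_Suc)
  next
    case 2
    show ?case unfolding upt sum using Suc.hyps(2)[OF k(2), of "st k s"] k(1) b
      by (simp del: upt_Suc)
  }
qed

lemma blocks_iff: "blocks k bs \<longleftrightarrow> k + length bs = Suc m \<and> (\<forall>i<length bs. bs ! i \<in> block (k + i))"
proof (induction bs arbitrary: k)
  case (Cons b bs)
  then show ?case by (auto simp: All_less_Suc2)
qed auto

lemma bij_blocks:
  "bij_betw (\<lambda>\<beta>. map \<beta> [1..<Suc m]) (PiE {1..m} block) {bs. blocks 1 bs}"
proof (rule bij_betw_byWitness[where f' = "\<lambda>bs. restrict (\<lambda>i. bs ! (i - 1)) {1..m}"])
  show "\<forall>\<beta>\<in>PiE {1..m} block. restrict (\<lambda>i. map \<beta> [1..<Suc m] ! (i - 1)) {1..m} = \<beta>"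
  proof
    fix \<beta> assume \<beta>: "\<beta> \<in> PiE {1..m} block"
    show "restrict (\<lambda>i. map \<beta> [1..<Suc m] ! (i - 1)) {1..m} = \<beta>"
    proof
      fix i show "restrict (\<lambda>i. map \<beta> [1..<Suc m] ! (i - 1)) {1..m} i = \<beta> i"
        using \<beta> by (cases "i \<in> {1..m}") (auto simp: PiE_def extensional_def nth_append simp del: upt_Suc)
    qed
  qed
  show "\<forall>bs\<in>{bs. blocks 1 bs}. map (restrict (\<lambda>i. bs ! (i - 1)) {1..m}) [1..<Suc m] = bs"
    by (auto simp: blocks_iff intro!: nth_equalityI simp del: upt_Suc)
  show "(\<lambda>\<beta>. map \<beta> [1..<Suc m]) ` PiE {1..m} block \<subseteq> {bs. blocks 1 bs}"
    by (auto simp: blocks_iff PiE_def Pi_def simp del: upt_Suc)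
  show "(\<lambda>bs. restrict (\<lambda>i. bs ! (i - 1)) {1..m}) ` {bs. blocks 1 bs} \<subseteq> PiE {1..m} block"
  proof
    fix \<beta> assume "\<beta> \<in> (\<lambda>bs. restrict (\<lambda>i. bs ! (i - 1)) {1..m}) ` {bs. blocks 1 bs}"
    then obtain bs where bs: "\<beta> = restrict (\<lambda>i. bs ! (i - 1)) {1..m}" "blocks 1 bs" by blast
    have "\<beta> i \<in> block i" if i: "i \<in> {1..m}" for i
    proof -
      have "i - 1 < length bs" "1 + (i - 1) = i" using bs(2) i by (auto simp: blocks_iff)
      then have "bs ! (i - 1) \<in> block i" using bs(2) unfolding blocks_iff by metis
      then show ?thesis using bs(1) i by simp
    qed
    then show "\<beta> \<in> PiE {1..m} block" using bs(1) by auto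
  qed
qed

theorem card_closed_walks:
  "card {es \<in> lists edges. walk src tgt 0 es 0 \<and> length (filter (\<lambda>e. src e = 0) es) = 1 \<and>
      length es = M \<and> sum_list (map wt es) = z} =
    card {\<beta> \<in> PiE {1..m} block. 1 + (\<Sum>i=1..m. 1 + length (snd (\<beta> i))) = M \<and> (\<Sum>i=1..m. block_weight i (\<beta> i)) = z}"
    (is "card ?W = card ?B")
proof -
  let ?f = "\<lambda>\<beta>. path 0 1 (map \<beta> [1..<Suc m])"
  have inj: "inj_on ?f (PiE {1..m} block)"
  proof (rule inj_onI)
    fix \<beta> \<gamma> assume *: "\<beta> \<in> PiE {1..m} block" "\<gamma> \<in> PiE {1..m} block" "?f \<beta> = ?f \<gamma>"
    have "blocks 1 (map \<beta> [1..<Suc m])" "blocks 1 (map \<gamma> [1..<Suc m])"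
      using bij_betw_imp_surj_on[OF bij_blocks] *(1,2) by blast+
    then have "map \<beta> [1..<Suc m] = map \<gamma> [1..<Suc m]" using path_inj *(3) by blast
    then show "\<beta> = \<gamma>" using bij_betw_imp_inj_on[OF bij_blocks] *(1,2) by (meson inj_onD)
  qed
  have im: "{es \<in> lists edges. walk src tgt 0 es 0 \<and> length (filter (\<lambda>e. src e = 0) es) = 1} = ?f ` PiE {1..m} block"
    unfolding closed_walks_eq bij_betw_imp_surj_on[OF bij_blocks, symmetric] image_image ..
  have "?W = {es \<in> ?f ` PiE {1..m} block. length es = M \<and> sum_list (map wt es) = z}"
    unfolding im[symmetric] by blast
  also have "\<dots> = ?f ` ?B"
    using path_map[of 1 0] by (auto simp del: upt_Suc)
  finally have "?W = ?f ` ?B" .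
  moreover have "inj_on ?f ?B" using inj by (rule inj_on_subset) blast
  ultimately show ?thesis by (simp only: card_image)
qed

end

section \<open>Binomial multisums are tile counting functions\<close>

lemma sum_split_levels:
  fixes F :: "nat \<Rightarrow> 'a :: comm_monoid_add"
  shows "(\<Sum>i=1..r + d + 1. F i) = (\<Sum>i=1..r. F i) + (\<Sum>j=1..d. F (r + j)) + F (r + d + 1)"
proof -
  have "(\<Sum>i=1..r + d. F i) = (\<Sum>i=1..r. F i) + (\<Sum>j=1..d. F (r + j))"
    by (induction d) (simp_all add: add.assoc)
  then show ?thesis by simp
qed

text \<open>The assumption is rational independence of 1, \<open>\<eta>\<close> and all
  \<open>x i\<close>, \<open>y i\<close>. The coefficient of 1 will record the number of edges, that
  of \<open>\<eta>\<close> the number of rounds, and those of \<open>x i\<close> and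
  \<open>y i\<close> the letters of the words.\<close>

locale multisum =
  fixes r d :: nat and a b :: "nat \<Rightarrow> nat \<Rightarrow> int" and a' b' a'' b'' :: "nat \<Rightarrow> int"
    and \<eta> :: real and x y :: "nat \<Rightarrow> real"
  assumes independent: "\<And>c0 c1 c e. of_int c0 + of_int c1 * \<eta> + (\<Sum>i=1..r. of_int (c i) * x i + of_int (e i) * y i) = 0 \<Longrightarrow>
      c0 = 0 \<and> c1 = 0 \<and> (\<forall>i\<in>{1..r}. c i = 0 \<and> e i = 0)"
begin

definition comb :: "(nat \<Rightarrow> int) \<Rightarrow> (nat \<Rightarrow> int) \<Rightarrow> real" where
  "comb c e = (\<Sum>i=1..r. of_int (c i) * x i + of_int (e i) * y i)"

lemma comb_add: "comb (\<lambda>i. c i + c' i) (\<lambda>i. e i + e' i) = comb c e + comb c' e'"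
  unfolding comb_def sum.distrib[symmetric] by (intro sum.cong) (auto simp: algebra_simps)

lemma comb_scale: "comb (\<lambda>i. t * c i) (\<lambda>i. t * e i) = of_int t * comb c e"
  unfolding comb_def sum_distrib_left by (intro sum.cong) (auto simp: algebra_simps)

lemma comb_0: "comb (\<lambda>_. 0) (\<lambda>_. 0) = 0"
  by (simp add: comb_def)

lemma comb_sum: "comb (\<lambda>i. \<Sum>j\<in>J. t j * c i j) (\<lambda>i. \<Sum>j\<in>J. t j * e i j) = (\<Sum>j\<in>J. of_int (t j) * comb (\<lambda>i. c i j) (\<lambda>i. e i j))"
proof (cases "finite J")
  case True
  then show ?thesis by (induction J rule: finite_induct) (simp_all add: comb_0 comb_add comb_scale)
qed (simp add: comb_0)

lemma comb_unit: "i \<in> {1..r} \<Longrightarrow> comb (\<lambda>k. of_bool (k = i)) (\<lambda>_. 0) = x i"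
  "i \<in> {1..r} \<Longrightarrow> comb (\<lambda>_. 0) (\<lambda>k. of_bool (k = i)) = y i"
proof -
  have *: "(\<Sum>k=1..r. of_int (of_bool (k = i)) * f k) = f i" if "i \<in> {1..r}" for f :: "nat \<Rightarrow> real"
  proof -
    have "(\<Sum>k=1..r. of_int (of_bool (k = i)) * f k) = (\<Sum>k=1..r. if k = i then f k else 0)"
      by (intro sum.cong) auto
    then show ?thesis using that by simp
  qed
  show "i \<in> {1..r} \<Longrightarrow> comb (\<lambda>k. of_bool (k = i)) (\<lambda>_. 0) = x i"
    "i \<in> {1..r} \<Longrightarrow> comb (\<lambda>_. 0) (\<lambda>k. of_bool (k = i)) = y i"
    unfolding comb_def using *[of x] *[of y] by simp_all
qed

lemma comb_inj:
  assumes "of_int c0 + of_int c1 * \<eta> + comb c e = of_int c0' + of_int c1' * \<eta> + comb c' e'"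
  shows "c0 = c0' \<and> c1 = c1' \<and> (\<forall>i\<in>{1..r}. c i = c' i \<and> e i = e' i)"
proof -
  have "comb c e - comb c' e' = comb (\<lambda>i. c i - c' i) (\<lambda>i. e i - e' i)"
    unfolding comb_def sum_subtractf[symmetric] by (intro sum.cong) (auto simp: algebra_simps)
  then have "of_int (c0 - c0') + of_int (c1 - c1') * \<eta> + comb (\<lambda>i. c i - c' i) (\<lambda>i. e i - e' i) = 0"
    using assms by (simp add: algebra_simps)
  then have "c0 - c0' = 0 \<and> c1 - c1' = 0 \<and> (\<forall>i\<in>{1..r}. c i - c' i = 0 \<and> e i - e' i = 0)"
    unfolding comb_def by (rule independent)
  then show ?thesis unfolding right_minus_eq .
qed

lemma x_neq_y: assumes "i \<in> {1..r}" shows "x i \<noteq> y i"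
proof
  assume "x i = y i"
  then have "comb (\<lambda>k. of_bool (k = i)) (\<lambda>_. 0) = comb (\<lambda>_. 0) (\<lambda>k. of_bool (k = i))" using comb_unit assms by simp
  then have "of_int 0 + of_int 0 * \<eta> + comb (\<lambda>k. of_bool (k = i)) (\<lambda>_. 0) =
      of_int 0 + of_int 0 * \<eta> + comb (\<lambda>_. 0) (\<lambda>k. of_bool (k = i))" by simp
  from comb_inj[OF this] have "of_bool (i = i) = (0::int)" using assms by blast
  then show False by simp
qed

section \<open>Encoding vectors and words as rounds of a chain graph\<close>

definition upper :: "nat \<Rightarrow> (nat \<Rightarrow> int) \<Rightarrow> nat \<Rightarrow> int" where
  "upper i v n = (\<Sum>j=1..d. a i j * v j) + a' i * int n + a'' i"

definition lower :: "nat \<Rightarrow> (nat \<Rightarrow> int) \<Rightarrow> nat \<Rightarrow> int" where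
  "lower i v n = (\<Sum>j=1..d. b i j * v j) + b' i * int n + b'' i"

text \<open>The weight of one unit of \<open>v j\<close>, chosen to cancel the contribution of
  \<open>v j\<close> to the letter counts on all levels \<open>i \<le> r\<close>.\<close>

definition p :: "nat \<Rightarrow> real" where
  "p j = - comb (\<lambda>i. a i j - b i j) (\<lambda>i. b i j)"

definition slope :: real where "slope = comb (\<lambda>i. a' i - b' i) b'"

definition start :: real where "start = comb (\<lambda>i. a'' i - b'' i) b''"

text \<open>The total weight required of a round does not depend on the vector \<open>v\<close> that
  it encodes. This is why a single length condition can count the summands for all \<open>v\<close>
  at once.\<close>

lemma comb_upper_lower:
  "comb (\<lambda>i. upper i v n - lower i v n) (\<lambda>i. lower i v n) + (\<Sum>j=1..d. of_int (v j) * p j) = real n * slope + start"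
proof -
  have 1: "(\<lambda>i. upper i v n - lower i v n) = (\<lambda>i. ((\<Sum>j=1..d. v j * (a i j - b i j)) + int n * (a' i - b' i)) + (a'' i - b'' i))"
    unfolding upper_def lower_def by (auto simp: algebra_simps sum_subtractf)
  have 2: "(\<lambda>i. lower i v n) = (\<lambda>i. ((\<Sum>j=1..d. v j * b i j) + int n * b' i) + b'' i)"
    unfolding lower_def by (auto simp: algebra_simps)
  show ?thesis
    unfolding 1 unfolding 2 comb_add comb_sum comb_scale slope_def start_def p_def by (simp add: sum_negf)
qed

text \<open>Level \<open>i \<le> r\<close> spells a word whose letters \<open>x i\<close>, \<open>y i\<close> are counted by the \<open>i\<close>-th binomial
  coefficient, its second state being the exceptional value at \<open>(-1, 0)\<close>. Level \<open>r + j\<close> spells the integer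
  \<open>v j\<close> in unary, with the states for the two signs. The last level pads with letters of weight 0.\<close>

definition m :: nat where "m = r + d + 1"

definition states :: "nat \<Rightarrow> bool set" where
  "states k = (if k = m then {False} else UNIV)"

text \<open>The weight \<open>- x k\<close> stands for upper entry -1 over lower entry 0, that is,
  for -1 letters \<open>x k\<close> and no letter \<open>y k\<close>. Entering the negative state of
  a unary level already counts -1, so that 0 is represented only once.\<close>

definition \<alpha> :: "nat \<Rightarrow> bool \<Rightarrow> real" where
  "\<alpha> k s = (if s then (if k \<le> r then - x k else if k = m then 0 else - p (k - r)) else 0)"

definition X :: "nat \<Rightarrow> bool \<Rightarrow> real set" where
  "X k s = (if k \<le> r then (if s then {} else {x k, y k}) else if k = m then {0} else if s then {- p (k - r)} else {p (k - r)})"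

sublocale G: chain_graph m states \<alpha> X
  by unfold_locales (auto simp: m_def X_def)

definition xcount :: "nat \<Rightarrow> bool \<times> real list \<Rightarrow> int" where
  "xcount i u = (if fst u then - 1 else int (count_list (snd u) (x i)))"

definition ycount :: "nat \<Rightarrow> bool \<times> real list \<Rightarrow> int" where
  "ycount i u = (if fst u then 0 else int (count_list (snd u) (y i)))"

definition unary :: "bool \<times> real list \<Rightarrow> int" where
  "unary u = (if fst u then - 1 - int (length (snd u)) else int (length (snd u)))"

lemma sum_list_const: "\<omega> \<in> lists {q} \<Longrightarrow> sum_list \<omega> = real (length \<omega>) * q"
  by (induction \<omega>) (auto simp: algebra_simps)

lemma lists_singleton: "\<omega> \<in> lists {q} \<longleftrightarrow> \<omega> = replicate (length \<omega>) q"
  by (induction \<omega>) auto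

lemma block_word:
  assumes "i \<in> {1..r}" "u \<in> G.block i"
  shows "G.block_weight i u = of_int (xcount i u) * x i + of_int (ycount i u) * y i"
    "\<not> fst u \<Longrightarrow> int (length (snd u)) = xcount i u + ycount i u" "fst u \<Longrightarrow> snd u = []"
proof -
  obtain s \<omega> where u: "u = (s, \<omega>)" by fastforce
  have i: "i \<le> r" using assms(1) by simp
  show "fst u \<Longrightarrow> snd u = []" using assms(2) i unfolding u G.block_def X_def by auto
  have w: "s \<Longrightarrow> \<omega> = []" "\<not> s \<Longrightarrow> set \<omega> \<subseteq> {x i, y i}" using assms(2) i unfolding u G.block_def X_def by auto
  show "G.block_weight i u = of_int (xcount i u) * x i + of_int (ycount i u) * y i"
  proof (cases s)
    case True
    then show ?thesis using w i unfolding u G.block_weight_def xcount_def ycount_def \<alpha>_def by simp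
  next
    case False
    have "sum_list (map (\<lambda>z. z) \<omega>) = (\<Sum>z\<in>{x i, y i}. real (count_list \<omega> z) * z)"
      using w(2)[OF False] by (intro sum_list_count) auto
    then show ?thesis using False i x_neq_y[OF assms(1)]
      unfolding u G.block_weight_def xcount_def ycount_def \<alpha>_def by simp
  qed
  show "int (length (snd u)) = xcount i u + ycount i u" if "\<not> fst u"
  proof -
    have "sum (count_list \<omega>) {x i, y i} = length \<omega>"
      using w(2) that u by (intro sum_count_set) auto
    then show ?thesis using that x_neq_y[OF assms(1)] unfolding u xcount_def ycount_def by simp
  qed
qed

lemma block_unary:
  assumes "j \<in> {1..d}"
  shows "(s, \<omega>) \<in> G.block (r + j) \<longleftrightarrow> \<omega> \<in> lists {if s then - p j else p j}"
    "u \<in> G.block (r + j) \<Longrightarrow> G.block_weight (r + j) u = of_int (unary u) * p j"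
proof -
  have j: "\<not> r + j \<le> r" "r + j \<noteq> m" using assms unfolding m_def by auto
  show 1: "(s, \<omega>) \<in> G.block (r + j) \<longleftrightarrow> \<omega> \<in> lists {if s then - p j else p j}" for s \<omega>
    using j unfolding G.block_def X_def states_def by auto
  assume "u \<in> G.block (r + j)"
  then show "G.block_weight (r + j) u = of_int (unary u) * p j"
    using 1[of "fst u" "snd u"] j sum_list_const[of "snd u" "if fst u then - p j else p j"]
    unfolding G.block_weight_def unary_def \<alpha>_def by (auto simp: algebra_simps)
qed

lemma block_pad: "(s, \<omega>) \<in> G.block m \<longleftrightarrow> \<not> s \<and> \<omega> \<in> lists {0}"
  "u \<in> G.block m \<Longrightarrow> G.block_weight m u = 0"
proof -
  show 1: "(s, \<omega>) \<in> G.block m \<longleftrightarrow> \<not> s \<and> \<omega> \<in> lists {0}" for s \<omega>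
    unfolding G.block_def X_def states_def m_def by auto
  assume "u \<in> G.block m"
  then show "G.block_weight m u = 0"
    using 1[of "fst u" "snd u"] sum_list_const[of "snd u" 0] unfolding G.block_weight_def \<alpha>_def by simp
qed

definition words :: "nat \<Rightarrow> int \<Rightarrow> int \<Rightarrow> (bool \<times> real list) set" where
  "words i A B = {u \<in> G.block i. xcount i u = A - B \<and> ycount i u = B}"

text \<open>The ordinary values come from words with \<open>A - B\<close> letters \<open>x i\<close>
  and \<open>B\<close> letters \<open>y i\<close>, the value 1 at \<open>(-1, 0)\<close> from the
  empty word in the second state.\<close>

lemma card_words:
  assumes "i \<in> {1..r}" shows "card (words i A B) = int_binom A B"
proof -
  have blk: "(s, \<omega>) \<in> G.block i \<longleftrightarrow> (if s then \<omega> = [] else \<omega> \<in> lists {x i, y i})" for s \<omega>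
    using assms unfolding G.block_def X_def states_def m_def by auto
  consider "0 \<le> B" "B \<le> A" | "A = -1" "B = 0" | "\<not> (0 \<le> B \<and> B \<le> A)" "\<not> (A = -1 \<and> B = 0)" by blast
  then show ?thesis
  proof cases
    case 1
    have eq: "words i A B = Pair False ` {\<omega> \<in> lists {x i, y i}. count_list \<omega> (x i) = nat (A - B) \<and> count_list \<omega> (y i) = nat B}"
      using 1 by (auto simp: words_def blk xcount_def ycount_def split: if_splits)
    have "card (words i A B) = (nat (A - B) + nat B) choose nat B"
    proof -
      have "card (Pair False ` A) = card A" for A :: "real list set" by (rule card_image) (auto intro: inj_onI)
      then show ?thesis
        unfolding eq using card_two_letter_words[OF x_neq_y[OF assms]] by simp
    qed
    also have "nat (A - B) + nat B = nat A" using 1 by simp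
    finally show ?thesis using 1 by (simp add: int_binom_def)
  next
    case 2
    then have "words i A B = {(True, [])}"
      by (auto simp: words_def blk xcount_def ycount_def split: if_splits)
    then show ?thesis using 2 by (simp add: int_binom_def)
  next
    case 3
    then have "words i A B = {}"
      by (auto simp: words_def blk xcount_def ycount_def split: if_splits)
    then show ?thesis using 3 by (auto simp: int_binom_def)
  qed
qed

definition summand :: "nat \<Rightarrow> (nat \<Rightarrow> int) \<Rightarrow> nat" where
  "summand n v = (\<Prod>i=1..r. int_binom (upper i v n) (lower i v n))"

definition encodings :: "nat \<Rightarrow> nat \<Rightarrow> (nat \<Rightarrow> bool \<times> real list) set" where
  "encodings n M = {\<beta> \<in> PiE {1..m} G.block. 1 + (\<Sum>i=1..m. 1 + length (snd (\<beta> i))) = M \<and>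
     (\<Sum>i=1..m. G.block_weight i (\<beta> i)) = real n * slope + start}"

definition decode :: "(nat \<Rightarrow> bool \<times> real list) \<Rightarrow> (nat \<Rightarrow> int) \<times> (nat \<Rightarrow> bool \<times> real list)" where
  "decode \<beta> = (restrict (\<lambda>j. unary (\<beta> (r + j))) {1..d}, restrict \<beta> {1..r})"

definition decoded :: "nat \<Rightarrow> ((nat \<Rightarrow> int) \<times> (nat \<Rightarrow> bool \<times> real list)) set" where
  "decoded n = Sigma {v \<in> int_vectors d. summand n v \<noteq> 0} (\<lambda>v. PiE {1..r} (\<lambda>i. words i (upper i v n) (lower i v n)))"

text \<open>After \<open>comb_upper_lower\<close> has cancelled the unary levels, rational
  independence turns the one equation for the total weight into equations for all letter
  counts.\<close>

lemma weight_iff: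
  assumes \<beta>: "\<beta> \<in> PiE {1..m} G.block" and v: "\<And>j. j \<in> {1..d} \<Longrightarrow> v j = unary (\<beta> (r + j))"
  shows "(\<Sum>i=1..m. G.block_weight i (\<beta> i)) = real n * slope + start \<longleftrightarrow>
    (\<forall>i\<in>{1..r}. \<beta> i \<in> words i (upper i v n) (lower i v n))"
proof -
  have mem: "\<beta> i \<in> G.block i" if "i \<in> {1..m}" for i using \<beta> that by auto
  have "(\<Sum>i=1..m. G.block_weight i (\<beta> i)) = comb (\<lambda>i. xcount i (\<beta> i)) (\<lambda>i. ycount i (\<beta> i)) + (\<Sum>j=1..d. of_int (v j) * p j)"
  proof -
    have "(\<Sum>i=1..r. G.block_weight i (\<beta> i)) = comb (\<lambda>i. xcount i (\<beta> i)) (\<lambda>i. ycount i (\<beta> i))"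
      unfolding comb_def using mem by (intro sum.cong refl block_word(1)) (auto simp: m_def)
    moreover have "(\<Sum>j=1..d. G.block_weight (r + j) (\<beta> (r + j))) = (\<Sum>j=1..d. of_int (v j) * p j)"
      using mem v by (intro sum.cong refl) (auto simp: m_def block_unary(2))
    moreover have "G.block_weight m (\<beta> m) = 0" using mem[of m] by (intro block_pad(2)) (auto simp: m_def)
    ultimately show ?thesis using sum_split_levels[of "\<lambda>i. G.block_weight i (\<beta> i)" r d] unfolding m_def by simp
  qed
  then have "(\<Sum>i=1..m. G.block_weight i (\<beta> i)) = real n * slope + start \<longleftrightarrow>
      comb (\<lambda>i. xcount i (\<beta> i)) (\<lambda>i. ycount i (\<beta> i)) = comb (\<lambda>i. upper i v n - lower i v n) (\<lambda>i. lower i v n)"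
    using comb_upper_lower[of v n] by linarith
  also have "\<dots> \<longleftrightarrow> (\<forall>i\<in>{1..r}. xcount i (\<beta> i) = upper i v n - lower i v n \<and> ycount i (\<beta> i) = lower i v n)"
  proof
    assume "comb (\<lambda>i. xcount i (\<beta> i)) (\<lambda>i. ycount i (\<beta> i)) = comb (\<lambda>i. upper i v n - lower i v n) (\<lambda>i. lower i v n)"
    then have "of_int 0 + of_int 0 * \<eta> + comb (\<lambda>i. xcount i (\<beta> i)) (\<lambda>i. ycount i (\<beta> i)) =
        of_int 0 + of_int 0 * \<eta> + comb (\<lambda>i. upper i v n - lower i v n) (\<lambda>i. lower i v n)" by simp
    from comb_inj[OF this] show "\<forall>i\<in>{1..r}. xcount i (\<beta> i) = upper i v n - lower i v n \<and> ycount i (\<beta> i) = lower i v n" by blast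
  next
    assume "\<forall>i\<in>{1..r}. xcount i (\<beta> i) = upper i v n - lower i v n \<and> ycount i (\<beta> i) = lower i v n"
    then show "comb (\<lambda>i. xcount i (\<beta> i)) (\<lambda>i. ycount i (\<beta> i)) = comb (\<lambda>i. upper i v n - lower i v n) (\<lambda>i. lower i v n)"
      unfolding comb_def by (intro sum.cong refl) simp
  qed
  also have "\<dots> \<longleftrightarrow> (\<forall>i\<in>{1..r}. \<beta> i \<in> words i (upper i v n) (lower i v n))"
    using mem unfolding words_def m_def by auto
  finally show ?thesis .
qed

lemma words_nonempty:
  assumes "i \<in> {1..r}" "u \<in> words i A B" shows "int_binom A B \<noteq> 0"
proof (cases "fst u")
  case True
  then show ?thesis using assms(2) unfolding int_binom_nonzero_iff words_def xcount_def ycount_def by auto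
next
  case False
  then have "A - B \<ge> 0" "B \<ge> 0" using assms(2) unfolding words_def xcount_def ycount_def by auto
  then show ?thesis unfolding int_binom_nonzero_iff by auto
qed

lemma words_length:
  assumes "i \<in> {1..r}" "u \<in> words i A B" shows "int (length (snd u)) \<le> \<bar>A\<bar>"
proof (cases "fst u")
  case True
  then show ?thesis using block_word(3)[of i u] assms unfolding words_def by auto
next
  case False
  then show ?thesis using block_word(2)[of i u] assms unfolding words_def by auto
qed

text \<open>Decoding forgets the padding, whose length is determined by the prescribed number
  \<open>M\<close> of edges; \<open>bound\<close> ensures that this length is not negative. For each
  \<open>v\<close>, the words on the levels up to \<open>r\<close> are then counted by the
  binomials.\<close>

lemma card_encodings:
  assumes fin: "finite {v \<in> int_vectors d. summand n v \<noteq> 0}"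
    and bound: "\<And>v. v \<in> int_vectors d \<Longrightarrow> summand n v \<noteq> 0 \<Longrightarrow>
      (\<Sum>j=1..d. \<bar>v j\<bar>) + (\<Sum>i=1..r. \<bar>upper i v n\<bar>) + int m + 1 \<le> int M"
  shows "card (encodings n M) = (\<Sum>v\<in>{v \<in> int_vectors d. summand n v \<noteq> 0}. summand n v)"
proof -
  have len_split: "(\<Sum>i=1..m. 1 + length (snd (\<beta> i))) = m + (\<Sum>i=1..r. length (snd (\<beta> i))) +
      (\<Sum>j=1..d. length (snd (\<beta> (r + j)))) + length (snd (\<beta> m))" for \<beta> :: "nat \<Rightarrow> bool \<times> real list"
    using sum_split_levels[of "\<lambda>i. length (snd (\<beta> i))" r d] unfolding sum.distrib m_def by simp
  have "bij_betw decode (encodings n M) (decoded n)"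
    unfolding bij_betw_def
  proof (intro conjI subset_antisym subsetI)
    show "inj_on decode (encodings n M)"
    proof (rule inj_onI)
      fix \<beta> \<gamma> assume \<beta>: "\<beta> \<in> encodings n M" and \<gamma>: "\<gamma> \<in> encodings n M" and eq: "decode \<beta> = decode \<gamma>"
      have mem: "\<beta> k \<in> G.block k" "\<gamma> k \<in> G.block k" if "k \<in> {1..m}" for k
        using \<beta> \<gamma> that unfolding encodings_def by auto
      have eqs: "restrict (\<lambda>j. unary (\<beta> (r + j))) {1..d} = restrict (\<lambda>j. unary (\<gamma> (r + j))) {1..d}"
        "restrict \<beta> {1..r} = restrict \<gamma> {1..r}"
        using eq unfolding decode_def prod.inject by blast+
      have low: "\<beta> k = \<gamma> k" if "k \<in> {1..r}" for k
        using fun_cong[OF eqs(2), of k] that by simp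
      have mid: "\<beta> (r + j) = \<gamma> (r + j)" if j: "j \<in> {1..d}" for j
      proof -
        have un: "unary (\<beta> (r + j)) = unary (\<gamma> (r + j))" using fun_cong[OF eqs(1), of j] j by simp
        obtain s \<omega> s' \<omega>' where sw: "\<beta> (r + j) = (s, \<omega>)" "\<gamma> (r + j) = (s', \<omega>')" by fastforce
        have k: "r + j \<in> {1..m}" using j unfolding m_def by auto
        have l: "\<omega> \<in> lists {if s then - p j else p j}" "\<omega>' \<in> lists {if s' then - p j else p j}"
          using mem[OF k] block_unary(1)[OF j] unfolding sw by auto
        \<comment> \<open>The two states represent disjoint ranges, the integers at least 0 and
          those at most -1.\<close>
        have "s = s' \<and> length \<omega> = length \<omega>'" using un unfolding sw unary_def by (auto split: if_splits)
        then have "\<omega> = \<omega>'" using l lists_singleton[of \<omega>] lists_singleton[of \<omega>'] by simp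
        then show ?thesis using \<open>s = s' \<and> _\<close> sw by simp
      qed
      have "length (snd (\<beta> m)) = length (snd (\<gamma> m))"
      proof -
        have "(\<Sum>i=1..m. 1 + length (snd (\<beta> i))) = (\<Sum>i=1..m. 1 + length (snd (\<gamma> i)))"
          using \<beta> \<gamma> unfolding encodings_def by auto
        moreover have "(\<Sum>i=1..r. length (snd (\<beta> i))) = (\<Sum>i=1..r. length (snd (\<gamma> i)))" using low by (intro sum.cong) auto
        moreover have "(\<Sum>j=1..d. length (snd (\<beta> (r + j)))) = (\<Sum>j=1..d. length (snd (\<gamma> (r + j))))" using mid by (intro sum.cong) auto
        ultimately show ?thesis unfolding len_split by simp
      qed
      moreover obtain s \<omega> s' \<omega>' where sw: "\<beta> m = (s, \<omega>)" "\<gamma> m = (s', \<omega>')" by fastforce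
      moreover have "m \<in> {1..m}" unfolding m_def by auto
      ultimately have last: "\<beta> m = \<gamma> m"
        using mem[of m] lists_singleton[of \<omega> 0] lists_singleton[of \<omega>' 0] by (simp add: block_pad(1))
      show "\<beta> = \<gamma>"
      proof
        fix k
        consider "k \<in> {1..r}" | "k \<in> {1..m}" "r < k" "k < m" | "k = m" | "k \<notin> {1..m}" unfolding m_def by force
        then show "\<beta> k = \<gamma> k"
        proof cases
          case 2
          then have "k - r \<in> {1..d}" "r + (k - r) = k" unfolding m_def by auto
          then show ?thesis using mid[of "k - r"] by simp
        next
          case 4
          then show ?thesis using \<beta> \<gamma> unfolding encodings_def PiE_def extensional_def by auto
        qed (use low last in auto)
      qed
    qed
    show "z \<in> decoded n" if z: "z \<in> decode ` encodings n M" for z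
    proof -
      obtain \<beta> where \<beta>: "z = decode \<beta>" "\<beta> \<in> encodings n M" using z by blast
      let ?v = "restrict (\<lambda>j. unary (\<beta> (r + j))) {1..d}"
      have w: "\<forall>i\<in>{1..r}. \<beta> i \<in> words i (upper i ?v n) (lower i ?v n)"
        using \<beta>(2) weight_iff[of \<beta> ?v n] unfolding encodings_def by simp
      have "int_binom (upper i ?v n) (lower i ?v n) \<noteq> 0" if i: "i \<in> {1..r}" for i
        using words_nonempty[OF i] w i by blast
      then have "summand n ?v \<noteq> 0" unfolding summand_def by simp
      then show ?thesis using w unfolding \<beta>(1) decode_def decoded_def int_vectors_def by auto
    qed
    show "z \<in> decode ` encodings n M" if z: "z \<in> decoded n" for z
    proof -
      obtain v u where vu: "z = (v, u)" "v \<in> int_vectors d" "summand n v \<noteq> 0" "u \<in> PiE {1..r} (\<lambda>i. words i (upper i v n) (lower i v n))"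
        using z unfolding decoded_def by blast
      define mid where "mid = (\<lambda>j. if v j \<ge> 0 then (False, replicate (nat (v j)) (p j)) else (True, replicate (nat (- 1 - v j)) (- p j)))"
      define L where "L = (\<Sum>i=1..r. length (snd (u i))) + (\<Sum>j=1..d. length (snd (mid j)))"
      have "int L + int m + 1 \<le> int M"
      proof -
        have "(\<Sum>i=1..r. int (length (snd (u i)))) \<le> (\<Sum>i=1..r. \<bar>upper i v n\<bar>)"
        proof (rule sum_mono)
          fix i assume i: "i \<in> {1..r}"
          show "int (length (snd (u i))) \<le> \<bar>upper i v n\<bar>" using words_length[OF i PiE_mem[OF vu(4) i]] .
        qed
        moreover have "(\<Sum>j=1..d. int (length (snd (mid j)))) \<le> (\<Sum>j=1..d. \<bar>v j\<bar>)"
          unfolding mid_def by (intro sum_mono) auto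
        ultimately show ?thesis using bound[OF vu(2,3)] unfolding L_def by simp
      qed
      then have L: "L + m + 1 \<le> M" by linarith
      define \<beta> where "\<beta> = restrict (\<lambda>k. if k \<le> r then u k else if k = m then (False, replicate (M - 1 - m - L) 0) else mid (k - r)) {1..m}"
      have \<beta>1: "\<beta> i = u i" if "i \<in> {1..r}" for i using that unfolding \<beta>_def m_def by auto
      have \<beta>2: "\<beta> (r + j) = mid j" if "j \<in> {1..d}" for j using that unfolding \<beta>_def m_def by auto
      have \<beta>3: "\<beta> m = (False, replicate (M - 1 - m - L) 0)" unfolding \<beta>_def m_def by auto
      have un: "unary (mid j) = v j" for j unfolding mid_def unary_def by auto
      have "\<beta> k \<in> G.block k" if "k \<in> {1..m}" for k
      proof -
        consider "k \<in> {1..r}" | "r < k" "k < m" | "k = m" using \<open>k \<in> {1..m}\<close> by force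
        then show ?thesis
        proof cases
          case 1
          then show ?thesis using \<beta>1[OF 1] PiE_mem[OF vu(4) 1] unfolding words_def by simp
        next
          case 2
          then have j: "k - r \<in> {1..d}" "k = r + (k - r)" unfolding m_def by auto
          have "mid (k - r) \<in> G.block (r + (k - r))" unfolding mid_def using block_unary(1)[OF j(1)] by auto
          then show ?thesis using \<beta>2[OF j(1)] j(2) by metis
        next
          case 3
          then show ?thesis using \<beta>3 block_pad(1) by auto
        qed
      qed
      then have \<beta>P: "\<beta> \<in> PiE {1..m} G.block" unfolding \<beta>_def by auto
      have "(\<Sum>i=1..m. G.block_weight i (\<beta> i)) = real n * slope + start"
      proof (subst weight_iff[OF \<beta>P])
        show "v j = unary (\<beta> (r + j))" if "j \<in> {1..d}" for j using \<beta>2[OF that] un by simp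
        show "\<forall>i\<in>{1..r}. \<beta> i \<in> words i (upper i v n) (lower i v n)" using \<beta>1 PiE_mem[OF vu(4)] by simp
      qed
      moreover have "1 + (\<Sum>i=1..m. 1 + length (snd (\<beta> i))) = M"
      proof -
        have "(\<Sum>i=1..r. length (snd (\<beta> i))) + (\<Sum>j=1..d. length (snd (\<beta> (r + j)))) = L"
          unfolding L_def using \<beta>1 \<beta>2 by (intro arg_cong2[where f = "(+)"] sum.cong) auto
        then show ?thesis unfolding len_split \<beta>3 using L by simp
      qed
      ultimately have "\<beta> \<in> encodings n M" using \<beta>P unfolding encodings_def by blast
      moreover have "decode \<beta> = (v, u)"
      proof -
        have "restrict (\<lambda>j. unary (\<beta> (r + j))) {1..d} = v"
          using vu(2) \<beta>2 un unfolding int_vectors_def by (intro ext) (auto simp: PiE_def extensional_def restrict_def)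
        moreover have "restrict \<beta> {1..r} = u" using vu(4) \<beta>1 by (intro ext) (auto simp: PiE_def extensional_def restrict_def)
        ultimately show ?thesis unfolding decode_def by simp
      qed
      ultimately show ?thesis using vu(1) by (metis imageI)
    qed
  qed
  then have "card (encodings n M) = card (decoded n)" by (rule bij_betw_same_card)
  also have "\<dots> = (\<Sum>v\<in>{v \<in> int_vectors d. summand n v \<noteq> 0}. card (PiE {1..r} (\<lambda>i. words i (upper i v n) (lower i v n))))"
    unfolding decoded_def
  proof (rule card_SigmaI[OF fin], intro ballI)
    fix v assume "v \<in> {v \<in> int_vectors d. summand n v \<noteq> 0}"
    then have "card (words i (upper i v n) (lower i v n)) \<noteq> 0" if "i \<in> {1..r}" for i
      using that card_words unfolding summand_def by auto
    then show "finite (PiE {1..r} (\<lambda>i. words i (upper i v n) (lower i v n)))"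
      by (intro finite_PiE) (auto intro: card_ge_0_finite)
  qed
  also have "\<dots> = (\<Sum>v\<in>{v \<in> int_vectors d. summand n v \<noteq> 0}. summand n v)"
    unfolding summand_def by (intro sum.cong refl) (simp add: card_PiE card_words)
  finally show ?thesis .
qed

end

section \<open>From weights to lengths\<close>

context multisum
begin

text \<open>All weights lie in the lattice, so that \<open>comb_inj\<close> applies to the total
  length of any walk.\<close>

lemma edge_weight_comb:
  assumes "e \<in> G.edges" shows "\<exists>c c'. fst (snd e) = comb c c'"
proof -
  have u: "\<exists>c c'. - t = comb c c'" "\<exists>c c'. t = comb c c'" if "t = comb c c'" for t c c'
  proof -
    show "\<exists>c c'. t = comb c c'" using that by blast
    have "- t = comb (\<lambda>i. - 1 * c i) (\<lambda>i. - 1 * c' i)" unfolding comb_scale that by simp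
    then show "\<exists>c c'. - t = comb c c'" by blast
  qed
  have 0: "\<exists>c c'. 0 = comb c c'" using comb_0 by metis
  have x: "\<exists>c c'. x k = comb c c'" "\<exists>c c'. y k = comb c c'" "\<exists>c c'. - x k = comb c c'" if "k \<in> {1..r}" for k
    using comb_unit[OF that] u by metis+
  have p: "\<exists>c c'. p j = comb c c'" "\<exists>c c'. - p j = comb c c'" for j
    using u[OF refl] unfolding p_def minus_minus by blast+
  have al: "\<exists>c c'. \<alpha> k s = comb c c'" if "k \<in> {1..m}" for k s
    using 0 x[of k] p that unfolding \<alpha>_def by auto
  have lo: "\<exists>c c'. t = comb c c'" if "t \<in> X k s" "k \<in> {1..m}" for t k s
    using 0 x[of k] p that unfolding X_def by (auto split: if_splits)
  from assms show ?thesis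
  proof (cases rule: G.edge_cases)
    case (enter k s u)
    then show ?thesis using al by simp
  next
    case (loop k s t)
    then show ?thesis using lo by simp
  next
    case (exit s)
    then show ?thesis using 0 by simp
  qed
qed

lemma walk_weight_comb:
  assumes "es \<in> lists G.edges" shows "\<exists>c c'. sum_list (map (\<lambda>e. fst (snd e)) es) = comb c c'"
  using assms
proof (induction es)
  case Nil
  then show ?case using comb_0 by (metis list.simps(8) sum_list.Nil)
next
  case (Cons e es)
  obtain c c' where 1: "fst (snd e) = comb c c'" using edge_weight_comb Cons by blast
  obtain g g' where 2: "sum_list (map (\<lambda>e. fst (snd e)) es) = comb g g'" using Cons by blast
  have "sum_list (map (\<lambda>e. fst (snd e)) (e # es)) = comb (\<lambda>i. c i + g i) (\<lambda>i. c' i + g' i)"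
    unfolding comb_add by (simp add: 1 2)
  then show ?case by blast
qed

theorem multisum_tile_counting:
  assumes s: "\<And>n. has_finite_sum (\<lambda>v. \<Prod>i=1..r. int_binom
      ((\<Sum>j=1..d. a i j * v j) + a' i * int n + a'' i)
      ((\<Sum>j=1..d. b i j * v j) + b' i * int n + b'' i)) (int_vectors d) (f n)"
  shows "f \<in> tile_counting_functions"
proof -
  have sm: "has_finite_sum (summand n) (int_vectors d) (f n)" for n
    using s[of n] unfolding summand_def upper_def lower_def .
  then have fin: "finite {v \<in> int_vectors d. summand n v \<noteq> 0}"
    and fn: "f n = (\<Sum>v\<in>{v \<in> int_vectors d. summand n v \<noteq> 0}. summand n v)" for n
    unfolding has_finite_sum_def by blast+
  have "\<exists>K. \<forall>n v. summand n v \<noteq> 0 \<longrightarrow> (\<Sum>j=1..d. \<bar>v j\<bar>) + (\<Sum>i=1..r. \<bar>upper i v n\<bar>) \<le> K * (int n + 1)"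
    unfolding summand_def upper_def lower_def
    by (rule support_bound) (rule fin[unfolded summand_def upper_def lower_def])
  then obtain K0 where K0: "\<And>n v. summand n v \<noteq> 0 \<Longrightarrow> (\<Sum>j=1..d. \<bar>v j\<bar>) + (\<Sum>i=1..r. \<bar>upper i v n\<bar>) \<le> K0 * (int n + 1)"
    by blast
  \<comment> \<open>With this \<open>K\<close>, \<open>K * (n + 1)\<close> edges suffice for every
    vector in the support at \<open>n\<close>, including the \<open>m + 1\<close> edges of a round
    that are not loops.\<close>
  define K where "K = nat \<bar>K0\<bar> + m + 1"
  have bound: "(\<Sum>j=1..d. \<bar>v j\<bar>) + (\<Sum>i=1..r. \<bar>upper i v n\<bar>) + int m + 1 \<le> int (K * (n + 1))" if "summand n v \<noteq> 0" for n v
  proof -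
    have "K0 * (int n + 1) \<le> \<bar>K0\<bar> * (int n + 1)" by (intro mult_right_mono) auto
    moreover have "int m + 1 \<le> (int m + 1) * (int n + 1)" by (simp add: algebra_simps)
    moreover have "int (K * (n + 1)) = \<bar>K0\<bar> * (int n + 1) + (int m + 1) * (int n + 1)"
      unfolding K_def by (simp add: algebra_simps)
    ultimately show ?thesis using K0[OF that] by linarith
  qed
  have cnt: "f n = card (encodings n (K * (n + 1)))" for n
    using card_encodings[OF fin bound] fn by simp
  \<comment> \<open>\<open>N\<close> outweighs all other terms; this makes the lengths,
    \<open>D\<close> and \<open>\<epsilon>\<close> below nonnegative or positive as
    required.\<close>
  obtain N :: nat where N: "real N > \<bar>\<eta>\<bar> + \<bar>slope\<bar> + \<bar>start\<bar> + (\<Sum>e\<in>G.edges. \<bar>fst (snd e)\<bar>)"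
    using reals_Archimedean2 by blast
  have Nw: "real N > \<bar>\<eta>\<bar> + \<bar>slope\<bar> + \<bar>start\<bar>" "\<And>e. e \<in> G.edges \<Longrightarrow> real N > \<bar>\<eta>\<bar> + \<bar>fst (snd e)\<bar>"
  proof -
    have "(\<Sum>e\<in>G.edges. \<bar>fst (snd e)\<bar>) \<ge> 0" by (intro sum_nonneg) auto
    then show "real N > \<bar>\<eta>\<bar> + \<bar>slope\<bar> + \<bar>start\<bar>" using N by linarith
    fix e assume "e \<in> G.edges"
    then have "\<bar>fst (snd e)\<bar> \<le> (\<Sum>e\<in>G.edges. \<bar>fst (snd e)\<bar>)" using G.finite_edges by (intro member_le_sum) auto
    then show "real N > \<bar>\<eta>\<bar> + \<bar>fst (snd e)\<bar>" using N by linarith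
  qed
  have "real N * 1 \<le> real N * real K" unfolding K_def by (intro mult_left_mono) auto
  then have NK: "real N \<le> real N * real K" by simp
  \<comment> \<open>Before scaling, the step from \<open>n\<close> to \<open>n + 1\<close> adds
    \<open>K\<close> edges of basic length \<open>N\<close> and the weight \<open>slope\<close>;
    division by \<open>D\<close> makes this increment 1.\<close>
  define D where "D = real N * real K + slope"
  have D: "D > 0" unfolding D_def using NK Nw(1) by linarith
  \<comment> \<open>The scaled length of one round with \<open>K\<close> edges and weight
    \<open>start\<close>, the target for \<open>n = 0\<close>.\<close>
  define \<epsilon> where "\<epsilon> = (real N * real K + \<eta> + start) / D"
  have \<epsilon>: "\<epsilon> \<ge> 0" unfolding \<epsilon>_def using D NK Nw(1) by (intro divide_nonneg_pos) linarith+
  \<comment> \<open>Every edge contributes \<open>N\<close>, so the integer part counts edges; edges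
    out of 0 also contribute \<open>\<eta>\<close>, which counts rounds.\<close>
  define len where "len = (\<lambda>e::edge. (real N + (if fst e = 0 then \<eta> else 0) + fst (snd e)) / D)"
  define \<phi> where "\<phi> = (\<lambda>e::edge. (fst e, len e, snd (snd e)))"
  have inj: "inj \<phi>"
  proof (rule injI)
    fix e g assume "\<phi> e = \<phi> g"
    then have "fst e = fst g" "len e = len g" "snd (snd e) = snd (snd g)" unfolding \<phi>_def by auto
    then show "e = g" unfolding len_def using D by (simp add: prod_eq_iff)
  qed
  have pos: "fst (snd e) > 0" if e: "e \<in> \<phi> ` G.edges" for e
  proof -
    obtain g where g: "g \<in> G.edges" "e = \<phi> g" using e by blast
    have "real N + (if fst g = 0 then \<eta> else 0) + fst (snd g) > 0" using Nw(2)[OF g(1)] by auto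
    then show ?thesis using D unfolding g(2) \<phi>_def len_def by simp
  qed
  obtain T where T: "finite T" "\<And>t. t \<in> T \<Longrightarrow> tile t \<and> tall t"
    "\<And>z. z \<ge> 0 \<Longrightarrow> card (tilings T z) =
      card {es \<in> lists (\<phi> ` G.edges). walk fst (\<lambda>e. snd (snd e)) 0 es 0 \<and> sum_list (map (\<lambda>e. fst (snd e)) es) = z}"
    by (rule walks_are_tilings[OF finite_imageI[OF G.finite_edges, of \<phi>] pos]) (assumption, rule that)
  have total: "sum_list (map len es) = (real N * real (length es) + real (length (filter (\<lambda>e. fst e = 0) es)) * \<eta> +
      sum_list (map (\<lambda>e. fst (snd e)) es)) / D" for es
    by (induction es) (auto simp: len_def add_divide_distrib algebra_simps)
  have walk: "walk fst (\<lambda>e. snd (snd e)) u (map \<phi> es) v \<longleftrightarrow> walk fst (\<lambda>e. snd (snd e)) u es v" for u es v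
    unfolding walk_map by (simp add: \<phi>_def o_def)
  have "tile_count T \<epsilon> n = f n" for n
  proof -
    have target: "real n + \<epsilon> = (real N * real (K * (n + 1)) + \<eta> + (real n * slope + start)) / D"
      unfolding \<epsilon>_def using D by (simp add: field_simps) (simp add: D_def algebra_simps)
    \<comment> \<open>By independence the coefficients of 1 and \<open>\<eta>\<close> and the
      lattice parts can be compared separately.\<close>
    have iff: "sum_list (map len es) = real n + \<epsilon> \<longleftrightarrow> length (filter (\<lambda>e. fst e = 0) es) = 1 \<and> length es = K * (n + 1) \<and>
        sum_list (map (\<lambda>e. fst (snd e)) es) = real n * slope + start" if es: "es \<in> lists G.edges" for es
    proof -
      obtain c c' where c: "sum_list (map (\<lambda>e. fst (snd e)) es) = comb c c'" using walk_weight_comb[OF es] by blast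
      obtain g g' where g: "real n * slope + start = comb g g'"
      proof -
        have "real n * slope + start = comb (\<lambda>i. int n * (a' i - b' i) + (a'' i - b'' i)) (\<lambda>i. int n * b' i + b'' i)"
          unfolding comb_add comb_scale slope_def start_def by simp
        then show thesis using that by blast
      qed
      have "sum_list (map len es) = real n + \<epsilon> \<longleftrightarrow>
          of_int (int N * int (length es)) + of_int (int (length (filter (\<lambda>e. fst e = 0) es))) * \<eta> + comb c c' =
          of_int (int N * int (K * (n + 1))) + of_int 1 * \<eta> + comb g g'"
        unfolding total target c g using D by simp
      also have "\<dots> \<longleftrightarrow> int N * int (length es) = int N * int (K * (n + 1)) \<and>
          int (length (filter (\<lambda>e. fst e = 0) es)) = 1 \<and> comb c c' = comb g g'"
      proof
        assume eq: "of_int (int N * int (length es)) + of_int (int (length (filter (\<lambda>e. fst e = 0) es))) * \<eta> + comb c c' =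
          of_int (int N * int (K * (n + 1))) + of_int 1 * \<eta> + comb g g'"
        from comb_inj[OF eq] show "int N * int (length es) = int N * int (K * (n + 1)) \<and>
          int (length (filter (\<lambda>e. fst e = 0) es)) = 1 \<and> comb c c' = comb g g'"
          unfolding comb_def by (auto intro!: sum.cong)
      next
        assume "int N * int (length es) = int N * int (K * (n + 1)) \<and>
          int (length (filter (\<lambda>e. fst e = 0) es)) = 1 \<and> comb c c' = comb g g'"
        then show "of_int (int N * int (length es)) + of_int (int (length (filter (\<lambda>e. fst e = 0) es))) * \<eta> + comb c c' =
          of_int (int N * int (K * (n + 1))) + of_int 1 * \<eta> + comb g g'" by (simp only:)
      qed
      also have "\<dots> \<longleftrightarrow> length (filter (\<lambda>e. fst e = 0) es) = 1 \<and> length es = K * (n + 1) \<and> comb c c' = comb g g'"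
      proof -
        have "N \<noteq> 0" using Nw(1) by auto
        then have "int N * int (length es) = int N * int (K * (n + 1)) \<longleftrightarrow> length es = K * (n + 1)"
          by (metis mult_cancel_left of_nat_eq_0_iff of_nat_eq_iff)
        then show ?thesis by auto
      qed
      finally show ?thesis unfolding c g .
    qed
    let ?W = "{es \<in> lists G.edges. walk fst (\<lambda>e. snd (snd e)) 0 es 0 \<and> length (filter (\<lambda>e. fst e = 0) es) = 1 \<and>
        length es = K * (n + 1) \<and> sum_list (map (\<lambda>e. fst (snd e)) es) = real n * slope + start}"
    have adv: "sum_list (map (\<lambda>e. fst (snd e)) (map \<phi> es)) = sum_list (map len es)" for es
      unfolding map_map by (simp add: \<phi>_def o_def)
    have "{es \<in> lists (\<phi> ` G.edges). walk fst (\<lambda>e. snd (snd e)) 0 es 0 \<and> sum_list (map (\<lambda>e. fst (snd e)) es) = real n + \<epsilon>} =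
        map \<phi> ` {es \<in> lists G.edges. walk fst (\<lambda>e. snd (snd e)) 0 es 0 \<and> sum_list (map len es) = real n + \<epsilon>}"
    proof -
      have "{es \<in> map \<phi> ` lists G.edges. Q es} = map \<phi> ` {es \<in> lists G.edges. Q (map \<phi> es)}" for Q by blast
      from this[of "\<lambda>es. walk fst (\<lambda>e. snd (snd e)) 0 es 0 \<and> sum_list (map (\<lambda>e. fst (snd e)) es) = real n + \<epsilon>"]
      show ?thesis unfolding lists_image walk adv .
    qed
    also have "{es \<in> lists G.edges. walk fst (\<lambda>e. snd (snd e)) 0 es 0 \<and> sum_list (map len es) = real n + \<epsilon>} = ?W"
      using iff by blast
    finally have "card (tilings T (real n + \<epsilon>)) = card (map \<phi> ` ?W)" using T(3)[of "real n + \<epsilon>"] \<epsilon> by simp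
    also have "\<dots> = card ?W"
      by (rule card_image) (rule inj_on_subset[OF inj_mapI[OF inj] subset_UNIV])
    also have "\<dots> = card (encodings n (K * (n + 1)))"
      unfolding encodings_def by (rule G.card_closed_walks)
    finally show ?thesis unfolding tile_count_def cnt .
  qed
  then have "f = tile_count T \<epsilon>" by (intro ext) simp
  then show ?thesis unfolding tile_counting_functions_def using T \<epsilon> by blast
qed

end

theorem multisum_imp_tile_counting:
  fixes f :: "nat \<Rightarrow> nat" and a b :: "nat \<Rightarrow> nat \<Rightarrow> int" and a' b' a'' b'' :: "nat \<Rightarrow> int"
  assumes "\<And>n. has_finite_sum (\<lambda>v. \<Prod>i=1..r. int_binom
      ((\<Sum>j=1..d. a i j * v j) + a' i * int n + a'' i)
      ((\<Sum>j=1..d. b i j * v j) + b' i * int n + b'' i)) (int_vectors d) (f n)"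
  shows "f \<in> tile_counting_functions"
proof -
  \<comment> \<open>\<open>None\<close> is the index of \<open>\<eta>\<close>;
    \<open>Some (i, False)\<close> and \<open>Some (i, True)\<close> are those of \<open>x i\<close>
    and \<open>y i\<close>.\<close>
  let ?I = "insert None (Some ` ({1..r} \<times> (UNIV :: bool set)))"
  have "finite ?I" by simp
  obtain g :: "(nat \<times> bool) option \<Rightarrow> real" where g: "\<forall>c c0. of_int c0 + (\<Sum>i\<in>?I. of_int (c i) * g i) = 0 \<longrightarrow> c0 = 0 \<and> (\<forall>i\<in>?I. c i = 0)"
    using independent_reals[OF \<open>finite ?I\<close>] by (rule exE)
  interpret multisum r d a b a' b' a'' b'' "g None" "\<lambda>i. g (Some (i, False))" "\<lambda>i. g (Some (i, True))"
  proof
    fix c0 c1 :: int and c e :: "nat \<Rightarrow> int"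
    assume z: "of_int c0 + of_int c1 * g None + (\<Sum>i=1..r. of_int (c i) * g (Some (i, False)) + of_int (e i) * g (Some (i, True))) = 0"
    let ?c = "\<lambda>q. case q of None \<Rightarrow> c1 | Some (i, s) \<Rightarrow> if s then e i else c i"
    have "(\<Sum>q\<in>Some ` ({1..r} \<times> (UNIV :: bool set)). of_int (?c q) * g q) =
        (\<Sum>q\<in>{1..r} \<times> (UNIV :: bool set). of_int (?c (Some q)) * g (Some q))"
      by (subst sum.reindex) auto
    also have "\<dots> = (\<Sum>i=1..r. \<Sum>s\<in>UNIV. of_int (?c (Some (i, s))) * g (Some (i, s)))"
      by (subst sum.cartesian_product) (simp only: case_prod_unfold prod.collapse)
    also have "\<dots> = (\<Sum>i=1..r. of_int (c i) * g (Some (i, False)) + of_int (e i) * g (Some (i, True)))"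
      by (intro sum.cong refl) (simp add: UNIV_bool)
    finally have "(\<Sum>q\<in>?I. of_int (?c q) * g q) = of_int c1 * g None +
        (\<Sum>i=1..r. of_int (c i) * g (Some (i, False)) + of_int (e i) * g (Some (i, True)))"
      by (subst sum.insert) auto
    then have "of_int c0 + (\<Sum>q\<in>?I. of_int (?c q) * g q) = 0" using z by (simp only: add.assoc)
    then have *: "c0 = 0 \<and> (\<forall>q\<in>?I. ?c q = 0)" by (rule g[rule_format])
    have "?c None = 0" "\<And>i s. i \<in> {1..r} \<Longrightarrow> ?c (Some (i, s)) = 0" using * by blast+
    from this(1) this(2)[of _ False] this(2)[of _ True]
    show "c0 = 0 \<and> c1 = 0 \<and> (\<forall>i\<in>{1..r}. c i = 0 \<and> e i = 0)" using * by simp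
  qed
  show ?thesis using assms by (rule multisum_tile_counting)
qed

theorem theorem1p3:
  fixes f :: "nat \<Rightarrow> nat"
  shows "f \<in> tile_counting_functions \<longleftrightarrow>
    (\<exists>(r::nat) (d::nat) (a :: nat \<Rightarrow> nat \<Rightarrow> int) (b :: nat \<Rightarrow> nat \<Rightarrow> int)
       (a' :: nat \<Rightarrow> int) (b' :: nat \<Rightarrow> int) (a'' :: nat \<Rightarrow> int) (b'' :: nat \<Rightarrow> int).
       \<forall>n::nat.
         has_finite_sum
           (\<lambda>v. \<Prod>i=1..r. int_binom
              ((\<Sum>j=1..d. a i j * v j) + a' i * int n + a'' i)
              ((\<Sum>j=1..d. b i j * v j) + b' i * int n + b'' i))
           (int_vectors d) (f n))"
proof (rule iffI, goal_cases)
  case 1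
  then obtain J :: "(nat set, nat) sum_var set" and Gs where J: "finite J"
    "\<And>n. has_finite_sum (\<lambda>v. binom_term J Gs v (int n) 1) (J \<rightarrow>\<^sub>E UNIV) (f n)"
    using tile_counting_imp_multisum by blast
  then show ?case by (rule binom_multisum_standard)
next
  case 2
  then show ?case using multisum_imp_tile_counting by blast
qed

end
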